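(* Let $\varphi:\mathfrak{n}\to\mathbb{C}$ be a good character. For any maximal ideal $\mathfrak{m}$ of $S(Z)=\mathbb{C}[x_{(1,0)}]$, the $\mathcal{B}$-module $L_{\varphi,\mathfrak{m}}=M_\varphi/\mathfrak{m}M_\varphi$ is simple, and any simple Whittaker module of type $\varphi$ is of this form (i.e. isomorphic to $L_{\varphi,\mathfrak{m}}$ for some maximal ideal $\mathfrak{m}$ of $S(Z)$).
   Context: Let $\mathcal{B}$ be the complex Lie algebra with basis $\{x_{(a,i)} : a\in\mathbb{Z},\ i\in\mathbb{N}\}$, $\mathbb{N}=\{0,1,2,\dots\}$, and bracket $[x_{(a,i)},x_{(b,j)}]=\big((b-1)i-(a-1)j\big)x_{(a+b,\,i+j-1)}$ (the coefficient is $0$ when $i=j=0$). Let $\mathfrak{n}=\mathrm{Span}_{\mathbb{C}}\{x_{(a,i)} : a+i>1\}$, a Lie subalgebra. Let $Z=\mathbb{C}x_{(1,0)}$ be the center of $\mathcal{B}$ and $S(Z)=\mathbb{C}[x_{(1,0)}]\subset\mathcal{U}(\mathcal{B})$, where $\mathcal{U}(\cdot)$ denotes the universal enveloping algebra. Let $\varphi:\mathfrak{n}\to\mathbb{C}$ be a Lie algebra homomorphism ($\mathbb{C}$ abelian). It is nonsingular if $\varphi(x_{(a,i)})\neq 0$ for all $(a,i)$ with $i\ge 0$ and $a+i=2$. For integers $n\ge1$, $s\ge 1$, let $H^{(n,s)}$ be the $\infty\times(n+1)$ matrix with rows indexed by $m\ge1$ and columns by $0\le j\le n$, whose $(m,j)$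 entry is $\varphi(x_{(2-a,a)})$ with $a=m+j+s-1$. The homomorphism $\varphi$ is a good character if it is nonsingular and $\mathrm{rank}(H^{(n,s)})=n+1$ for all $n\ge1$, $s\ge1$. For a $\mathcal{B}$-module $V$, a vector $v\in V$ is a Whittaker vector of type $\varphi$ if $xv=\varphi(x)v$ for all $x\in\mathfrak{n}$; $V$ is a Whittaker module of type $\varphi$ if it is generated by a Whittaker vector of type $\varphi$. Let $\mathbb{C}_\varphi$ be the one-dimensional $\mathfrak{n}$-module on which $x\in\mathfrak{n}$ acts by $\varphi(x)$, and $M_\varphi=\mathcal{U}(\mathcal{B})\otimes_{\mathcal{U}(\mathfrak{n})}\mathbb{C}_\varphi$. *)

theory Defs
  imports "HOL-Algebra.Algebra" "HOL-Algebra.Algebraic_Closure_Type"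
    "HOL-Algebra.Free_Abelian_Groups" "HOL-Library.Function_Algebras"
begin

section \<open>Complex Lie algebras and their modules\<close>

abbreviation complex_field :: "complex ring"
  where "complex_field \<equiv> ring_of_type_algebra"

text \<open>
  As usual in HOL-Algebra, a record extending \<^typ>\<open>('a, 'b) module\<close> inherits the fields
  \<^const>\<open>monoid.mult\<close> and \<^const>\<open>monoid.one\<close>; they play no role for modules and are left
  \<^const>\<open>undefined\<close> where there is no product. The fields are meaningful only on the carrier.
\<close>

record 'g lie_alg = "(complex, 'g) module" +
  lie_bracket :: "'g \<Rightarrow> 'g \<Rightarrow> 'g"

record ('g, 'v) lie_mod = "(complex, 'v) module" +
  act :: "'g \<Rightarrow> 'v \<Rightarrow> 'v"

definition lie_hom :: "('g, 'x) lie_alg_scheme \<Rightarrow> ('h, 'y) lie_alg_scheme \<Rightarrow> ('g \<Rightarrow> 'h) \<Rightarrow> bool"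
  where "lie_hom L K f \<longleftrightarrow>
    f \<in> carrier L \<rightarrow> carrier K \<and>
    (\<forall>x\<in>carrier L. \<forall>y\<in>carrier L. f (x \<oplus>\<^bsub>L\<^esub> y) = f x \<oplus>\<^bsub>K\<^esub> f y) \<and>
    (\<forall>c. \<forall>x\<in>carrier L. f (c \<odot>\<^bsub>L\<^esub> x) = c \<odot>\<^bsub>K\<^esub> f x) \<and>
    (\<forall>x\<in>carrier L. \<forall>y\<in>carrier L. f (lie_bracket L x y) = lie_bracket K (f x) (f y))"

definition abelian_line :: "complex lie_alg"
  where "abelian_line =
    \<lparr>carrier = UNIV, monoid.mult = (*), monoid.one = 1, ring.zero = 0, ring.add = (+), module.smult = (*),
     lie_bracket = (\<lambda>_ _. 0)\<rparr>"

locale lie_module = Module.module complex_field V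
  for L :: "('g, 'x) lie_alg_scheme" and V :: "('g, 'v, 'y) lie_mod_scheme" +
  assumes act_closed: "x \<in> carrier L \<Longrightarrow> v \<in> carrier V \<Longrightarrow> act V x v \<in> carrier V"
    and act_add_left: "x \<in> carrier L \<Longrightarrow> y \<in> carrier L \<Longrightarrow> v \<in> carrier V \<Longrightarrow>
      act V (x \<oplus>\<^bsub>L\<^esub> y) v = act V x v \<oplus>\<^bsub>V\<^esub> act V y v"
    and act_scale_left: "x \<in> carrier L \<Longrightarrow> v \<in> carrier V \<Longrightarrow>
      act V (c \<odot>\<^bsub>L\<^esub> x) v = c \<odot>\<^bsub>V\<^esub> act V x v"
    and act_add_right: "x \<in> carrier L \<Longrightarrow> v \<in> carrier V \<Longrightarrow> w \<in> carrier V \<Longrightarrow>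
      act V x (v \<oplus>\<^bsub>V\<^esub> w) = act V x v \<oplus>\<^bsub>V\<^esub> act V x w"
    and act_scale_right: "x \<in> carrier L \<Longrightarrow> v \<in> carrier V \<Longrightarrow>
      act V x (c \<odot>\<^bsub>V\<^esub> v) = c \<odot>\<^bsub>V\<^esub> act V x v"
    and act_bracket: "x \<in> carrier L \<Longrightarrow> y \<in> carrier L \<Longrightarrow> v \<in> carrier V \<Longrightarrow>
      act V (lie_bracket L x y) v = act V x (act V y v) \<ominus>\<^bsub>V\<^esub> act V y (act V x v)"

definition lie_submodule ::
    "('g, 'x) lie_alg_scheme \<Rightarrow> ('g, 'v, 'y) lie_mod_scheme \<Rightarrow> 'v set \<Rightarrow> bool"
  where "lie_submodule L V W \<longleftrightarrow>
    submodule W complex_field V \<and> (\<forall>x\<in>carrier L. \<forall>w\<in>W. act V x w \<in> W)"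

definition simple_lie_module ::
    "('g, 'x) lie_alg_scheme \<Rightarrow> ('g, 'v, 'y) lie_mod_scheme \<Rightarrow> bool"
  where "simple_lie_module L V \<longleftrightarrow>
    lie_module L V \<and> carrier V \<noteq> {\<zero>\<^bsub>V\<^esub>} \<and>
    (\<forall>W. lie_submodule L V W \<longrightarrow> W = {\<zero>\<^bsub>V\<^esub>} \<or> W = carrier V)"

definition lie_module_isomorphic ::
    "('g, 'x) lie_alg_scheme \<Rightarrow> ('g, 'v, 'y) lie_mod_scheme \<Rightarrow> ('g, 'w, 'z) lie_mod_scheme \<Rightarrow> bool"
  where "lie_module_isomorphic L V W \<longleftrightarrow>
    (\<exists>f. bij_betw f (carrier V) (carrier W) \<and>
      (\<forall>u\<in>carrier V. \<forall>v\<in>carrier V. f (u \<oplus>\<^bsub>V\<^esub> v) = f u \<oplus>\<^bsub>W\<^esub> f v) \<and>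
      (\<forall>c. \<forall>v\<in>carrier V. f (c \<odot>\<^bsub>V\<^esub> v) = c \<odot>\<^bsub>W\<^esub> f v) \<and>
      (\<forall>x\<in>carrier L. \<forall>v\<in>carrier V. f (act V x v) = act W x (f v)))"


section \<open>Quotients of modules and algebras\<close>

text \<open>
  If \<open>M\<close> is an associative algebra and \<open>N\<close> a two-sided ideal, this is the quotient algebra.
  If \<open>M\<close> is a left module over a not necessarily commutative ring and \<open>N\<close> a submodule,
  it is the quotient module.
\<close>

definition quot_module :: "('a, 'm, 'x) module_scheme \<Rightarrow> 'm set \<Rightarrow> ('a, 'm set) module"
  where "quot_module M N =
    \<lparr>carrier = carrier (M Quot N), monoid.mult = monoid.mult (M Quot N), monoid.one = monoid.one (M Quot N),
     ring.zero = ring.zero (M Quot N), ring.add = ring.add (M Quot N),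
     module.smult = (\<lambda>a C. \<Union>x\<in>C. N +>\<^bsub>M\<^esub> (a \<odot>\<^bsub>M\<^esub> x))\<rparr>"


section \<open>The universal enveloping algebra\<close>

definition scale :: "complex \<Rightarrow> ('k \<Rightarrow>\<^sub>0 complex) \<Rightarrow> ('k \<Rightarrow>\<^sub>0 complex)"
  where "scale c f = Poly_Mapping.map ((*) c) f"

datatype 'a free_monoid = Word (letters: "'a list")

instantiation free_monoid :: (type) monoid_add
begin

definition zero_free_monoid :: "'a free_monoid"
  where "zero_free_monoid = Word []"

definition plus_free_monoid :: "'a free_monoid \<Rightarrow> 'a free_monoid \<Rightarrow> 'a free_monoid"
  where "plus_free_monoid u v = Word (letters u @ letters v)"

instance
  by intro_classes (simp_all add: zero_free_monoid_def plus_free_monoid_def)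

end

text \<open>
  The free associative algebra on the \<^emph>\<open>set\<close> \<open>carrier L\<close>: the product of
  \<^type>\<open>poly_mapping\<close> over \<^typ>\<open>'g free_monoid\<close> is the convolution product of
  noncommutative polynomials.
\<close>

definition free_alg :: "('g, 'x) lie_alg_scheme \<Rightarrow> (complex, 'g free_monoid \<Rightarrow>\<^sub>0 complex) module"
  where "free_alg L =
    \<lparr>carrier = {f. \<forall>w\<in>Poly_Mapping.keys f. set (letters w) \<subseteq> carrier L},
     monoid.mult = (*), monoid.one = 1, ring.zero = 0, ring.add = (+), module.smult = scale\<rparr>"

definition gen :: "'g \<Rightarrow> 'g free_monoid \<Rightarrow>\<^sub>0 complex"
  where "gen x = Poly_Mapping.single (Word [x]) 1"

text \<open>
  The first two families of relations turn the free algebra on the set \<open>carrier L\<close> into the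
  tensor algebra of the vector space \<open>L\<close>, the third one turns the latter into \<open>U(L)\<close>.
\<close>

definition env_relations :: "('g, 'x) lie_alg_scheme \<Rightarrow> ('g free_monoid \<Rightarrow>\<^sub>0 complex) set"
  where "env_relations L =
    {gen (x \<oplus>\<^bsub>L\<^esub> y) - (gen x + gen y) | x y. x \<in> carrier L \<and> y \<in> carrier L} \<union>
    {gen (c \<odot>\<^bsub>L\<^esub> x) - scale c (gen x) | c x. x \<in> carrier L} \<union>
    {gen x * gen y - gen y * gen x - gen (lie_bracket L x y) | x y.
       x \<in> carrier L \<and> y \<in> carrier L}"

definition env_ideal :: "('g, 'x) lie_alg_scheme \<Rightarrow> ('g free_monoid \<Rightarrow>\<^sub>0 complex) set"
  where "env_ideal L = genideal (free_alg L) (env_relations L)"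

definition univ_env :: "('g, 'x) lie_alg_scheme \<Rightarrow> (complex, ('g free_monoid \<Rightarrow>\<^sub>0 complex) set) module"
  where "univ_env L = quot_module (free_alg L) (env_ideal L)"

definition env_incl :: "('g, 'x) lie_alg_scheme \<Rightarrow> 'g \<Rightarrow> ('g free_monoid \<Rightarrow>\<^sub>0 complex) set"
  where "env_incl L x = env_ideal L +>\<^bsub>free_alg L\<^esub> gen x"

text \<open>
  For a subalgebra \<open>K\<close> of \<open>L\<close>, the canonical map \<open>U(K) \<rightarrow> U(L)\<close>: it sends the class of \<open>f\<close>
  modulo \<open>env_ideal K\<close> to the class of \<open>f\<close> modulo \<open>env_ideal L\<close>.
\<close>

definition env_map :: "('g, 'x) lie_alg_scheme \<Rightarrow>
    ('g free_monoid \<Rightarrow>\<^sub>0 complex) set \<Rightarrow> ('g free_monoid \<Rightarrow>\<^sub>0 complex) set"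
  where "env_map L C = env_ideal L <+>\<^bsub>free_alg L\<^esub> C"

text \<open>The left \<open>U(L)\<close>-module defined by a Lie module \<open>V\<close> over \<open>L\<close>, and the Lie
  module defined by a left \<open>U(L)\<close>-module, the scalars acting through \<open>\<complex> \<rightarrow> U(L)\<close>.\<close>

definition free_act ::
    "('g, 'v, 'y) lie_mod_scheme \<Rightarrow> ('g free_monoid \<Rightarrow>\<^sub>0 complex) \<Rightarrow> 'v \<Rightarrow> 'v"
  where "free_act V f v =
    (\<Oplus>\<^bsub>V\<^esub>w\<in>Poly_Mapping.keys f. Poly_Mapping.lookup f w \<odot>\<^bsub>V\<^esub> foldr (act V) (letters w) v)"

definition env_module ::
    "('g, 'v, 'y) lie_mod_scheme \<Rightarrow> (('g free_monoid \<Rightarrow>\<^sub>0 complex) set, 'v) module"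
  where "env_module V =
    \<lparr>carrier = carrier V, monoid.mult = undefined, monoid.one = undefined,
     ring.zero = \<zero>\<^bsub>V\<^esub>, ring.add = (\<oplus>\<^bsub>V\<^esub>),
     module.smult = (\<lambda>C v. the_elem ((\<lambda>f. free_act V f v) ` C))\<rparr>"

definition restrict_to_lie :: "('g, 'x) lie_alg_scheme \<Rightarrow>
    (('g free_monoid \<Rightarrow>\<^sub>0 complex) set, 'v, 'y) module_scheme \<Rightarrow> ('g, 'v) lie_mod"
  where "restrict_to_lie L W =
    \<lparr>carrier = carrier W, monoid.mult = undefined, monoid.one = undefined,
     ring.zero = \<zero>\<^bsub>W\<^esub>, ring.add = (\<oplus>\<^bsub>W\<^esub>),
     module.smult = (\<lambda>c v. (c \<odot>\<^bsub>univ_env L\<^esub> \<one>\<^bsub>univ_env L\<^esub>) \<odot>\<^bsub>W\<^esub> v),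
     act = (\<lambda>x v. env_incl L x \<odot>\<^bsub>W\<^esub> v)\<rparr>"


section \<open>Tensor products over noncommutative rings and induced modules\<close>

text \<open>
  In this section a right \<open>A\<close>-module \<open>M\<close> is represented by a record in which
  \<open>a \<odot>\<^bsub>M\<^esub> m\<close> stands for \<open>m \<cdot> a\<close>.
\<close>

definition tensor_relations :: "('a, 'r) ring_scheme \<Rightarrow> ('a, 'm, 'x) module_scheme \<Rightarrow>
    ('a, 'n, 'y) module_scheme \<Rightarrow> ('m \<times> 'n \<Rightarrow>\<^sub>0 int) set"
  where "tensor_relations A M N =
    {frag_of (m \<oplus>\<^bsub>M\<^esub> m', n) - frag_of (m, n) - frag_of (m', n) | m m' n.
       m \<in> carrier M \<and> m' \<in> carrier M \<and> n \<in> carrier N} \<union>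
    {frag_of (m, n \<oplus>\<^bsub>N\<^esub> n') - frag_of (m, n) - frag_of (m, n') | m n n'.
       m \<in> carrier M \<and> n \<in> carrier N \<and> n' \<in> carrier N} \<union>
    {frag_of (a \<odot>\<^bsub>M\<^esub> m, n) - frag_of (m, a \<odot>\<^bsub>N\<^esub> n) | a m n.
       a \<in> carrier A \<and> m \<in> carrier M \<and> n \<in> carrier N}"

definition tensor_subgroup :: "('a, 'r) ring_scheme \<Rightarrow> ('a, 'm, 'x) module_scheme \<Rightarrow>
    ('a, 'n, 'y) module_scheme \<Rightarrow> ('m \<times> 'n \<Rightarrow>\<^sub>0 int) set"
  where "tensor_subgroup A M N =
    generate (free_Abelian_group (carrier M \<times> carrier N)) (tensor_relations A M N)"

text \<open>
  The tensor product of \<open>M\<close> and \<open>N\<close> over \<open>A\<close> as a left module over a second ring, where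
  \<open>l u m\<close> is a left action of that ring on \<open>M\<close> commuting with the right action of \<open>A\<close>.
\<close>

definition tensor_module :: "('a, 'r) ring_scheme \<Rightarrow> ('u \<Rightarrow> 'm \<Rightarrow> 'm) \<Rightarrow>
    ('a, 'm, 'x) module_scheme \<Rightarrow> ('a, 'n, 'y) module_scheme \<Rightarrow>
    ('u, ('m \<times> 'n \<Rightarrow>\<^sub>0 int) set) module"
  where "tensor_module A l M N =
    (let F = free_Abelian_group (carrier M \<times> carrier N);
         R = tensor_subgroup A M N;
         T = F Mod R
     in \<lparr>carrier = carrier T, monoid.mult = undefined, monoid.one = undefined,
         ring.zero = monoid.one T, ring.add = monoid.mult T,
         module.smult = (\<lambda>u C. \<Union>f\<in>C. R #>\<^bsub>F\<^esub> frag_extend (\<lambda>(m, n). frag_of (l u m, n)) f)\<rparr>)"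

definition env_right_module :: "('g, 'x) lie_alg_scheme \<Rightarrow>
    (('g free_monoid \<Rightarrow>\<^sub>0 complex) set, ('g free_monoid \<Rightarrow>\<^sub>0 complex) set) module"
  where "env_right_module L =
    \<lparr>carrier = carrier (univ_env L), monoid.mult = undefined, monoid.one = undefined,
     ring.zero = \<zero>\<^bsub>univ_env L\<^esub>, ring.add = (\<oplus>\<^bsub>univ_env L\<^esub>),
     module.smult = (\<lambda>a u. u \<otimes>\<^bsub>univ_env L\<^esub> env_map L a)\<rparr>"

text \<open>The left \<open>U(L)\<close>-module induced by a module \<open>V\<close> over the subalgebra \<open>K\<close> of \<open>L\<close>.\<close>

definition induced_module :: "('g, 'x) lie_alg_scheme \<Rightarrow> ('g, 'z) lie_alg_scheme \<Rightarrow>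
    ('g, 'v, 'y) lie_mod_scheme \<Rightarrow>
    (('g free_monoid \<Rightarrow>\<^sub>0 complex) set,
     (('g free_monoid \<Rightarrow>\<^sub>0 complex) set \<times> 'v \<Rightarrow>\<^sub>0 int) set) module"
  where "induced_module L K V =
    tensor_module (univ_env K) (\<otimes>\<^bsub>univ_env L\<^esub>) (env_right_module L) (env_module V)"


section \<open>The Lie algebra \<open>\<B>\<close> and its subalgebra \<open>\<nn>\<close>\<close>

type_synonym bvec = "int \<times> nat \<Rightarrow>\<^sub>0 complex"

definition bx :: "int \<Rightarrow> nat \<Rightarrow> bvec"
  where "bx a i = Poly_Mapping.single (a, i) 1"

text \<open>
  Truncated subtraction in \<^term>\<open>i + j - 1\<close> only matters for \<^prop>\<open>i = 0 \<and> j = 0\<close>,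
  where the coefficient vanishes.
\<close>

definition b_bracket :: "bvec \<Rightarrow> bvec \<Rightarrow> bvec"
  where "b_bracket f g =
    (\<Sum>(a, i)\<in>Poly_Mapping.keys f. \<Sum>(b, j)\<in>Poly_Mapping.keys g.
       scale (Poly_Mapping.lookup f (a, i) * Poly_Mapping.lookup g (b, j) *
              of_int ((b - 1) * int i - (a - 1) * int j))
         (bx (a + b) (i + j - 1)))"

definition b_alg :: "bvec lie_alg"
  where "b_alg =
    \<lparr>carrier = UNIV, monoid.mult = undefined, monoid.one = undefined, ring.zero = 0, ring.add = (+), module.smult = scale,
     lie_bracket = b_bracket\<rparr>"

definition n_alg :: "bvec lie_alg"
  where "n_alg = b_alg\<lparr>carrier := module.span scale {bx a i | a i. a + int i > 1}\<rparr>"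

definition center_b :: "bvec set"
  where "center_b = module.span scale {bx 1 0}"

text \<open>
  \<open>S(Z)\<close> as a subalgebra of \<open>U(\<B>)\<close>: the subring generated by the scalars and \<open>Z\<close>.
\<close>

definition sym_center :: "(complex, (bvec free_monoid \<Rightarrow>\<^sub>0 complex) set) module"
  where "sym_center = (univ_env b_alg)\<lparr>carrier :=
    generate_ring (univ_env b_alg)
      (range (\<lambda>c. c \<odot>\<^bsub>univ_env b_alg\<^esub> \<one>\<^bsub>univ_env b_alg\<^esub>) \<union> env_incl b_alg ` center_b)\<rparr>"


section \<open>Good characters\<close>

text \<open>
  The rank of a matrix with (possibly infinite) row index set \<open>I\<close> and column index set \<open>J\<close> is
  the dimension of the span of its columns, columns being extended by zero outside \<open>I\<close>.
\<close>

definition matrix_rank :: "'i set \<Rightarrow> 'j set \<Rightarrow> ('i \<Rightarrow> 'j \<Rightarrow> complex) \<Rightarrow> nat"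
  where "matrix_rank I J A =
    vector_space.dim (\<lambda>c (f :: 'i \<Rightarrow> complex) i. c * f i)
      ((\<lambda>j i. if i \<in> I then A i j else 0) ` J)"

definition nonsingular :: "(bvec \<Rightarrow> complex) \<Rightarrow> bool"
  where "nonsingular \<phi> \<longleftrightarrow> (\<forall>a i. a + int i = 2 \<longrightarrow> \<phi> (bx a i) \<noteq> 0)"

definition hankel :: "(bvec \<Rightarrow> complex) \<Rightarrow> nat \<Rightarrow> nat \<Rightarrow> nat \<Rightarrow> complex"
  where "hankel \<phi> s m j = (let a = m + j + s - 1 in \<phi> (bx (2 - int a) a))"

definition good_character :: "(bvec \<Rightarrow> complex) \<Rightarrow> bool"
  where "good_character \<phi> \<longleftrightarrow>
    lie_hom n_alg abelian_line \<phi> \<and> nonsingular \<phi> \<and>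
    (\<forall>n\<ge>1. \<forall>s\<ge>1. matrix_rank {1..} {0..n} (hankel \<phi> s) = n + 1)"


section \<open>Whittaker modules\<close>

definition whittaker_vector :: "(bvec \<Rightarrow> complex) \<Rightarrow> (bvec, 'v, 'y) lie_mod_scheme \<Rightarrow> 'v \<Rightarrow> bool"
  where "whittaker_vector \<phi> V v \<longleftrightarrow>
    v \<in> carrier V \<and> (\<forall>x\<in>carrier n_alg. act V x v = \<phi> x \<odot>\<^bsub>V\<^esub> v)"

definition whittaker_module :: "(bvec \<Rightarrow> complex) \<Rightarrow> (bvec, 'v, 'y) lie_mod_scheme \<Rightarrow> bool"
  where "whittaker_module \<phi> V \<longleftrightarrow>
    lie_module b_alg V \<and>
    (\<exists>v. whittaker_vector \<phi> V v \<and> \<Inter>{W. lie_submodule b_alg V W \<and> v \<in> W} = carrier V)"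

definition one_dim_module :: "(bvec \<Rightarrow> complex) \<Rightarrow> (bvec, complex) lie_mod"
  where "one_dim_module \<phi> =
    \<lparr>carrier = UNIV, monoid.mult = undefined, monoid.one = undefined, ring.zero = 0, ring.add = (+), module.smult = (*),
     act = (\<lambda>x c. \<phi> x * c)\<rparr>"

type_synonym whittaker_vec =
  "((bvec free_monoid \<Rightarrow>\<^sub>0 complex) set \<times> complex \<Rightarrow>\<^sub>0 int) set"

definition universal_whittaker :: "(bvec \<Rightarrow> complex) \<Rightarrow>
    ((bvec free_monoid \<Rightarrow>\<^sub>0 complex) set, whittaker_vec) module"
  where "universal_whittaker \<phi> = induced_module b_alg n_alg (one_dim_module \<phi>)"

definition ideal_times_module :: "'u set \<Rightarrow> ('u, 'm, 'x) module_scheme \<Rightarrow> 'm set"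
  where "ideal_times_module I M =
    generate (add_monoid M) {z \<odot>\<^bsub>M\<^esub> v | z v. z \<in> I \<and> v \<in> carrier M}"

definition whittaker_quotient :: "(bvec \<Rightarrow> complex) \<Rightarrow>
    (bvec free_monoid \<Rightarrow>\<^sub>0 complex) set set \<Rightarrow> (bvec, whittaker_vec set) lie_mod"
  where "whittaker_quotient \<phi> \<mm> =
    (let M = universal_whittaker \<phi>
     in restrict_to_lie b_alg (quot_module M (ideal_times_module \<mm> M)))"

end

theory Submission
  imports Defs "HOL-Computational_Algebra.Fundamental_Theorem_Algebra"
begin

text \<open>
  Put \<open>y d i = x_(1+d-i, i)\<close> (\<open>yb\<close> below); then \<open>[y d i, y e j] = (e i - d j) y (d+e) (i+j-1)\<close>, so \<open>\<B>\<close> is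
  graded by \<open>d\<close>, the subalgebra \<open>\<nn>\<close> is the part of degree at least 1, a character of \<open>\<nn>\<close> lives in
  degree 1, and the center is spanned by \<open>z = y 0 0\<close>.

  Filter a module generated by a Whittaker vector by giving \<open>y (-k) i\<close> the weight \<open>k + 1\<close>. On the
  associated graded, which is a quotient of the polynomial ring \<open>A\<close> in the \<open>y (-k) i\<close> other than \<open>z\<close>,
  the operator \<open>x - \<phi> x\<close> for \<open>x = y d j\<close> with \<open>d \<ge> 1\<close> acts as a derivation lowering the weight by \<open>d\<close>.
  Let \<open>P\<close> be nonconstant in \<open>A\<close>, and \<open>K\<close> the largest \<open>k\<close> occurring in \<open>P\<close>. If \<open>K \<ge> 1\<close>, the derivation of \<open>y K j\<close>
  sends \<open>y (-K) i\<close> to a nonzero multiple of \<open>y 0 (i+j-1)\<close>, which is a variable not occurring in \<open>P\<close> when \<open>j\<close> is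
  large, so it does not kill \<open>P\<close>. If \<open>K = 0\<close>, the derivations of the \<open>y 1 j\<close> have constant coefficients
  \<open>-i \<phi> (y 1 (i+j-1))\<close>, and the rank condition on the Hankel matrices shows that one of them does not kill \<open>P\<close>.
  Hence every nonzero submodule contains a nonzero multiple of the generator, over \<open>\<complex>\<close> if \<open>z\<close>
  acts by a scalar and over \<open>\<complex>[z]\<close> in general. The second case yields an eigenvalue of \<open>z\<close> on
  every simple Whittaker module.

  That the quotient by \<open>z - \<xi>\<close> is nonzero needs no Poincare-Birkhoff-Witt theorem: \<open>\<B>\<close> acts on the free
  algebra on the \<open>y (-k) i\<close>, elements of \<open>\<nn>\<close> being commuted through words, and the two-sided ideal
  of relations is stable and killed by the algebra homomorphism with \<open>z \<mapsto> \<xi>\<close> and all other \<open>y (-k) i \<mapsto> 0\<close>,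
  because \<open>z\<close> is not a bracket of elements of degree at most 0.
\<close>

section \<open>The leading-term descent\<close>

text \<open>The weight \<open>k + 1\<close> serves two purposes. A bracket of letters of degrees
  \<open>-k\<close> and \<open>-l\<close> is a multiple of one letter of weight
  \<open>k + l + 1\<close>, one less than the weight of their product, so letters commute up to
  lower weight. And when \<open>y d j\<close> meets a letter of degree \<open>-k\<close>, the scalar
  that appears for \<open>d = k + 1\<close> has weight 0, which is \<open>k + 1 - d\<close>, so it
  belongs to the same leading term as the letters that appear for \<open>d \<le> k\<close>. The
  associated graded of a quotient may have unknown relations, so symbols are not assumed unique.
  Some nonzero \<open>P\<close> is chosen, and the statement that \<open>P\<close> represents an
  element of lower weight is pushed through derivations until it reads \<open>a v0 \<in> W\<close>
  with \<open>a \<noteq> 0\<close>. For the eigenvalue: if \<open>z\<close> is nonzero on a simple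
  module, it is surjective, so the generator is \<open>z f\<close>. The symbol of \<open>z f\<close>
  is \<open>z\<close> times that of \<open>f\<close>, yet the generator has weight 0; the descent
  over \<open>\<complex>[z]\<close> turns this into a nonzero polynomial in \<open>z\<close> killing
  the generator. All modules are presented as quotients of the free algebra on \<B>, so that
  submodules and kernels of the tensor construction are compared as left ideals.\<close>

abbreviation "keys \<equiv> Poly_Mapping.keys"
abbreviation "lookup \<equiv> Poly_Mapping.lookup"
abbreviation "single \<equiv> Poly_Mapping.single"

type_synonym word_alg = "bvec free_monoid \<Rightarrow>\<^sub>0 complex"
type_synonym letter = "nat \<times> nat"
type_synonym letter_words = "letter list \<Rightarrow>\<^sub>0 complex"

text \<open>The scalar action is a parameter because the same extension is used with values in
  modules over \<complex>, over \<open>\<complex>[z]\<close> and over the integers, and for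
  characters with values in \<complex>.\<close>

definition linear_extension :: "('a::zero \<Rightarrow> 'b \<Rightarrow> 'b) \<Rightarrow> ('k \<Rightarrow> 'b) \<Rightarrow> ('k \<Rightarrow>\<^sub>0 'a) \<Rightarrow> 'b::comm_monoid_add"
  where "linear_extension sc f P = (\<Sum>k\<in>keys P. sc (lookup P k) (f k))"

context Modules.module
begin

lemma linear_extension_superset:
  "finite A \<Longrightarrow> keys P \<subseteq> A \<Longrightarrow>
    linear_extension scale f P = (\<Sum>k\<in>A. lookup P k *s f k)"
  unfolding linear_extension_def by (rule sum.mono_neutral_left) (auto simp: in_keys_iff)

lemma linear_extension_zero [simp]: "linear_extension scale f 0 = 0"
  by (simp add: linear_extension_def)

lemma linear_extension_single [simp]: "linear_extension scale f (single k a) = a *s f k"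
  by (cases "a = 0") (simp_all add: linear_extension_def)

lemma linear_extension_add: "linear_extension scale f (P + Q) = linear_extension scale f P + linear_extension scale f Q"
proof -
  let ?A = "keys P \<union> keys Q"
  have "linear_extension scale f (P + Q) = (\<Sum>k\<in>?A. lookup (P + Q) k *s f k)"
    by (rule linear_extension_superset) (auto simp: Poly_Mapping.keys_add)
  also have "\<dots> = linear_extension scale f P + linear_extension scale f Q"
    by (simp add: lookup_add scale_left_distrib sum.distrib linear_extension_superset[of ?A])
  finally show ?thesis .
qed

lemma linear_extension_diff: "linear_extension scale f (P - Q) = linear_extension scale f P - linear_extension scale f Q"
  using linear_extension_add[of f "P - Q" Q] by (simp add: algebra_simps)

lemma linear_extension_sum: "linear_extension scale f (sum g A) = (\<Sum>x\<in>A. linear_extension scale f (g x))"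
  by (induction A rule: infinite_finite_induct) (simp_all add: linear_extension_add)

lemma linear_extension_fun_add:
  "linear_extension scale (\<lambda>k. f k + g k) P = linear_extension scale f P + linear_extension scale g P"
  by (simp add: linear_extension_def scale_right_distrib sum.distrib)

lemma linear_extension_fun_scale:
  "linear_extension scale (\<lambda>k. a *s f k) P = a *s linear_extension scale f P"
  by (simp add: linear_extension_def scale_sum_right mult.commute)

lemma linear_extension_map:
  "linear_extension scale f (Poly_Mapping.map ((*) a) P) = a *s linear_extension scale f P"
proof -
  have "linear_extension scale f (Poly_Mapping.map ((*) a) P)
      = (\<Sum>k\<in>keys P. lookup (Poly_Mapping.map ((*) a) P) k *s f k)"
    by (rule linear_extension_superset) (auto simp: Poly_Mapping.map.rep_eq in_keys_iff when_def)
  then show ?thesis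
    by (auto simp: linear_extension_def Poly_Mapping.map.rep_eq in_keys_iff when_def scale_sum_right
        intro!: sum.cong)
qed

end

text \<open>
  The relations of \<open>\<B>\<close> and the Whittaker condition are only required modulo \<open>W\<close>: the module of
  interest is the quotient by \<open>W\<close>. The scalars \<open>'a\<close> are \<open>\<complex>\<close> or \<open>\<complex>[z]\<close>.
\<close>

locale whittaker_descent = Modules.module sc
  for sc :: "'a::{idom,ring_char_0} \<Rightarrow> 'v::ab_group_add \<Rightarrow> 'v" +
  fixes Y :: "int \<Rightarrow> nat \<Rightarrow> 'v \<Rightarrow> 'v" and W :: "'v set" and v0 :: 'v and ph :: "nat \<Rightarrow> 'a"
  assumes W: "subspace W"
    and Y_add: "Y d i (u + v) = Y d i u + Y d i v"
    and Y_scale: "Y d i (sc a v) - sc a (Y d i v) \<in> W"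
    and Y_W: "v \<in> W \<Longrightarrow> Y d i v \<in> W"
    and Y_comm: "Y d i (Y e j v) - Y e j (Y d i v)
      - sc (of_int (e * int i - d * int j)) (Y (d + e) (i + j - 1) v) \<in> W"
    and Y_v0: "1 \<le> d \<Longrightarrow> Y d i v0 - sc (if d = 1 then ph i else 0) v0 \<in> W"
    and ph_independent: "\<And>a :: nat \<Rightarrow> 'a. (\<And>j. (\<Sum>i = 1..n. a i * ph (i + j - 1)) = 0) \<Longrightarrow> i \<in> {1..n} \<Longrightarrow> a i = 0"
begin

fun letter :: "letter \<Rightarrow> 'v \<Rightarrow> 'v"
  where "letter (k, i) = Y (- int k) i"

definition word :: "letter list \<Rightarrow> 'v"
  where "word l = foldr letter l v0"

section \<open>The weight filtration; letters commute up to lower weight\<close>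

definition wt :: "letter multiset \<Rightarrow> nat"
  where "wt M = (\<Sum>b\<in>#M. fst b + 1)"

text \<open>The inequality is strict, so that modulo \<open>G (wt M)\<close> means up to lower
  weight and \<open>G 0\<close> is \<open>W\<close>. The bound is an integer because operators of
  degree \<open>d\<close> shift it by \<open>- d\<close>, possibly below 0, where \<open>G\<close>
  stays equal to \<open>W\<close>.\<close>

definition G :: "int \<Rightarrow> 'v set"
  where "G N = span ({word l | l. int (wt (mset l)) < N} \<union> W)"

lemma wt_simps [simp]: "wt {#} = 0" "wt (add_mset b M) = fst b + 1 + wt M" "wt (M + M') = wt M + wt M'"
  by (simp_all add: wt_def)

lemma word_simps [simp]: "word [] = v0" "word (b # l) = letter b (word l)"
  by (simp_all add: word_def)

lemma G_subspace [simp]: "subspace (G N)"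
  by (simp add: G_def)

lemma W_G: "w \<in> W \<Longrightarrow> w \<in> G N"
  by (simp add: G_def span_base)

lemma G_word: "int (wt (mset l)) < N \<Longrightarrow> word l \<in> G N"
  unfolding G_def by (rule span_base) auto

lemma G_mono: "v \<in> G N \<Longrightarrow> N \<le> N' \<Longrightarrow> v \<in> G N'"
  unfolding G_def by (erule rev_subsetD, rule span_mono) auto

lemma G_nonpos: "N \<le> 0 \<Longrightarrow> G N = W"
proof -
  assume "N \<le> 0"
  then have "{word l | l. int (wt (mset l)) < N} \<union> W = W" by auto
  with W show ?thesis by (simp add: G_def)
qed

lemmas G_rules = subspace_add[OF G_subspace] subspace_diff[OF G_subspace]
  subspace_scale[OF G_subspace] subspace_0[OF G_subspace]

lemma G_trans: "u - v \<in> G N \<Longrightarrow> v - w \<in> G N \<Longrightarrow> u - w \<in> G N"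
  using G_rules(1)[of "u - v" N "v - w"] by simp

lemma G_sym: "u - v \<in> G N \<Longrightarrow> v - u \<in> G N"
  using subspace_neg[OF G_subspace, of "u - v" N] by simp

lemma G_cong: "u - v \<in> G N \<Longrightarrow> u \<in> G N \<longleftrightarrow> v \<in> G N"
  using G_rules(1)[of "u - v" N v] G_rules(2)[of u N "u - v"] by auto

lemma Y_zero: "Y d i 0 = 0"
  using Y_add[of d i 0 0] by simp

lemma Y_diff: "Y d i (u - v) = Y d i u - Y d i v"
  using Y_add[of d i "u - v" v] by (simp add: algebra_simps)

lemma letter_diff: "letter b (u - v) = letter b u - letter b v"
  by (cases b) (simp add: Y_diff)

lemma letter_add: "letter b (u + v) = letter b u + letter b v"
  by (cases b) (simp add: Y_add)

lemma letter_zero: "letter b 0 = 0"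
  by (cases b) (simp add: Y_zero)

lemma letter_W: "v \<in> W \<Longrightarrow> letter b v \<in> W"
  by (cases b) (simp add: Y_W)

lemma letter_scale: "letter b (sc a v) - sc a (letter b v) \<in> W"
  by (cases b) (simp add: Y_scale)

text \<open>Span induction for maps that commute with scalars only modulo \<open>W\<close>, as the
  operators \<open>Y\<close> do; the error is harmless because \<open>W\<close> lies in every
  \<open>G N'\<close>.\<close>

lemma G_linear_closed:
  assumes "v \<in> G N"
    and word: "\<And>l. int (wt (mset l)) < N \<Longrightarrow> f (word l) \<in> G N'"
    and W: "\<And>v. v \<in> W \<Longrightarrow> f v \<in> G N'"
    and add: "\<And>u v. f (u + v) = f u + f v"
    and sc: "\<And>a v. f (sc a v) - sc a (f v) \<in> W"
  shows "f v \<in> G N'"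
proof -
  have "f 0 = 0" using add[of 0 0] by simp
  then have "subspace (Collect (\<lambda>v. f v \<in> G N'))"
    using G_cong[OF W_G[OF sc]] by (auto intro!: subspaceI simp: add G_rules)
  moreover have "v \<in> span ({word l | l. int (wt (mset l)) < N} \<union> W)"
    using assms(1) by (simp add: G_def)
  ultimately show ?thesis
    by (rule_tac span_induct) (auto intro: word W)
qed

lemma letter_G: "v \<in> G N \<Longrightarrow> N + int (fst b) + 1 \<le> N' \<Longrightarrow> letter b v \<in> G N'"
proof (erule G_linear_closed)
  fix l assume "N + int (fst b) + 1 \<le> N'" "int (wt (mset l)) < N"
  then have "word (b # l) \<in> G N'" by (intro G_word) auto
  then show "letter b (word l) \<in> G N'" by simp
qed (auto simp: W_G letter_W letter_add letter_scale)

lemma letter_comm: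
  "letter b (letter b' v) - letter b' (letter b v)
    - sc (of_int (int (fst b) * int (snd b') - int (fst b') * int (snd b)))
        (letter (fst b + fst b', snd b + snd b' - 1) v) \<in> W"
  using Y_comm[of "- int (fst b)" "snd b" "- int (fst b')" "snd b'" v]
  by (cases b; cases b') (simp add: algebra_simps)

text \<open>The commutator of two letters is a multiple of a single letter whose weight is one less
  than the sum of the two weights.\<close>

lemma word_swap: "word (b # b' # l) - word (b' # b # l) \<in> G (wt (mset (b # b' # l)))"
proof -
  let ?c = "of_int (int (fst b) * int (snd b') - int (fst b') * int (snd b))"
  let ?w = "word ((fst b + fst b', snd b + snd b' - 1) # l)"
  have "?w \<in> G (wt (mset (b # b' # l)))"
    by (intro G_word) simp
  then have "sc ?c ?w \<in> G (wt (mset (b # b' # l)))"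
    by (intro G_rules)
  moreover have "(word (b # b' # l) - word (b' # b # l)) - sc ?c ?w \<in> G (wt (mset (b # b' # l)))"
    using W_G[OF letter_comm[of b b' "word l"]] by simp
  ultimately show ?thesis
    using G_cong by blast
qed

lemma word_to_front:
  "word (l @ b # l') - word (b # l @ l') \<in> G (wt (mset (b # l @ l')))"
proof (induction l)
  case Nil
  then show ?case by (simp add: G_rules)
next
  case (Cons a l)
  have "letter a (word (l @ b # l') - word (b # l @ l')) \<in> G (wt (mset (b # (a # l) @ l')))"
    using Cons.IH by (rule letter_G) simp
  then have "word ((a # l) @ b # l') - word (a # b # l @ l') \<in> G (wt (mset (b # (a # l) @ l')))"
    by (simp only: letter_diff word_simps append_Cons)
  moreover have "word (a # b # l @ l') - word (b # a # l @ l') \<in> G (wt (mset (b # (a # l) @ l')))"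
    using word_swap[of a b "l @ l'"] by (simp add: add_ac)
  ultimately show ?case
    unfolding append_Cons by (rule G_trans)
qed

text \<open>Bring the first letter of \<open>l\<close> to the front of \<open>l'\<close> and compare
  the rest by induction. This is what turns words into monomials of a commutative polynomial
  ring.\<close>

lemma word_perm: "mset l = mset l' \<Longrightarrow> word l - word l' \<in> G (wt (mset l))"
proof (induction l arbitrary: l')
  case Nil
  then show ?case by (simp add: G_rules)
next
  case (Cons b l)
  then have "b \<in> set l'" by (metis list.set_intros(1) set_mset_mset)
  then obtain l1 l2 where l': "l' = l1 @ b # l2" by (meson split_list)
  with Cons.prems have "mset l = mset (l1 @ l2)" by simp
  then have "word l - word (l1 @ l2) \<in> G (wt (mset l))" by (rule Cons.IH)
  then have "letter b (word l - word (l1 @ l2)) \<in> G (wt (mset (b # l)))"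
    by (rule letter_G) simp
  then have "word (b # l) - word (b # l1 @ l2) \<in> G (wt (mset (b # l)))"
    by (simp add: letter_diff)
  moreover have "word (b # l1 @ l2) - word l' \<in> G (wt (mset (b # l)))"
    using G_sym[OF word_to_front[of l1 b l2]] l' Cons.prems by simp
  ultimately show ?case
    using G_trans by blast
qed

text \<open>The order of the letters is chosen arbitrarily, which matters only up to lower weight.\<close>

definition s :: "letter multiset \<Rightarrow> 'v"
  where "s M = word (SOME l. mset l = M)"

lemma word_s: "word l - s (mset l) \<in> G (wt (mset l))"
proof -
  have "mset (SOME l'. mset l' = mset l) = mset l" by (rule someI) (rule refl)
  then show ?thesis unfolding s_def using word_perm by metis
qed

lemma letter_s: "letter b (s M) - s (add_mset b M) \<in> G (int (wt (add_mset b M)))"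
proof -
  obtain l where l: "mset l = M" using ex_mset by blast
  have "letter b (word l - s M) \<in> G (int (wt (add_mset b M)))"
    using word_s[of l] l by (intro letter_G[of _ "int (wt M)"]) auto
  then have "letter b (s M) - word (b # l) \<in> G (int (wt (add_mset b M)))"
    using G_sym by (simp add: letter_diff)
  moreover have "word (b # l) - s (add_mset b M) \<in> G (int (wt (add_mset b M)))"
    using word_s[of "b # l"] l by simp
  ultimately show ?thesis by (rule G_trans)
qed

section \<open>Operators of positive degree lower the weight\<close>

definition p :: "int \<Rightarrow> nat \<Rightarrow> 'a"
  where "p d j = (if d = 1 then ph j else 0)"

lemma Y_letter:
  "Y d j (letter (k, i) v) - letter (k, i) (Y d j v)
    - sc (- of_nat (k * j) - of_int d * of_nat i) (Y (d - int k) (i + j - 1) v) \<in> W"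
  using Y_comm[of d j "- int k" i v] by (simp add: add_ac)

text \<open>Commute \<open>Y d j\<close> to the right. Passing a letter \<open>(k, i)\<close>
  produces \<open>Y (d - k)\<close>: for \<open>d \<le> k\<close> this is a letter of weight
  \<open>k - d + 1\<close>; for \<open>d > k\<close> it is again an operator of positive degree,
  covered by the induction hypothesis, and its own scalar survives only if \<open>d = k + 1\<close>,
  when the deleted letter accounts for the weight \<open>d\<close>. Since \<open>G\<close> is
  strict, the bound says that the weight drops by at least \<open>d\<close>.\<close>

lemma Y_word:
  "1 \<le> d \<Longrightarrow> Y d j (word l) - sc (p d j) (word l) \<in> G (int (wt (mset l)) - d + 1)"
proof (induction l arbitrary: d j)
  case Nil
  then show ?case using Y_v0[of d j] by (simp add: W_G p_def)
next
  case (Cons b l)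
  obtain k i where b: "b = (k, i)" by (cases b)
  let ?N = "int (wt (mset (b # l))) - d + 1"
  let ?c = "- of_nat (k * j) - of_int d * of_nat i :: 'a"
  let ?u = "Y (d - int k) (i + j - 1) (word l)"
  have 1: "letter b (Y d j (word l) - sc (p d j) (word l)) \<in> G ?N"
    using Cons.IH[OF Cons.prems] by (rule letter_G) simp
  have 2: "letter b (sc (p d j) (word l)) - sc (p d j) (word (b # l)) \<in> G ?N"
    by (simp add: W_G letter_scale)
  have 3: "?u \<in> G ?N"
  proof (cases "d \<le> int k")
    case True
    then have "?u = word ((k - nat d, i + j - 1) # l)" using Cons.prems by simp
    also have "\<dots> \<in> G ?N" using True Cons.prems by (intro G_word) (simp add: b)
    finally show ?thesis .
  next
    case False
    then have *: "?u - sc (p (d - int k) (i + j - 1)) (word l)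
        \<in> G (int (wt (mset l)) - (d - int k) + 1)"
      by (intro Cons.IH) simp
    have "?u - sc (p (d - int k) (i + j - 1)) (word l) \<in> G ?N"
      by (rule G_mono[OF *]) (simp add: b)
    moreover have "sc (p (d - int k) (i + j - 1)) (word l) \<in> G ?N"
    proof (cases "d - int k = 1")
      case True
      then show ?thesis by (intro G_rules G_word) (simp add: b)
    qed (simp add: p_def G_rules)
    ultimately show ?thesis using G_cong by blast
  qed
  have 4: "Y d j (word (b # l)) - letter b (Y d j (word l)) - sc ?c ?u \<in> G ?N"
    using W_G[OF Y_letter[of d j k i "word l"]] by (simp add: b)
  have "Y d j (word (b # l)) - letter b (Y d j (word l)) \<in> G ?N"
    using G_rules(1)[OF 4 G_rules(3)[OF 3, of ?c]] by simp
  from G_rules(1)[OF G_rules(1)[OF this 1] 2] show ?case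
    by (simp add: letter_diff)
qed

lemma Y_G:
  assumes "1 \<le> d" "v \<in> G N"
  shows "Y d j v - sc (p d j) v \<in> G (N - d)"
  using assms(2)
proof (rule G_linear_closed)
  fix l assume "int (wt (mset l)) < N"
  then show "Y d j (word l) - sc (p d j) (word l) \<in> G (N - d)"
    using Y_word[OF assms(1)] by (rule_tac G_mono) auto
next
  fix v assume "v \<in> W"
  then show "Y d j v - sc (p d j) v \<in> G (N - d)"
    by (intro G_rules W_G) (auto simp: Y_W)
next
  fix a v
  have "Y d j (sc a v) - sc (p d j) (sc a v) - sc a (Y d j v - sc (p d j) v)
    = Y d j (sc a v) - sc a (Y d j v)"
    by (simp add: scale_right_diff_distrib mult.commute)
  then show "Y d j (sc a v) - sc (p d j) (sc a v) - sc a (Y d j v - sc (p d j) v) \<in> W"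
    using Y_scale by metis
qed (simp add: Y_add scale_right_distrib)

lemma Y_G_exists:
  assumes "v \<in> G N"
  shows "\<exists>N'. Y d j v \<in> G N'"
proof (cases "1 \<le> d")
  case True
  from Y_G[OF this assms, of j] have "Y d j v - sc (p d j) v \<in> G N"
    by (rule G_mono) (use True in simp)
  with G_cong[OF this] G_rules(3)[OF assms] show ?thesis by blast
next
  case False
  then have "Y d j v = letter (nat (- d), j) v" by simp
  with letter_G[OF assms order_refl] show ?thesis by metis
qed

section \<open>Polynomial symbols and the derivations acting on them\<close>

abbreviation S :: "(letter multiset \<Rightarrow>\<^sub>0 'a) \<Rightarrow> 'v"
  where "S \<equiv> linear_extension sc s"

lemma S_sum_mset: "S (\<Sum>b\<in>#M. f b) = (\<Sum>b\<in>#M. S (f b))"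
  by (induction M) (simp_all add: linear_extension_add)

lemma letter_sum_mset: "letter b (\<Sum>b'\<in>#M. f b') = (\<Sum>b'\<in>#M. letter b (f b'))"
  by (induction M) (simp_all add: letter_add letter_zero)

lemma sum_mset_G:
  "(\<And>b. b \<in># M \<Longrightarrow> f b - g b \<in> G N) \<Longrightarrow> (\<Sum>b\<in>#M. f b) - (\<Sum>b\<in>#M. g b) \<in> G N"
proof (induction M)
  case (add b M)
  have "(f b - g b) + ((\<Sum>b\<in>#M. f b) - (\<Sum>b\<in>#M. g b)) \<in> G N"
    by (intro G_rules add) (auto intro: add.prems)
  then show ?case by (simp add: algebra_simps)
qed (simp add: G_rules)

lemma sum_G:
  "(\<And>b. b \<in> A \<Longrightarrow> f b - g b \<in> G N) \<Longrightarrow> (\<Sum>b\<in>A. f b) - (\<Sum>b\<in>A. g b) \<in> G N"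
  unfolding sum_subtractf[symmetric] by (rule subspace_sum) auto

text \<open>The structure constant of \<open>[y d j, y (-k) i]\<close> for
  \<open>b = (k, i)\<close>. Both summands have the same sign, so it is nonzero as soon as one of
  \<open>k * j\<close> and \<open>d * i\<close> is.\<close>

definition coef :: "nat \<Rightarrow> nat \<Rightarrow> letter \<Rightarrow> 'a"
  where "coef d j b = - of_nat (fst b * j + d * snd b)"

text \<open>
  \<open>contrib d j b M a\<close> is the leading term of \<open>a [y d j, b] M\<close>, where \<open>b\<close> stands for \<open>y (- fst b) (snd b)\<close>.
  The truncated subtraction only matters where the coefficient vanishes.
\<close>

definition contrib :: "nat \<Rightarrow> nat \<Rightarrow> letter \<Rightarrow> letter multiset \<Rightarrow> 'a \<Rightarrow> letter multiset \<Rightarrow>\<^sub>0 'a"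
  where "contrib d j b M a =
    (if d \<le> fst b then single (add_mset (fst b - d, snd b + j - 1) M) (a * coef d j b)
     else if fst b + 1 = d then single M (a * coef d j b * ph (snd b + j - 1))
     else 0)"

lemma S_contrib_scale: "S (contrib d j b M a) = sc a (S (contrib d j b M 1))"
  by (simp add: contrib_def linear_extension_single mult.assoc)

lemma letter_sc_s:
  assumes "int (wt (add_mset b M)) \<le> N"
  shows "letter b (sc a (s M)) - sc a (s (add_mset b M)) \<in> G N"
proof -
  have "letter b (s M) - s (add_mset b M) \<in> G N"
    using letter_s assms by (rule G_mono)
  from G_rules(3)[OF this, of a] have "sc a (letter b (s M)) - sc a (s (add_mset b M)) \<in> G N"
    by (simp add: scale_right_diff_distrib)
  with W_G[OF letter_scale] show ?thesis by (rule G_trans)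
qed

lemma letter_contrib:
  "letter b (S (contrib d j b' M a)) - S (contrib d j b' (add_mset b M) a)
    \<in> G (int (wt (add_mset b (add_mset b' M))) - int d)"
  by (cases b') (auto simp: contrib_def linear_extension_single letter_zero G_rules add_mset_commute intro!: letter_sc_s)

text \<open>The induction of \<open>Y_word\<close> with the terms of weight exactly
  \<open>wt - d\<close> retained. They come from a single commutator with one letter; reordering the
  other letters costs only lower weight.\<close>

lemma Y_word_leading:
  assumes d: "1 \<le> d"
  shows "Y (int d) j (word l) - sc (p d j) (word l)
    - (\<Sum>b\<in>#mset l. S (contrib d j b (mset l - {#b#}) 1)) \<in> G (int (wt (mset l)) - int d)"
proof (induction l)
  case Nil
  then show ?case using Y_v0[of "int d" j] d by (simp add: W_G p_def)
next
  case (Cons b l)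
  obtain k i where b: "b = (k, i)" by (cases b)
  let ?N = "int (wt (mset (b # l))) - int d"
  let ?c = "coef d j b"
  let ?u = "Y (int d - int k) (i + j - 1) (word l)"
  let ?sum = "\<lambda>l. (\<Sum>b\<in>#mset l. S (contrib d j b (mset l - {#b#}) 1))"
  have 1: "letter b (Y (int d) j (word l) - sc (p d j) (word l) - ?sum l) \<in> G ?N"
    using Cons.IH by (rule letter_G) simp
  have 2: "letter b (sc (p d j) (word l)) - sc (p d j) (word (b # l)) \<in> G ?N"
    by (simp add: W_G letter_scale)
  have 3: "letter b (?sum l) - (\<Sum>b'\<in>#mset l. S (contrib d j b' (mset (b # l) - {#b'#}) 1)) \<in> G ?N"
    unfolding letter_sum_mset
  proof (rule sum_mset_G)
    fix b' assume "b' \<in># mset l"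
    then have "mset (b # l) - {#b'#} = add_mset b (mset l - {#b'#})"
      and "wt (add_mset b (add_mset b' (mset l - {#b'#}))) = wt (mset (b # l))"
      by (simp_all add: insert_DiffM del: wt_simps)
    then show "letter b (S (contrib d j b' (mset l - {#b'#}) 1))
      - S (contrib d j b' (mset (b # l) - {#b'#}) 1) \<in> G ?N"
      using letter_contrib by metis
  qed
  have 4: "sc ?c ?u - S (contrib d j b (mset l) 1) \<in> G ?N"
  proof -
    consider "d \<le> k" | "k + 1 = d" | "k + 2 \<le> d" by linarith
    then show ?thesis
    proof cases
      case 1
      have "word ((k - d, i + j - 1) # l) - s (add_mset (k - d, i + j - 1) (mset l)) \<in> G ?N"
        using 1 word_s[of "(k - d, i + j - 1) # l"]  by (rule_tac G_mono) (auto simp: b)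
      from G_rules(3)[OF this, of ?c] show ?thesis using 1
        by (simp add: contrib_def b linear_extension_single scale_right_diff_distrib)
    next
      case 2
      have "Y 1 (i + j - 1) (word l) - sc (ph (i + j - 1)) (word l) \<in> G ?N"
        using Y_word[of 1 "i + j - 1" l] 2 by (simp add: p_def b)
      moreover have "sc (ph (i + j - 1)) (word l - s (mset l)) \<in> G ?N"
        using word_s[of l] 2 by (intro G_rules(3)) (auto simp: b)
      ultimately have "Y 1 (i + j - 1) (word l) - sc (ph (i + j - 1)) (s (mset l)) \<in> G ?N"
        unfolding scale_right_diff_distrib by (rule G_trans)
      from G_rules(3)[OF this, of ?c] show ?thesis using 2
        by (auto simp add: contrib_def b linear_extension_single scale_right_diff_distrib)
    next
      \<comment> \<open>Here \<open>d - k \<ge> 2\<close>, where the character vanishes. The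
        operator lowers the weight of \<open>l\<close> by at least \<open>d - k\<close>, so the
        result has weight below \<open>wt (mset (b # l)) - d\<close> and yields no leading
        term.\<close>
      case 3
      then have "?u \<in> G ?N"
        using Y_word[of "int d - int k" "i + j - 1" l]
        by (rule_tac G_mono[of _ "int (wt (mset l)) - (int d - int k) + 1"]) (auto simp: p_def b)
      with 3 show ?thesis
        by (simp add: contrib_def b G_rules)
    qed
  qed
  have 5: "Y (int d) j (word (b # l)) - letter b (Y (int d) j (word l)) - sc ?c ?u \<in> G ?N"
    using W_G[OF Y_letter[of "int d" j k i "word l"]] by (simp add: b coef_def)
  have "Y (int d) j (word (b # l)) - letter b (Y (int d) j (word l)) - S (contrib d j b (mset l) 1) \<in> G ?N"
    using G_trans[OF 5 4] .
  from G_rules(1)[OF G_rules(1)[OF G_rules(1)[OF this 1] 2] 3] show ?case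
    unfolding letter_diff by (simp add: algebra_simps)
qed

text \<open>Multisets of letters serve as monomials. The inner sum runs over \<open>M\<close> with
  multiplicity, which is the Leibniz rule for repeated letters.\<close>

definition D :: "nat \<Rightarrow> nat \<Rightarrow> (letter multiset \<Rightarrow>\<^sub>0 'a) \<Rightarrow> letter multiset \<Rightarrow>\<^sub>0 'a"
  where "D d j P =
    (\<Sum>M\<in>keys P. \<Sum>b\<in>#M. contrib d j b (M - {#b#}) (lookup P M))"

text \<open>The letter \<open>(0, 0)\<close> is excluded because the central element acts through the scalars.\<close>

definition homogeneous :: "nat \<Rightarrow> (letter multiset \<Rightarrow>\<^sub>0 'a) \<Rightarrow> bool"
  where "homogeneous N P \<longleftrightarrow> (\<forall>M\<in>keys P. wt M = N \<and> (0, 0) \<notin># M)"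

lemma Y_s_leading:
  assumes "1 \<le> d"
  shows "Y (int d) j (s M) - sc (p d j) (s M)
    - (\<Sum>b\<in>#M. S (contrib d j b (M - {#b#}) 1)) \<in> G (int (wt M) - int d)"
proof -
  obtain l where "mset l = M" and "s M = word l"
    unfolding s_def by (metis (mono_tags, lifting) ex_mset someI_ex)
  with Y_word_leading[OF assms, of j l] show ?thesis by simp
qed

lemma Y_sum: "Y d j (\<Sum>x\<in>A. f x) = (\<Sum>x\<in>A. Y d j (f x))"
  by (induction A rule: infinite_finite_induct) (simp_all add: Y_add Y_zero)

lemma scale_sum_mset: "sc a (\<Sum>b\<in>#M. f b) = (\<Sum>b\<in>#M. sc a (f b))"
  by (induction M) (simp_all add: scale_right_distrib)

lemma Y_S_leading:
  assumes d: "1 \<le> d" and P: "homogeneous N P"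
  shows "Y (int d) j (S P) - sc (p d j) (S P) - S (D d j P) \<in> G (int N - int d)"
proof -
  have "(\<Sum>M\<in>keys P. Y (int d) j (sc (lookup P M) (s M))
      - sc (p d j) (sc (lookup P M) (s M)))
    - (\<Sum>M\<in>keys P. S (\<Sum>b\<in>#M. contrib d j b (M - {#b#}) (lookup P M)))
    \<in> G (int N - int d)"
  proof (rule sum_G)
    fix M assume "M \<in> keys P"
    then have N: "wt M = N" using P by (simp add: homogeneous_def)
    let ?a = "lookup P M"
    have 1: "sc ?a (Y (int d) j (s M) - sc (p d j) (s M)
      - (\<Sum>b\<in>#M. S (contrib d j b (M - {#b#}) 1))) \<in> G (int N - int d)"
      using Y_s_leading[OF d, of j M] N by (intro G_rules(3)) simp
    have 2: "S (\<Sum>b\<in>#M. contrib d j b (M - {#b#}) ?a) = sc ?a (\<Sum>b\<in>#M. S (contrib d j b (M - {#b#}) 1))"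
      by (simp add: S_sum_mset scale_sum_mset S_contrib_scale[where a = "lookup P M"])
    show "Y (int d) j (sc ?a (s M)) - sc (p d j) (sc ?a (s M))
      - S (\<Sum>b\<in>#M. contrib d j b (M - {#b#}) ?a) \<in> G (int N - int d)"
      using G_rules(1)[OF W_G[OF Y_scale[of "int d" j ?a "s M"]] 1] unfolding 2
      by (simp add: algebra_simps)
  qed
  then show ?thesis
    by (simp add: linear_extension_def[of sc s P] D_def linear_extension_sum Y_sum scale_sum_right sum_subtractf)
qed

text \<open>On \<open>S P\<close> the operator \<open>Y - p\<close> agrees with \<open>D\<close>
  modulo \<open>G (N - d)\<close>. So if \<open>P\<close> represents an element of weight below
  \<open>N\<close>, then \<open>D d j P\<close> represents one of weight below \<open>N - d\<close>.
  This is the inductive step of the descent.\<close>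

lemma D_G:
  assumes "1 \<le> d" "homogeneous N P" "S P \<in> G N"
  shows "S (D d j P) \<in> G (int N - int d)"
  using G_cong[OF Y_S_leading[OF assms(1,2), of j]] Y_G[of "int d" "S P" N j] assms by simp

lemma lookup_sum_mset: "lookup (\<Sum>b\<in>#M. f b) x = (\<Sum>b\<in>#M. lookup (f b) x)"
  by (induction M) (simp_all add: lookup_add)

lemma lookup_D: "lookup (D d j P) M' = (\<Sum>M\<in>keys P.
    \<Sum>b\<in>#M. lookup (contrib d j b (M - {#b#}) (lookup P M)) M')"
  by (simp add: D_def lookup_sum lookup_sum_mset)

lemma lookup_D_nonzero:
  assumes "lookup (D d j P) M' \<noteq> 0"
  obtains M b where "M \<in> keys P" "b \<in># M"
    "lookup (contrib d j b (M - {#b#}) (lookup P M)) M' \<noteq> 0"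
proof -
  have *: "\<exists>b\<in>#M. f b \<noteq> 0" if "(\<Sum>b\<in>#M. f b) \<noteq> 0" for M and f :: "letter \<Rightarrow> 'a"
    using that by (rule contrapos_np) (induction M; simp)
  from assms that show ?thesis
    unfolding lookup_D by (elim sum.not_neutral_contains_not_neutral) (blast dest: *)
qed

text \<open>A letter of degree exactly \<open>- d\<close> turns into
  \<open>(0, snd b + j - 1)\<close>; the condition on \<open>j\<close> keeps this away from the
  excluded letter \<open>(0, 0)\<close>. Letters of lower degree keep a positive first index, and
  the others produce no letter.\<close>

lemma homogeneous_D:
  assumes P: "homogeneous N P"
    and j: "\<And>M b. M \<in> keys P \<Longrightarrow> b \<in># M \<Longrightarrow> d \<le> fst b \<Longrightarrow> fst b = d \<longrightarrow> 2 \<le> snd b + j"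
  shows "homogeneous (N - d) (D d j P)"
  unfolding homogeneous_def
proof
  fix M' assume "M' \<in> keys (D d j P)"
  then have "lookup (D d j P) M' \<noteq> 0" by (simp add: in_keys_iff)
  then obtain M b where M: "M \<in> keys P" "b \<in># M"
    and nz: "lookup (contrib d j b (M - {#b#}) (lookup P M)) M' \<noteq> 0"
    by (rule lookup_D_nonzero)
  have "wt M = fst b + 1 + wt (M - {#b#})"
    using M(2) by (metis insert_DiffM wt_simps(2))
  with P M have *: "N = fst b + 1 + wt (M - {#b#})" "(0, 0) \<notin># M - {#b#}"
    by (auto simp: homogeneous_def dest: in_diffD)
  show "wt M' = N - d \<and> (0, 0) \<notin># M'"
  proof (cases "d \<le> fst b")
    case True
    with nz have "M' = add_mset (fst b - d, snd b + j - 1) (M - {#b#})"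
      by (auto simp: contrib_def lookup_single when_def split: if_splits)
    then show ?thesis using * True j[OF M True] by auto
  next
    case False
    with nz have "M' = M - {#b#}" "fst b + 1 = d"
      by (auto simp: contrib_def lookup_single when_def split: if_splits)
    then show ?thesis using * by auto
  qed
qed

lemma sum_mset_delta': "(\<Sum>b\<in>#M. if b = c then x else 0) = of_nat (count M c) * (x :: 'a)"
  by (induction M) (simp_all add: algebra_simps)

lemma exists_nonzero_D:
  assumes P: "homogeneous N P" and M0: "M0 \<in> keys P" "b0 \<in># M0"
    and max: "\<And>M b. M \<in> keys P \<Longrightarrow> b \<in># M \<Longrightarrow> fst b \<le> fst b0"
  shows "\<exists>d j. 1 \<le> d \<and> d \<le> N \<and> homogeneous (N - d) (D d j P) \<and> D d j P \<noteq> 0"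
proof -
  let ?B = "\<Union>M\<in>keys P. set_mset M"
  define J where "J = Max (snd ` ?B) + 1"
  have J: "snd b < J" if "M \<in> keys P" "b \<in># M" for M b
    using that unfolding J_def by (auto simp: less_Suc_eq_le intro!: Max_ge)
  have "wt M0 = fst b0 + 1 + wt (M0 - {#b0#})"
    using M0(2) by (metis insert_DiffM wt_simps(2))
  then have N: "fst b0 + 1 \<le> N" using P M0(1) by (auto simp: homogeneous_def)
  show ?thesis
  proof (cases "fst b0 = 0")
    case False
    \<comment> \<open>Beyond all second indices in \<open>P\<close>, so that
      \<open>(0, snd b + j - 1)\<close> is a fresh letter; the surplus of 2 also meets the side
      condition of \<open>homogeneous_D\<close>.\<close>
    define j where "j = J + 2"
    let ?new = "\<lambda>b. (0, snd b + j - 1) :: letter"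
    \<comment> \<open>The monomial \<open>M0\<close> with one \<open>b0\<close> replaced by its
      fresh letter. Since that letter can be traced back to \<open>b0\<close>, only
      \<open>b0\<close> in \<open>M0\<close> contributes to this coefficient; letters with a smaller
      first index create no letter at all.\<close>
    define M' where "M' = add_mset (?new b0) (M0 - {#b0#})"
    have fresh: "?new b \<notin># M" if "M \<in> keys P" for b M
      using J[OF that, of "?new b"] by (auto simp: j_def)
    have eq: "lookup (contrib (fst b0) j b (M - {#b#}) (lookup P M)) M' =
      (if b = b0 then if M = M0 then lookup P M0 * coef (fst b0) j b0 else 0 else 0)"
      if M: "M \<in> keys P" "b \<in># M" for M b
    proof (cases "fst b = fst b0")
      case True
      have "add_mset (?new b) (M - {#b#}) = M' \<longleftrightarrow> b = b0 \<and> M = M0"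
      proof
        assume *: "add_mset (?new b) (M - {#b#}) = M'"
        have "?new b0 \<in># add_mset (?new b) (M - {#b#})" unfolding * M'_def by (rule union_single_eq_member) (rule refl)
        moreover have "?new b0 \<notin># M - {#b#}" using fresh[OF M(1), of b0] in_diffD by metis
        ultimately have "?new b0 = ?new b" by (simp only: set_mset_add_mset_insert insert_iff simp_thms)
        with True have b: "b = b0" by (auto simp: prod_eq_iff j_def)
        with * have "M - {#b#} = M0 - {#b#}" by (simp add: M'_def)
        with b M M0 show "b = b0 \<and> M = M0" by (metis insert_DiffM)
      qed (simp add: M'_def)
      with True show ?thesis by (auto simp: contrib_def lookup_single when_def)
    next
      case False
      with max[OF M] have lt: "\<not> fst b0 \<le> fst b" by simp
      have "?new b0 \<notin># M - {#b#}" using fresh[OF M(1), of b0] in_diffD by metis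
      moreover have "?new b0 \<in># M'" unfolding M'_def by (rule union_single_eq_member) (rule refl)
      ultimately have "M - {#b#} \<noteq> M'" by metis
      with False lt show ?thesis by (auto simp: contrib_def lookup_single when_def)
    qed
    have "lookup (D (fst b0) j P) M' = (\<Sum>M\<in>keys P. \<Sum>b\<in>#M.
      (if b = b0 then if M = M0 then lookup P M0 * coef (fst b0) j b0 else 0 else 0))"
      unfolding lookup_D by (intro sum.cong refl arg_cong[of _ _ sum_mset] image_mset_cong eq)
    also have "\<dots> = of_nat (count M0 b0) * (lookup P M0 * coef (fst b0) j b0)"
      by (simp add: sum_mset_delta' if_distrib[of "(*) _"] M0 cong: if_cong)
    also have "\<dots> \<noteq> 0"
      using M0 False by (auto simp add: in_keys_iff coef_def j_def not_in_iff simp flip: of_nat_add of_nat_mult)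
    finally have "D (fst b0) j P \<noteq> 0" by auto
    moreover have "homogeneous (N - fst b0) (D (fst b0) j P)"
      using P by (rule homogeneous_D) (simp add: j_def)
    ultimately show ?thesis using False N by (intro exI[of _ "fst b0"] exI[of _ j]) auto
  next
    case True
    define M' where "M' = M0 - {#b0#}"
    \<comment> \<open>All first indices are 0 here and \<open>(0, 0)\<close> is excluded. Hence
      \<open>D 1 j\<close> turns letters into scalars only, and the independence hypothesis applies
      with indices from 1 on.\<close>
    have k: "fst b = 0" "0 < snd b" if "M \<in> keys P" "b \<in># M" for M b
      using max[OF that] P that True
      by (auto simp: homogeneous_def, metis gr0I prod.collapse)
    \<comment> \<open>Up to the factor \<open>i\<close>, the coefficient of \<open>M'\<close> in the
      partial derivative of \<open>P\<close> by the letter \<open>(0, i)\<close>. The coefficient of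
      \<open>M'\<close> in \<open>D 1 j P\<close> is then minus the sum of all
      \<open>a i * ph (i + j - 1)\<close>.\<close>
    define a where "a i = of_nat i * (of_nat (count (add_mset (0, i) M') (0, i)) *
      lookup P (add_mset (0, i) M'))" for i
    have M0': "M0 = add_mset (0, snd b0) M'"
      using M0 True by (metis M'_def insert_DiffM prod.collapse)
    have "(0, snd b0) \<in># M0" using M0(2) True by (metis prod.collapse)
    then have "a (snd b0) \<noteq> 0"
      using M0 k[OF M0] unfolding a_def M0'[symmetric] by (simp add: in_keys_iff)
    moreover have "snd b0 \<in> {1..J}" using J[OF M0] k[OF M0] by simp
    ultimately obtain j where j: "(\<Sum>i = 1..J. a i * ph (i + j - 1)) \<noteq> 0"
      using ph_independent[where n = J and a = a and i = "snd b0"] by blast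
    let ?g = "\<lambda>M i. if M = add_mset (0, i) M'
      then - (lookup P (add_mset (0, i) M') * of_nat i * ph (i + j - 1)) else 0"
    have eq: "lookup (contrib 1 j b (M - {#b#}) (lookup P M)) M' =
      (\<Sum>i = 1..J. if b = (0, i) then ?g M i else 0)"
      if M: "M \<in> keys P" "b \<in># M" for M b
    proof -
      have b: "b = (0, snd b)" and i: "snd b \<in> {1..J}"
        using k[OF M] J[OF M] by (auto simp: prod_eq_iff)
      have "M - {#b#} = M' \<longleftrightarrow> M = add_mset (0, snd b) M'"
        using M(2) b by (metis add_mset_remove_trivial insert_DiffM)
      then have "lookup (contrib 1 j b (M - {#b#}) (lookup P M)) M' =
        (if M = add_mset (0, snd b) M' then - (lookup P (add_mset (0, snd b) M') * of_nat (snd b) * ph (snd b + j - 1)) else 0)"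
        using k[OF M] by (auto simp: contrib_def lookup_single when_def coef_def)
      also have "\<dots> = (\<Sum>i = 1..J. if i = snd b then ?g M i else 0)"
        using i by (simp add: sum.delta)
      also have "\<dots> = (\<Sum>i = 1..J. if b = (0, i) then ?g M i else 0)"
        using b by (intro sum.cong refl if_cong) (auto simp: prod_eq_iff)
      finally show ?thesis .
    qed
    have "lookup (D 1 j P) M' = (\<Sum>M\<in>keys P. \<Sum>b\<in>#M.
      (\<Sum>i = 1..J. if b = (0, i) then ?g M i else 0))"
      unfolding lookup_D by (intro sum.cong refl arg_cong[of _ _ sum_mset] image_mset_cong eq)
    also have "\<dots> = (\<Sum>i = 1..J. \<Sum>M\<in>keys P. \<Sum>b\<in>#M.
      if b = (0, i) then ?g M i else 0)"
    proof -
      have "(\<Sum>b\<in>#M. \<Sum>i\<in>A. f b i) = (\<Sum>i\<in>A. \<Sum>b\<in>#M. f b i)" for M A and f :: "letter \<Rightarrow> nat \<Rightarrow> 'a"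
        by (induction M) (simp_all add: sum.distrib)
      then show ?thesis by (simp only:) (rule sum.swap)
    qed
    also have "\<dots> = (\<Sum>i = 1..J. - (a i * ph (i + j - 1)))"
    proof (rule sum.cong)
      fix i
      have "(\<Sum>M\<in>keys P. \<Sum>b\<in>#M. if b = (0, i) then ?g M i else 0)
       = (\<Sum>M\<in>keys P. if M = add_mset (0, i) M' then - (a i * ph (i + j - 1)) else 0)"
        unfolding sum_mset_delta' by (intro sum.cong refl) (simp add: a_def)
      also have "\<dots> = - (a i * ph (i + j - 1))"
        by (auto simp: a_def in_keys_iff)
      finally show "(\<Sum>M\<in>keys P. \<Sum>b\<in>#M. if b = (0, i) then ?g M i else 0)
       = - (a i * ph (i + j - 1))" .
    qed simp
    finally have "D 1 j P \<noteq> 0" using j by (auto simp: sum_negf)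
    moreover have "homogeneous (N - 1) (D 1 j P)"
      using P by (rule homogeneous_D) (use k in force)
    ultimately show ?thesis using N True by (intro exI[of _ 1] exI[of _ j]) auto
  qed
qed

text \<open>Strong induction on the weight: \<open>exists_nonzero_D\<close> supplies a derivation
  that keeps the polynomial nonzero and \<open>D_G\<close> carries the relation down, until the
  polynomial is a constant of weight 0 and \<open>G 0 = W\<close>. Read contrapositively, symbols
  are unique as long as no nonzero scalar sends \<open>v0\<close> into \<open>W\<close>.\<close>

theorem graded_faithful:
  assumes "homogeneous N P" "P \<noteq> 0" "S P \<in> G N"
  obtains a where "a \<noteq> 0" "sc a v0 \<in> W"
  using assms
proof (induction N arbitrary: P thesis rule: less_induct)
  case (less N)
  let ?B = "\<Union>M\<in>keys P. set_mset M"
  show ?case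
  proof (cases "?B = {}")
    case True
    then have "keys P \<subseteq> {{#}}" by auto
    moreover have "keys P \<noteq> {}" using less.prems by simp
    ultimately have keys: "keys P = {{#}}" by blast
    with less.prems have N: "N = 0" by (simp add: homogeneous_def)
    have "s {#} = v0" by (simp add: s_def)
    then have "S P = sc (lookup P {#}) v0" by (simp add: linear_extension_def keys)
    moreover have "lookup P {#} \<noteq> 0" using keys by (simp flip: in_keys_iff)
    ultimately show ?thesis using less.prems N by (simp add: G_nonpos)
  next
    case False
    then have "Max (fst ` ?B) \<in> fst ` ?B" by (intro Max_in) auto
    then obtain M0 b0 where "M0 \<in> keys P" "b0 \<in># M0" "fst b0 = Max (fst ` ?B)" by auto
    moreover have "fst b \<le> Max (fst ` ?B)" if "M \<in> keys P" "b \<in># M" for M b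
      using that by (intro Max_ge) auto
    ultimately obtain d j where dj: "1 \<le> d" "d \<le> N" "homogeneous (N - d) (D d j P)" "D d j P \<noteq> 0"
      using exists_nonzero_D[OF less.prems(2)] by metis
    from D_G[OF dj(1) less.prems(2,4), of j] dj(2) have "S (D d j P) \<in> G (int (N - d))"
      by (simp only: of_nat_diff)
    moreover have "N - d < N" using dj by simp
    ultimately show ?thesis using less.IH less.prems(1) dj(3,4) by blast
  qed
qed

text \<open>A word of weight \<open>N\<close> without the letter \<open>(0, 0)\<close> is a monomial
  up to lower weight; a word containing \<open>(0, 0)\<close> trades it for the scalar
  \<open>\<zeta>\<close> and thereby loses weight 1.\<close>

lemma symbol_exists:
  assumes Y0: "\<And>v. Y 0 0 v - sc \<zeta> v \<in> W" and v: "v \<in> G (int N + 1)"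
  obtains P where "homogeneous N P" "v - S P \<in> G N"
proof -
  let ?Q = "\<lambda>v. \<exists>P. homogeneous N P \<and> v - S P \<in> G N"
  have add: "homogeneous N (P + P')" if "homogeneous N P" "homogeneous N P'" for P P'
    using that Poly_Mapping.keys_add[of P P'] by (auto simp: homogeneous_def)
  have "v \<in> span ({word l | l. int (wt (mset l)) < int N + 1} \<union> W)"
    using v by (simp add: G_def)
  then have "?Q v"
  proof (induction rule: span_induct_alt)
    case base
    show ?case by (rule exI[of _ 0]) (simp add: homogeneous_def G_rules)
  next
    case (step a x y)
    from step(2) obtain P where P: "homogeneous N P" "y - S P \<in> G N" by blast
    have "?Q x"
    proof (cases "x \<in> W")
      case True
      then show ?thesis by (intro exI[of _ 0]) (simp add: homogeneous_def W_G)
    next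
      case False
      with step(1) obtain l where l: "x = word l" "wt (mset l) \<le> N" by auto
      consider "wt (mset l) < N" | "(0, 0) \<in> set l" | "wt (mset l) = N" "(0, 0) \<notin> set l"
        using l by linarith
      then show ?thesis
      proof cases
        case 1
        then show ?thesis using l by (intro exI[of _ 0]) (simp add: homogeneous_def G_word)
      next
        case 2
        then obtain l1 l2 where l12: "l = l1 @ (0, 0) # l2" by (meson split_list)
        have "word l - word ((0, 0) # l1 @ l2) \<in> G N"
          unfolding l12 using word_to_front[of l1 "(0, 0)" l2] by (rule G_mono) (use l l12 in simp)
        moreover have "word ((0, 0) # l1 @ l2) - sc \<zeta> (word (l1 @ l2)) \<in> G N"
          using Y0 by (simp add: W_G)
        ultimately have "word l - sc \<zeta> (word (l1 @ l2)) \<in> G N" by (rule G_trans)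
        moreover have "sc \<zeta> (word (l1 @ l2)) \<in> G N"
          using l l12 by (intro G_rules(3) G_word) simp
        ultimately have "word l \<in> G N" using G_cong by blast
        then show ?thesis using l by (intro exI[of _ 0]) (simp add: homogeneous_def)
      next
        case 3
        then show ?thesis using l word_s[of l]
          by (intro exI[of _ "single (mset l) 1"]) (simp add: homogeneous_def linear_extension_single)
      qed
    qed
    then obtain P' where P': "homogeneous N P'" "x - S P' \<in> G N" by blast
    have "homogeneous N (Poly_Mapping.map ((*) a) P')"
      using P'(1) by (auto simp: homogeneous_def Poly_Mapping.map.rep_eq in_keys_iff when_def)
    moreover have "sc a (x - S P') + (y - S P) \<in> G N" by (intro G_rules P P')
    ultimately show ?case using P
      by (intro exI[of _ "Poly_Mapping.map ((*) a) P' + P"]) (simp add: add linear_extension_add linear_extension_map algebra_simps)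
  qed
  with that show ?thesis by blast
qed

end

section \<open>A module with prescribed central character\<close>

lemma lookup_scale: "lookup (scale c f) k = c * lookup f k"
  by (simp add: scale_def Poly_Mapping.map.rep_eq when_def)

lemma scale_single [simp]: "scale a (single k b) = single k (a * b)"
  by (auto intro!: poly_mapping_eqI simp: lookup_scale lookup_single when_def)

interpretation scale: vector_space "scale :: complex \<Rightarrow> ('k \<Rightarrow>\<^sub>0 complex) \<Rightarrow> _"
  by unfold_locales (auto intro!: poly_mapping_eqI simp: lookup_scale lookup_add algebra_simps)

interpretation complex_line: vector_space "(*) :: complex \<Rightarrow> complex \<Rightarrow> complex"
  by unfold_locales (auto simp: algebra_simps)

lemma linear_extension_scale:
  assumes "Modules.module sc"
  shows "linear_extension sc f (scale a P) = sc a (linear_extension sc f P)"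
  unfolding scale_def by (rule module.linear_extension_map[OF assms])

lemma linear_extension_id: "linear_extension scale (\<lambda>k. single k 1) t = t"
  by (rule poly_mapping_eqI)
    (auto simp: linear_extension_def lookup_sum lookup_single when_def in_keys_iff)

lemma linear_induct [case_names single add scale]:
  fixes t :: "'k \<Rightarrow>\<^sub>0 complex"
  assumes "\<And>k. Q (single k 1)" "\<And>t u. Q t \<Longrightarrow> Q u \<Longrightarrow> Q (t + u)" "\<And>a t. Q t \<Longrightarrow> Q (scale a t)"
  shows "Q t"
proof -
  have "Q 0" using assms(3)[OF assms(1), of 0 undefined] by simp
  then have "Q (\<Sum>k\<in>A. scale (lookup t k) (single k 1))" for A
    by (induction A rule: infinite_finite_induct) (simp_all add: assms del: scale_single)
  then show ?thesis
    by (subst linear_extension_id[symmetric]) (simp only: linear_extension_def)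
qed

locale induced_words =
  fixes ph :: "nat \<Rightarrow> complex" and \<xi> :: complex
begin

abbreviation c :: "int \<Rightarrow> nat \<Rightarrow> int \<Rightarrow> nat \<Rightarrow> complex"
  where "c d i e j \<equiv> of_int (e * int i - d * int j)"

abbreviation prepend :: "letter \<Rightarrow> letter_words \<Rightarrow> letter_words"
  where "prepend b \<equiv> linear_extension scale (\<lambda>l. single (b # l) 1)"

text \<open>The action forced in a module induced from \<nn>: a nonpositive degree adds a letter on
  the left, a positive one is commuted to the empty word, where the character takes over.
  \<open>d\<close> and \<open>i\<close> come after the word because the recursive call changes them.
  Words are left unreduced, so brackets between nonpositive degrees hold only modulo
  \<open>R\<close> below.\<close>

primrec Yw :: "letter list \<Rightarrow> int \<Rightarrow> nat \<Rightarrow> letter_words"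
  where
    "Yw [] = (\<lambda>d i. if d \<le> 0 then single [(nat (- d), i)] 1
       else if d = 1 then single [] (ph i) else 0)"
  | "Yw (b # l) = (\<lambda>d i. if d \<le> 0 then single ((nat (- d), i) # b # l) 1
       else prepend b (Yw l d i) +
         scale (c d i (- int (fst b)) (snd b)) (Yw l (d - int (fst b)) (i + snd b - 1)))"

definition Y :: "int \<Rightarrow> nat \<Rightarrow> letter_words \<Rightarrow> letter_words"
  where "Y d i = linear_extension scale (\<lambda>l. Yw l d i)"

lemma Y_add: "Y d i (t + u) = Y d i t + Y d i u"
  by (simp add: Y_def scale.linear_extension_add)

lemma Y_diff: "Y d i (t - u) = Y d i t - Y d i u"
  by (simp add: Y_def scale.linear_extension_diff)

lemma Y_scale: "Y d i (scale a t) = scale a (Y d i t)"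
  by (simp add: Y_def linear_extension_scale scale.module_axioms)

lemma Y_zero [simp]: "Y d i 0 = 0"
  by (simp add: Y_def)

lemma Y_single: "Y d i (single l 1) = Yw l d i"
  by (simp add: Y_def)

lemma prepend_eq: "d \<le> 0 \<Longrightarrow> Y d i t = prepend (nat (- d), i) t"
proof -
  assume "d \<le> 0"
  then have "Yw l d i = single ((nat (- d), i) # l) 1" for l by (cases l) auto
  then show ?thesis by (simp add: Y_def)
qed

text \<open>Rewriting the structure constants over \<open>int\<close> disposes of the truncated subtraction in the second index.\<close>

lemma jacobi_term:
  "scale (c d i k m * c (d + k) (i + m - 1) e j) (F (i + m - 1 + j - 1))
    = scale (of_int ((k * int i - d * int m) * (e * (int i + int m - 1) - (d + k) * int j)))
        (F (i + j + m - 2))"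
proof (cases "i + m = 0")
  case False
  then have "i + m - 1 + j - 1 = i + j + m - 2" "int (i + m - 1) = int i + int m - 1" by auto
  then show ?thesis by (simp only: of_int_mult)
qed simp

text \<open>The Jacobi identity on basis vectors, as an identity of coefficients. The family
  \<open>F\<close> stands for the basis vector of given degree and index, so that it can be replaced
  by the operators \<open>Y\<close> applied to a fixed vector.\<close>

lemma jacobi:
  "scale (c d i k m) (scale (c (d + k) (i + m - 1) e j) (F (d + k + e) (i + m - 1 + j - 1)))
   + scale (c e j k m) (scale (c d i (e + k) (j + m - 1)) (F (d + (e + k)) (i + (j + m - 1) - 1)))
   = scale (c d i e j) (scale (c (d + e) (i + j - 1) k m) (F (d + e + k) (i + j - 1 + m - 1)))"
proof -
  have "c d i (e + k) (j + m - 1) = - c (e + k) (j + m - 1) d i" by simp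
  then have *: "scale (c e j k m * c d i (e + k) (j + m - 1)) (F (d + (e + k)) (i + (j + m - 1) - 1))
    = - scale (c e j k m * c (e + k) (j + m - 1) d i) (F (d + e + k) (j + m - 1 + i - 1))"
    by (simp only: mult_minus_right scale.scale_minus_left add_ac diff_add_eq)
  have idx: "d + k + e = d + e + k" "i + m + j - 2 = i + j + m - 2" "j + i + m - 2 = i + j + m - 2"
    by simp_all
  have "of_int ((e * int i - d * int j) * (k * (int i + int j - 1) - (d + e) * int m))
    = (of_int ((k * int i - d * int m) * (e * (int i + int m - 1) - (d + k) * int j))
       - of_int ((k * int j - e * int m) * (d * (int j + int m - 1) - (e + k) * int i)) :: complex)"
    unfolding of_int_diff[symmetric] by (rule arg_cong[of _ _ of_int]) (simp add: algebra_simps)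
  then show ?thesis
    unfolding scale.scale_scale * idx(1) jacobi_term[where d = d and i = i and k = k and m = m and e = e and j = j and F = "F (d + e + k)"]
      jacobi_term[where d = e and i = j and k = k and m = m and e = d and j = i and F = "F (d + e + k)"] jacobi_term[where d = d and i = i and k = e and m = j and e = k and j = m and F = "F (d + e + k)"] idx(2,3)
    by (simp only: scale.scale_left_diff_distrib) simp
qed

lemma Y_past_letter:
  assumes "1 \<le> d" "e \<le> 0"
  shows "Y d i (Y e j t) = Y e j (Y d i t) + scale (c d i e j) (Y (d + e) (i + j - 1) t)"
proof (induction t rule: linear_induct)
  case (single l)
  have "Y e j (single l 1) = single ((nat (- e), j) # l) 1"
    using assms(2) by (simp add: prepend_eq)
  then show ?case using assms
    by (simp add: Y_single[where l = "_ # _"]) (simp add: Y_single prepend_eq)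
qed (simp_all add: Y_add Y_scale scale.scale_right_distrib mult.commute)

text \<open>Induction on the word. For two positive degrees, write the word as
  \<open>Y k m w\<close> and carry both operators past its first letter; what remains is the claim
  for the shorter word \<open>w\<close> and the Jacobi identity.\<close>

lemma Y_comm_exact:
  assumes "1 \<le> d"
  shows "Y d i (Y e j t) = Y e j (Y d i t) + scale (c d i e j) (Y (d + e) (i + j - 1) t)"
proof (induction t arbitrary: rule: linear_induct)
  case (single l)
  from assms show ?case
  proof (induction l arbitrary: d i e j)
    case Nil
    then show ?case
      by (cases "e \<le> 0") (auto simp: Y_past_letter Y_def linear_extension_scale scale.module_axioms mult.commute)
  next
    case (Cons b l)
    show ?case
    proof (cases "e \<le> 0")
      case True
      with Cons.prems show ?thesis by (simp add: Y_past_letter)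
    next
      case False
      define k m where "k = - int (fst b)" and "m = snd b"
      define w :: "letter_words" where "w = single l 1"
      have k: "k \<le> 0" and bl: "single (b # l) 1 = Y k m w"
        by (simp_all add: k_def m_def w_def prepend_eq)
      have comm: "Y d i (Y e j w) = Y e j (Y d i w) + scale (c d i e j) (Y (d + e) (i + j - 1) w)"
        if "1 \<le> d \<or> 1 \<le> e" for d i e j
      proof (cases "1 \<le> d")
        case True
        then show ?thesis using Cons.IH unfolding w_def by simp
      next
        case False
        with that have "1 \<le> e" by simp
        from Cons.IH[OF this, of j d i] show ?thesis
          unfolding w_def
          by (simp add: add.commute scale.scale_left_diff_distrib algebra_simps flip: scale.scale_minus_left)
      qed
      note past = Y_past_letter[OF _ k]
      have e: "1 \<le> e" and d: "1 \<le> d" and de: "1 \<le> d + e" using False Cons.prems by auto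
      have regroup: "A1 + A2 = A3 + A4 + A5 \<Longrightarrow> B1 + B2 + A1 + A2 = B1 + A4 + A3 + (B2 + A5)"
        for A1 A2 A3 A4 A5 B1 B2 :: "letter_words"
        by (auto simp: algebra_simps)
      \<comment> \<open>The degrees \<open>d + k\<close> and \<open>e + k\<close> may be
        nonpositive, so these two exchanges rely on \<open>e\<close> and on \<open>d\<close>,
        respectively, being positive. This is why the induction hypothesis was symmetrized in
        \<open>comm\<close>.\<close>
      have "scale (c d i k m) (Y (d + k) (i + m - 1) (Y e j w)) + scale (c e j k m) (Y d i (Y (e + k) (j + m - 1) w))
        = scale (c d i k m) (Y e j (Y (d + k) (i + m - 1) w)) + scale (c e j k m) (Y (e + k) (j + m - 1) (Y d i w))
          + scale (c d i e j) (scale (c (d + e) (i + j - 1) k m) (Y (d + e + k) (i + j - 1 + m - 1) w))"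
        unfolding comm[OF disjI2[OF e], of "d + k" "i + m - 1" j] comm[OF disjI1[OF d], of i "e + k" "j + m - 1"]
        using jacobi[where d = d and i = i and k = k and m = m and e = e and j = j and F = "\<lambda>d i. Y d i w"] by (simp only: scale.scale_right_distrib add_ac)
      then show ?thesis
        unfolding bl past[OF d] past[OF e] Y_add Y_scale comm[OF disjI1[OF d], of i e j]
          past[OF de] scale.scale_right_distrib
        by (rule regroup)
    qed
  qed
qed (simp_all add: Y_add Y_scale scale.scale_right_distrib mult.commute)

text \<open>The two-sided ideal of the free algebra on the letters generated by the relations among
  nonpositive degrees and by \<open>z - \<xi>\<close>: left multiplication is
  \<open>R_letter\<close>, right multiplication is hidden in the arbitrary \<open>t\<close> of
  \<open>R_comm\<close> and \<open>R_center\<close>.\<close>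

inductive_set R :: "letter_words set"
  where
    R_zero: "0 \<in> R"
  | R_add: "r \<in> R \<Longrightarrow> r' \<in> R \<Longrightarrow> r + r' \<in> R"
  | R_scale: "r \<in> R \<Longrightarrow> scale a r \<in> R"
  | R_letter: "r \<in> R \<Longrightarrow> d \<le> 0 \<Longrightarrow> Y d i r \<in> R"
  | R_comm: "d \<le> 0 \<Longrightarrow> e \<le> 0 \<Longrightarrow>
      Y d i (Y e j t) - Y e j (Y d i t) - scale (c d i e j) (Y (d + e) (i + j - 1) t) \<in> R"
  | R_center: "Y 0 0 t - scale \<xi> t \<in> R"

lemma R_uminus: "r \<in> R \<Longrightarrow> - r \<in> R"
  using R_scale[of r "-1"] by simp

abbreviation defect
  where "defect d i e j t \<equiv> Y d i (Y e j t) - Y e j (Y d i t) - scale (c d i e j) (Y (d + e) (i + j - 1) t)"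

lemma defect_R: "defect d i e j t \<in> R"
proof (cases "d \<le> 0 \<and> e \<le> 0")
  case True
  then show ?thesis by (intro R_comm) auto
next
  case False
  then have "defect d i e j t = 0"
  proof (cases "1 \<le> d")
    case True
    show ?thesis unfolding Y_comm_exact[OF True, of i e j] by simp
  next
    case 2: False
    with False have "1 \<le> e" by simp
    have "c d i e j = - c e j d i" by simp
    then show ?thesis unfolding Y_comm_exact[OF \<open>1 \<le> e\<close>, of j d i]
      by (simp only: scale.scale_minus_left) (simp add: add_ac)
  qed
  then show ?thesis by (simp add: R_zero)
qed

text \<open>An operator of positive degree acts on a bracket by the Leibniz rule, which is again the
  Jacobi identity. This serves to show that \<open>R\<close> is stable under positive degrees, the
  one kind of stability not built into its definition.\<close>

lemma Y_defect:
  assumes "1 \<le> f"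
  shows "Y f k (defect d i e j t) = defect d i e j (Y f k t)
    + scale (c f k d i) (defect (f + d) (k + i - 1) e j t)
    + scale (c f k e j) (defect d i (f + e) (k + j - 1) t)"
proof -
  note x = Y_comm_exact[OF assms]
  have regroup: "T1 + T2 = U2 \<Longrightarrow> P1 + P2 + P3 - (Q1 + Q2 + Q3) - (U1 + U2)
      = P1 - Q1 - U1 + (P3 - Q2 - T1) + (P2 - Q3 - T2)"
    for T1 T2 U1 U2 P1 P2 P3 Q1 Q2 Q3 :: "letter_words"
    by (auto simp: algebra_simps)
  have "scale (c f k d i) (scale (c (f + d) (k + i - 1) e j) (Y (f + d + e) (k + i - 1 + j - 1) t))
    + scale (c f k e j) (scale (c d i (f + e) (k + j - 1)) (Y (d + (f + e)) (i + (k + j - 1) - 1) t))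
    = scale (c d i e j) (scale (c f k (d + e) (i + j - 1)) (Y (f + (d + e)) (k + (i + j - 1) - 1) t))"
  proof -
    have "scale (c f k d i) (scale (c (f + d) (k + i - 1) e j) (Y (f + d + e) (k + i - 1 + j - 1) t))
      = - scale (c d i f k) (scale (c (d + f) (i + k - 1) e j) (Y (d + f + e) (i + k - 1 + j - 1) t))"
      unfolding add.commute[of f d] add.commute[of k i] scale.scale_minus_left[symmetric] by simp
    moreover have "scale (c d i e j) (scale (c f k (d + e) (i + j - 1)) (Y (f + (d + e)) (k + (i + j - 1) - 1) t))
      = - scale (c d i e j) (scale (c (d + e) (i + j - 1) f k) (Y (d + e + f) (i + j - 1 + k - 1) t))"
    proof -
      have neg: "c (d + e) (i + j - 1) f k = - c f k (d + e) (i + j - 1)" by simp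
      show ?thesis
        by (simp only: neg scale.scale_minus_left scale.scale_minus_right minus_minus
            add.commute[of "d + e" f] add.commute[of "i + j - 1" k])
    qed
    moreover have "T1 = - V \<Longrightarrow> T3 = - U \<Longrightarrow> U + T2 = V \<Longrightarrow> T1 + T2 = T3"
      for T1 T2 T3 U V :: "letter_words"
      by (auto simp: algebra_simps)
    ultimately show ?thesis
      using jacobi[where d = d and i = i and k = e and m = j and e = f and j = k and F = "\<lambda>d i. Y d i t"]
      by blast
  qed
  then show ?thesis
    unfolding Y_diff Y_scale x Y_add scale.scale_right_diff_distrib scale.scale_right_distrib
    by (rule regroup)
qed

lemma Y_R: "r \<in> R \<Longrightarrow> Y d i r \<in> R"
proof (induction arbitrary: d i rule: R.induct)
  case (R_letter r e j)
  show ?case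
  proof (cases "1 \<le> d")
    case True
    show ?thesis unfolding Y_comm_exact[OF True]
      by (intro R.R_add R.R_scale R.R_letter R_letter)
  next
    case False
    then show ?thesis by (intro R.R_letter R_letter) auto
  qed
next
  case (R_comm e f j t k)
  show ?case
  proof (cases "1 \<le> d")
    case True
    show ?thesis unfolding Y_defect[OF True]
      by (intro R.R_add R.R_scale defect_R)
  next
    case False
    then show ?thesis by (intro R.R_letter R.R_comm R_comm) auto
  qed
next
  case (R_center t)
  show ?case
  proof (cases "1 \<le> d")
    case True
    have "Y d i (Y 0 0 t - scale \<xi> t) = Y 0 0 (Y d i t) - scale \<xi> (Y d i t)"
      unfolding Y_diff Y_scale Y_comm_exact[OF True] by simp
    then show ?thesis by (simp add: R.R_center)
  next
    case False
    then show ?thesis by (intro R.R_letter R.R_center) auto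
  qed
qed (auto simp: Y_add Y_scale intro: R.intros)

definition \<chi> :: "letter \<Rightarrow> complex"
  where "\<chi> b = (if b = (0, 0) then \<xi> else 0)"

definition \<epsilon> :: "letter_words \<Rightarrow> complex"
  where "\<epsilon> = linear_extension (*) (\<lambda>l. prod_list (map \<chi> l))"

lemma \<epsilon>_simps:
  "\<epsilon> 0 = 0" "\<epsilon> (t + u) = \<epsilon> t + \<epsilon> u" "\<epsilon> (t - u) = \<epsilon> t - \<epsilon> u" "\<epsilon> (scale a t) = a * \<epsilon> t"
  "\<epsilon> (single l a) = a * prod_list (map \<chi> l)"
  by (simp_all add: \<epsilon>_def complex_line.linear_extension_add complex_line.linear_extension_diff
      linear_extension_scale complex_line.module_axioms)

lemma \<epsilon>_letter:
  assumes "d \<le> 0"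
  shows "\<epsilon> (Y d i t) = \<chi> (nat (- d), i) * \<epsilon> t"
proof (induction t rule: linear_induct)
  case (single l)
  have "Y d i (single l 1) = single ((nat (- d), i) # l) 1"
    using assms by (simp add: prepend_eq)
  then show ?case by (simp only: \<epsilon>_simps list.map prod_list.Cons) simp
next
  case (add t u)
  then show ?case by (simp only: Y_add \<epsilon>_simps distrib_left)
next
  case (scale a t)
  then show ?case by (simp only: Y_scale \<epsilon>_simps mult.left_commute)
qed

lemma \<epsilon>_R: "r \<in> R \<Longrightarrow> \<epsilon> r = 0"
proof (induction rule: R.induct)
  case (R_comm d e i j t)
  \<comment> \<open>If \<open>d = e = 0\<close>, the structure constant vanishes; otherwise the
    letter has degree \<open>d + e < 0\<close> and \<open>\<chi>\<close> sends it to 0.\<close>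
  have "c d i e j * \<chi> (nat (- (d + e)), i + j - 1) = 0"
    by (cases "d = 0 \<and> e = 0") (use R_comm in \<open>auto simp: \<chi>_def\<close>)
  with R_comm show ?case
    by (simp only: \<epsilon>_simps \<epsilon>_letter add_nonpos_nonpos mult.assoc[symmetric]) simp
qed (auto simp: \<epsilon>_simps \<epsilon>_letter \<chi>_def)

lemma empty_word_notin_R: "single [] 1 \<notin> R"
  using \<epsilon>_R[of "single [] 1"] by (auto simp: \<epsilon>_simps)

end

section \<open>Free associative algebras and the ideal of relations\<close>

lemma scale_conv_mult: "scale a f = single 0 a * f"
  for f :: "'k::monoid_add \<Rightarrow>\<^sub>0 complex"
  by (simp add: scale_def mult_map_scale_conv_mult)

lemma scale_mult_left: "scale a f * g = scale a (f * g)"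
  for f g :: "'k::monoid_add \<Rightarrow>\<^sub>0 complex"
  by (simp add: scale_conv_mult mult.assoc)

lemma single_zero_commute: "f * single 0 a = single 0 a * f"
  for f :: "'k::monoid_add \<Rightarrow>\<^sub>0 complex"
proof (induction f rule: linear_induct)
  case (scale b f)
  have "single 0 a * scale b f = scale b (single 0 a * f)"
    unfolding scale_conv_mult[of b] mult.assoc[symmetric] mult_single by (simp only: mult.commute)
  then show ?case by (simp only: scale_mult_left scale)
qed (simp_all add: mult_single distrib_left distrib_right)

lemma scale_mult_right: "f * scale a g = scale a (f * g)"
  for f g :: "'k::monoid_add \<Rightarrow>\<^sub>0 complex"
  unfolding scale_conv_mult mult.assoc[symmetric] single_zero_commute[of f a] ..

lemma scale_one_mult: "scale a 1 * f = scale a f" "f * scale a 1 = scale a f"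
  for f :: "'k::monoid_add \<Rightarrow>\<^sub>0 complex"
  by (simp_all add: scale_mult_left scale_mult_right)

lemma letters_zero [simp]: "letters 0 = []"
  by (simp add: zero_free_monoid_def)

lemma letters_plus [simp]: "letters (u + v) = letters u @ letters v"
  by (simp add: plus_free_monoid_def)

lemma gen_mult_single: "gen x * single (Word l) a = single (Word (x # l)) a"
  by (simp add: gen_def mult_single plus_free_monoid_def)

lemma free_alg_simps [simp]:
  "monoid.mult (free_alg L) = (*)" "\<one>\<^bsub>free_alg L\<^esub> = 1" "\<zero>\<^bsub>free_alg L\<^esub> = 0"
  "ring.add (free_alg L) = (+)" "module.smult (free_alg L) = scale"
  by (simp_all add: free_alg_def)

lemma carrier_free_alg: "f \<in> carrier (free_alg L) \<longleftrightarrow> (\<forall>w\<in>keys f. set (letters w) \<subseteq> carrier L)"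
  by (simp add: free_alg_def)

lemma free_alg_ring: "ring (free_alg L)"
proof (rule ringI)
  show "abelian_group (free_alg L)"
  proof (rule abelian_groupI)
    fix f assume "f \<in> carrier (free_alg L)"
    then have "- f \<in> carrier (free_alg L)" by (simp add: carrier_free_alg)
    then show "\<exists>g\<in>carrier (free_alg L). g \<oplus>\<^bsub>free_alg L\<^esub> f = \<zero>\<^bsub>free_alg L\<^esub>"
      by (intro bexI[of _ "- f"]) auto
  qed (use Poly_Mapping.keys_add in \<open>fastforce simp: carrier_free_alg add_ac\<close>)+
  show "monoid (free_alg L)"
  proof (rule monoidI)
    fix f g assume fg: "f \<in> carrier (free_alg L)" "g \<in> carrier (free_alg L)"
    have "set (letters w) \<subseteq> carrier L" if w: "w \<in> keys (f * g)" for w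
    proof -
      obtain u v where "w = u + v" "u \<in> keys f" "v \<in> keys g"
        using subsetD[OF keys_mult w] by blast
      then show ?thesis using fg by (simp add: carrier_free_alg)
    qed
    then show "f \<otimes>\<^bsub>free_alg L\<^esub> g \<in> carrier (free_alg L)"
      by (simp add: carrier_free_alg)
  qed (simp_all add: carrier_free_alg mult.assoc zero_free_monoid_def)
qed (simp_all add: distrib_left distrib_right)

lemma minus_free_alg: "f \<in> carrier (free_alg L) \<Longrightarrow> \<ominus>\<^bsub>free_alg L\<^esub> f = - f"
  by (intro abelian_group.minus_equality[OF ring.is_abelian_group[OF free_alg_ring]])
    (simp_all add: carrier_free_alg)

lemma gen_carrier: "x \<in> carrier L \<Longrightarrow> gen x \<in> carrier (free_alg L)"
  by (simp add: gen_def carrier_free_alg)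

lemma scale_carrier: "f \<in> carrier (free_alg L) \<Longrightarrow> scale a f \<in> carrier (free_alg L)"
  by (auto simp: carrier_free_alg in_keys_iff lookup_scale)

text \<open>Closure under the operations places \<open>env_relations\<close> inside the free algebra
  on the carrier, so that \<open>genideal\<close> yields a two-sided ideal; this is shared by \<B>
  and \<nn>.\<close>

locale lie_operations =
  fixes L :: "('g, 'x) lie_alg_scheme"
  assumes add_closed: "x \<in> carrier L \<Longrightarrow> y \<in> carrier L \<Longrightarrow> x \<oplus>\<^bsub>L\<^esub> y \<in> carrier L"
    and smult_closed: "x \<in> carrier L \<Longrightarrow> c \<odot>\<^bsub>L\<^esub> x \<in> carrier L"
    and bracket_closed: "x \<in> carrier L \<Longrightarrow> y \<in> carrier L \<Longrightarrow> lie_bracket L x y \<in> carrier L"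
begin

sublocale free: ring "free_alg L" by (rule free_alg_ring)

lemma env_relations_carrier: "env_relations L \<subseteq> carrier (free_alg L)"
proof -
  have closed: "f - g \<in> carrier (free_alg L)" "f + g \<in> carrier (free_alg L)" "f * g \<in> carrier (free_alg L)"
    if "f \<in> carrier (free_alg L)" "g \<in> carrier (free_alg L)" for f g
    using free.minus_closed[OF that] free.a_closed[OF that] free.m_closed[OF that]
    by (simp_all add: a_minus_def minus_free_alg[OF that(2)])
  then show ?thesis
    unfolding env_relations_def
    by (auto intro!: closed gen_carrier scale_carrier add_closed smult_closed bracket_closed)
qed

lemma env_ideal_ideal: "ideal (env_ideal L) (free_alg L)"
  unfolding env_ideal_def by (rule free.genideal_ideal[OF env_relations_carrier])

lemma env_relations_env_ideal: "env_relations L \<subseteq> env_ideal L"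
  unfolding env_ideal_def by (rule free.genideal_self[OF env_relations_carrier])

text \<open>Serves as the induction principle for \<open>env_ideal\<close>: a property of all its
  elements is checked on the relations and shown to cut out an ideal.\<close>

lemma env_ideal_minimal:
  assumes "0 \<in> I" "I \<subseteq> carrier (free_alg L)" "\<And>f g. f \<in> I \<Longrightarrow> g \<in> I \<Longrightarrow> f + g \<in> I" "\<And>f. f \<in> I \<Longrightarrow> - f \<in> I"
    "\<And>f g. f \<in> I \<Longrightarrow> g \<in> carrier (free_alg L) \<Longrightarrow> g * f \<in> I"
    "\<And>f g. f \<in> I \<Longrightarrow> g \<in> carrier (free_alg L) \<Longrightarrow> f * g \<in> I"
    "env_relations L \<subseteq> I"
  shows "env_ideal L \<subseteq> I"
  unfolding env_ideal_def
proof (rule free.genideal_minimal)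
  show "ideal I (free_alg L)"
  proof (rule idealI[OF free_alg_ring])
    show "subgroup I (add_monoid (free_alg L))"
    proof (rule free.add.subgroupI)
      fix f assume "f \<in> I"
      with assms(2) have "\<ominus>\<^bsub>free_alg L\<^esub> f = - f" by (intro minus_free_alg) blast
      with \<open>f \<in> I\<close> show "\<ominus>\<^bsub>free_alg L\<^esub> f \<in> I" by (simp add: assms(4))
    qed (use assms in auto)
  qed (use assms in auto)
qed (rule assms)

end

section \<open>The graded basis of the Lie algebra, and the character on it\<close>

lemma b_alg_simps [simp]:
  "carrier b_alg = UNIV" "ring.add b_alg = (+)" "module.smult b_alg = scale" "lie_bracket b_alg = b_bracket"
  "\<zero>\<^bsub>b_alg\<^esub> = 0"
  by (simp_all add: b_alg_def)

interpretation b_alg: lie_operations b_alg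
  by unfold_locales auto

lemma carrier_free_alg_b [simp]: "carrier (free_alg b_alg) = UNIV"
  by (auto simp: carrier_free_alg)

lemma env_ideal_gen:
  "gen (x + x') - (gen x + gen x') \<in> env_ideal b_alg"
  "gen (scale c x) - scale c (gen x) \<in> env_ideal b_alg"
  "gen x * gen x' - gen x' * gen x - gen (b_bracket x x') \<in> env_ideal b_alg"
  by (rule subsetD[OF b_alg.env_relations_env_ideal], unfold env_relations_def b_alg_simps, blast)+

lemma b_bracket_conv: "b_bracket f g =
  linear_extension scale (\<lambda>(a, i). linear_extension scale
    (\<lambda>(b, j). scale (of_int ((b - 1) * int i - (a - 1) * int j)) (bx (a + b) (i + j - 1))) g) f"
  unfolding b_bracket_def linear_extension_def
  by (simp only: split_def prod.collapse scale.scale_sum_right scale.scale_scale mult.assoc)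

lemma b_bracket_linear:
  "b_bracket (f + f') g = b_bracket f g + b_bracket f' g"
  "b_bracket (scale a f) g = scale a (b_bracket f g)"
  "b_bracket f (g + g') = b_bracket f g + b_bracket f g'"
  "b_bracket f (scale a g) = scale a (b_bracket f g)"
proof -
  show "b_bracket (f + f') g = b_bracket f g + b_bracket f' g"
    "b_bracket (scale a f) g = scale a (b_bracket f g)"
    by (simp_all add: b_bracket_conv scale.linear_extension_add linear_extension_scale scale.module_axioms)
  show "b_bracket f (g + g') = b_bracket f g + b_bracket f g'"
    "b_bracket f (scale a g) = scale a (b_bracket f g)"
    by (simp_all only: b_bracket_conv split_def scale.linear_extension_add
        linear_extension_scale[OF scale.module_axioms]
        scale.linear_extension_fun_add scale.linear_extension_fun_scale)
qed

lemma b_bracket_bx: "b_bracket (bx a i) (bx b j)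
    = scale (of_int ((b - 1) * int i - (a - 1) * int j)) (bx (a + b) (i + j - 1))"
  by (simp add: b_bracket_conv bx_def del: scale_single)

definition yb :: "int \<Rightarrow> nat \<Rightarrow> bvec"
  where "yb d i = bx (1 + d - int i) i"

lemma b_bracket_y: "b_bracket (yb d i) (yb e j) = scale (of_int (e * int i - d * int j)) (yb (d + e) (i + j - 1))"
proof (cases "i + j = 0")
  case False
  then have "int (i + j - 1) = int i + int j - 1" by linarith
  then have "1 + d - int i + (1 + e - int j) = 1 + (d + e) - int (i + j - 1)" by simp
  moreover have "(1 + e - int j - 1) * int i - (1 + d - int i - 1) * int j = e * int i - d * int j"
    by (simp add: algebra_simps)
  ultimately show ?thesis
    unfolding yb_def b_bracket_bx by metis
qed (simp add: yb_def b_bracket_bx)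

lemma n_alg_simps [simp]:
  "carrier n_alg = scale.span {bx a i | a i. a + int i > 1}" "ring.add n_alg = (+)"
  "module.smult n_alg = scale" "lie_bracket n_alg = b_bracket"
  by (simp_all add: n_alg_def b_alg_def)

lemma bx_y: "bx a i = yb (a + int i - 1) i"
  by (simp add: yb_def)

lemma n_alg_carrier: "carrier n_alg = scale.span {yb d i | d i. 1 \<le> d}"
proof -
  have "{bx a i | a i. a + int i > 1} = {yb d i | d i. 1 \<le> d}"
  proof (intro equalityI subsetI)
    fix f assume "f \<in> {bx a i | a i. a + int i > 1}"
    then obtain a i where "f = yb (a + int i - 1) i" "a + int i > 1" by (auto simp: bx_y)
    then show "f \<in> {yb d i | d i. 1 \<le> d}" by (intro CollectI exI[of _ "a + int i - 1"] exI[of _ i]) simp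
  next
    fix f assume "f \<in> {yb d i | d i. 1 \<le> d}"
    then obtain d i where "f = bx (1 + d - int i) i" "1 \<le> d" by (auto simp: yb_def)
    then show "f \<in> {bx a i | a i. a + int i > 1}" by (intro CollectI exI[of _ "1 + d - int i"] exI[of _ i]) simp
  qed
  then show ?thesis by simp
qed

lemma n_alg_bracket: "f \<in> carrier n_alg \<Longrightarrow> g \<in> carrier n_alg \<Longrightarrow> b_bracket f g \<in> carrier n_alg"
  unfolding n_alg_carrier
proof (induction f rule: scale.span_induct_alt)
  case base
  show ?case using b_bracket_linear(2)[of 0 0 g] scale.span_zero by simp
next
  case (step c x f)
  have "b_bracket x g \<in> scale.span {yb d i | d i. 1 \<le> d}"
    using step(3)
  proof (induction g rule: scale.span_induct_alt)
    case base
    show ?case using b_bracket_linear(4)[of x 0 0] scale.span_zero by simp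
  next
    case (step c' z g)
    from step(1) \<open>x \<in> _\<close> obtain d i e j where "x = yb d i" "z = yb e j" "1 \<le> d" "1 \<le> e" by auto
    moreover from this have "yb (d + e) (i + j - 1) \<in> {yb d i | d i. 1 \<le> d}" by force
    ultimately have "b_bracket x z \<in> scale.span {yb d i | d i. 1 \<le> d}"
      by (simp only: b_bracket_y scale.span_scale scale.span_base)
    then show ?case using step by (auto simp: b_bracket_linear intro!: scale.span_add scale.span_scale)
  qed
  with step show ?case by (auto simp: b_bracket_linear intro!: scale.span_add scale.span_scale)
qed

interpretation n_alg: lie_operations n_alg
  by unfold_locales (simp_all only: n_alg_simps(2-4) n_alg_carrier scale.span_add scale.span_scale
    n_alg_bracket[unfolded n_alg_carrier])

text \<open>Additive inverses are covered by multiplication with \<open>- 1\<close>. The notion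
  serves the free algebra, where it encodes submodules of cyclic modules, as well as ideals of
  \<open>complex poly\<close>.\<close>

definition left_ideal :: "'r::ring_1 set \<Rightarrow> bool"
  where "left_ideal W \<longleftrightarrow> 0 \<in> W \<and> (\<forall>u\<in>W. \<forall>v\<in>W. u + v \<in> W) \<and> (\<forall>u\<in>W. \<forall>f. f * u \<in> W)"

text \<open>The left ideals that occur as annihilators, in the free algebra, of a Whittaker vector
  of type \<open>\<phi>\<close>; they correspond to the quotients of
  \<open>universal_whittaker \<phi>\<close>.\<close>

definition whittaker_ideal :: "(bvec \<Rightarrow> complex) \<Rightarrow> word_alg set \<Rightarrow> bool"
  where "whittaker_ideal \<phi> W \<longleftrightarrow> left_ideal W \<and> env_ideal b_alg \<subseteq> W \<and>
    (\<forall>x\<in>carrier n_alg. gen x - scale (\<phi> x) 1 \<in> W)"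

lemma lie_hom_n_alg:
  assumes "lie_hom n_alg abelian_line \<phi>"
  shows "f \<in> carrier n_alg \<Longrightarrow> g \<in> carrier n_alg \<Longrightarrow> \<phi> (f + g) = \<phi> f + \<phi> g"
    and "f \<in> carrier n_alg \<Longrightarrow> \<phi> (scale a f) = a * \<phi> f"
    and "f \<in> carrier n_alg \<Longrightarrow> g \<in> carrier n_alg \<Longrightarrow> \<phi> (b_bracket f g) = 0"
  using assms by (simp_all add: lie_hom_def abelian_line_def)

lemma y_n_alg: "1 \<le> d \<Longrightarrow> yb d i \<in> carrier n_alg"
  unfolding n_alg_carrier by (rule scale.span_base) auto

text \<open>\<open>\<phi>\<close> kills brackets, and for \<open>d \<ge> 2\<close> the bracket
  \<open>[y 1 0, y (d - 1) (i + 1)]\<close> is \<open>-(i + 1)\<close> times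
  \<open>y d i\<close>.\<close>

lemma character_y:
  assumes \<phi>: "lie_hom n_alg abelian_line \<phi>" and "2 \<le> d"
  shows "\<phi> (yb d i) = 0"
proof -
  have "b_bracket (yb 1 0) (yb (d - 1) (Suc i)) = scale (- of_nat (Suc i)) (yb d i)"
    unfolding b_bracket_y by simp
  with lie_hom_n_alg(3)[OF \<phi>, of "yb 1 0" "yb (d - 1) (Suc i)"] \<open>2 \<le> d\<close>
  have "\<phi> (scale (- of_nat (Suc i)) (yb d i)) = 0" by (simp add: y_n_alg del: n_alg_simps(1))
  then show ?thesis
    using lie_hom_n_alg(2)[OF \<phi> y_n_alg[of d i], of "- of_nat (Suc i)"] \<open>2 \<le> d\<close> by (simp del: of_nat_Suc)
qed

section \<open>The free algebra on \<B> acting on words modulo \<open>R\<close>\<close>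

context induced_words
begin

definition \<rho> :: "bvec \<Rightarrow> letter_words \<Rightarrow> letter_words"
  where "\<rho> x t = linear_extension scale (\<lambda>(a, i). Y (a + int i - 1) i t) x"

lemma \<rho>_linear:
  "\<rho> (x + x') t = \<rho> x t + \<rho> x' t" "\<rho> (scale a x) t = scale a (\<rho> x t)"
  "\<rho> x (t + t') = \<rho> x t + \<rho> x t'" "\<rho> x (scale a t) = scale a (\<rho> x t)" "\<rho> x 0 = 0"
  by (simp_all only: \<rho>_def scale.linear_extension_add linear_extension_scale[OF scale.module_axioms]
      split_def Y_add Y_scale scale.linear_extension_fun_add scale.linear_extension_fun_scale)
    (simp add: linear_extension_def)

lemma \<rho>_y: "\<rho> (yb d i) = Y d i"
  by (rule ext) (simp add: \<rho>_def yb_def bx_def)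

lemma \<rho>_R: "r \<in> R \<Longrightarrow> \<rho> x r \<in> R"
proof (induction x rule: linear_induct)
  case (single k)
  then have "\<rho> (bx (fst k) (snd k)) r \<in> R" by (simp add: bx_y \<rho>_y Y_R)
  then show ?case by (simp add: bx_def)
qed (auto simp: \<rho>_linear intro: R_add R_scale)

lemma \<rho>_comm: "\<rho> x (\<rho> x' t) - \<rho> x' (\<rho> x t) - \<rho> (b_bracket x x') t \<in> R"
proof -
  have "\<rho> (bx a i) (\<rho> (bx b j) t) - \<rho> (bx b j) (\<rho> (bx a i) t) - \<rho> (b_bracket (bx a i) (bx b j)) t \<in> R"
    for a b i j
    unfolding bx_y b_bracket_y \<rho>_y \<rho>_linear by (rule defect_R)
  then have basis: "\<rho> (single k 1) (\<rho> (single k' 1) t)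
    - \<rho> (single k' 1) (\<rho> (single k 1) t)
    - \<rho> (b_bracket (single k 1) (single k' 1)) t \<in> R" for k k'
    by (cases k; cases k') (simp add: bx_def)
  have regroup: "A1 - B1 - C1 + (A2 - B2 - C2) = A1 + A2 - (B1 + B2) - (C1 + C2)"
    for A1 A2 B1 B2 C1 C2 :: "letter_words" by simp
  show ?thesis
  proof (induction x rule: linear_induct)
    case (single k)
    show ?case
    proof (induction x' rule: linear_induct)
      case (add u v)
      from R_add[OF add] show ?case
        by (simp only: \<rho>_linear b_bracket_linear regroup)
    next
      case (scale a u)
      from R_scale[OF scale, of a] show ?case
        by (simp only: \<rho>_linear b_bracket_linear scale.scale_right_diff_distrib)
    qed (rule basis)
  next
    case (add u v)
    from R_add[OF add] show ?case
      by (simp only: \<rho>_linear b_bracket_linear regroup)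
  next
    case (scale a u)
    from R_scale[OF scale, of a] show ?case
      by (simp only: \<rho>_linear b_bracket_linear scale.scale_right_diff_distrib)
  qed
qed

definition act_word :: "bvec free_monoid \<Rightarrow> letter_words \<Rightarrow> letter_words"
  where "act_word w t = foldr \<rho> (letters w) t"

definition alg_act :: "word_alg \<Rightarrow> letter_words \<Rightarrow> letter_words"
  where "alg_act f t = linear_extension scale (\<lambda>w. act_word w t) f"

lemma act_word_simps [simp]: "act_word 0 t = t" "act_word (u + v) t = act_word u (act_word v t)"
  "act_word (Word [x]) t = \<rho> x t"
  by (simp_all add: act_word_def)

lemma foldr_\<rho>_linear:
  "foldr \<rho> l (t + t') = foldr \<rho> l t + foldr \<rho> l t'" "foldr \<rho> l (scale a t) = scale a (foldr \<rho> l t)"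
  by (induction l) (simp_all only: foldr.simps \<rho>_linear o_apply id_apply)

lemma alg_act_linear:
  "alg_act (f + g) t = alg_act f t + alg_act g t" "alg_act (f - g) t = alg_act f t - alg_act g t"
  "alg_act (scale a f) t = scale a (alg_act f t)"
  "alg_act f (t + t') = alg_act f t + alg_act f t'" "alg_act f (scale a t) = scale a (alg_act f t)"
  "alg_act 0 t = 0" "alg_act (single w 1) t = act_word w t"
  by (simp_all only: alg_act_def act_word_def scale.linear_extension_add scale.linear_extension_diff
      linear_extension_scale[OF scale.module_axioms] foldr_\<rho>_linear scale.linear_extension_zero
      scale.linear_extension_fun_add scale.linear_extension_fun_scale scale.linear_extension_single scale.scale_one)

lemma alg_act_simps [simp]: "alg_act 1 t = t" "alg_act (gen x) t = \<rho> x t"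
  by (simp_all add: alg_act_linear(7) gen_def single_one[symmetric] del: single_one)

lemma alg_act_mult: "alg_act (f * g) t = alg_act f (alg_act g t)"
proof (induction f rule: linear_induct)
  case (single u)
  show ?case
  proof (induction g rule: linear_induct)
    case (single v)
    show ?case by (simp add: mult_single alg_act_linear)
  next
    case (add g h)
    then show ?case by (simp only: distrib_left alg_act_linear)
  next
    case (scale a g)
    then show ?case by (simp only: scale_mult_right alg_act_linear)
  qed
qed (simp_all only: distrib_right alg_act_linear scale_mult_left)

lemma alg_act_R: "r \<in> R \<Longrightarrow> alg_act f r \<in> R"
proof (induction f rule: linear_induct)
  case (single u)
  have "foldr \<rho> l r \<in> R" for l by (induction l) (simp_all add: single \<rho>_R)
  then show ?case by (simp add: alg_act_linear act_word_def)
qed (auto simp: alg_act_linear intro: R_add R_scale)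

text \<open>The elements acting as 0 modulo \<open>R\<close> form a two-sided ideal because
  \<open>R\<close> is stable, and the relations lie in it by linearity and
  \<open>\<rho>_comm\<close>.\<close>

lemma env_ideal_alg_act: "f \<in> env_ideal b_alg \<Longrightarrow> alg_act f t \<in> R"
proof -
  have "env_ideal b_alg \<subseteq> {f. \<forall>t. alg_act f t \<in> R}"
  proof (rule b_alg.env_ideal_minimal)
    have "alg_act f t \<in> R" if "f \<in> env_relations b_alg" for f t
      using that unfolding env_relations_def
      by (auto simp: alg_act_linear alg_act_mult \<rho>_linear R_zero \<rho>_comm)
    then show "env_relations b_alg \<subseteq> {f. \<forall>t. alg_act f t \<in> R}" by blast
    fix f :: "word_alg"
    assume "f \<in> {f. \<forall>t. alg_act f t \<in> R}"
    then show "- f \<in> {f. \<forall>t. alg_act f t \<in> R}"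
      using alg_act_linear(2)[of 0 f] R_uminus by (simp add: alg_act_linear)
  qed (auto simp: alg_act_linear alg_act_mult R_zero alg_act_R intro: R_add)
  then show "f \<in> env_ideal b_alg \<Longrightarrow> alg_act f t \<in> R" by blast
qed

end

text \<open>\<open>W\<close> is the annihilator of the empty word modulo \<open>R\<close>. The
  kernel of the quotient of \<open>universal_whittaker \<phi>\<close> by \<open>z - \<xi>\<close>
  will turn out to lie in every such \<open>W\<close>, so this one shows that the quotient is
  nonzero.\<close>

proposition exists_whittaker_ideal:
  assumes \<phi>: "lie_hom n_alg abelian_line \<phi>"
  shows "\<exists>W. whittaker_ideal \<phi> W \<and> gen (bx 1 0) - scale \<xi> 1 \<in> W \<and> 1 \<notin> W"
proof -
  interpret induced_words "\<lambda>i. \<phi> (yb 1 i)" \<xi> .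
  let ?v = "single [] 1 :: letter_words"
  define W where "W = {f. alg_act f ?v \<in> R}"
  have "left_ideal W"
    by (auto simp: left_ideal_def W_def alg_act_linear alg_act_mult R_zero alg_act_R intro: R_add)
  moreover have "env_ideal b_alg \<subseteq> W"
    by (auto simp: W_def env_ideal_alg_act)
  moreover have "gen x - scale (\<phi> x) 1 \<in> W" if "x \<in> carrier n_alg" for x
  proof -
    have "\<rho> x ?v = scale (\<phi> x) ?v \<and> x \<in> carrier n_alg"
      using that unfolding n_alg_carrier
    proof (induction x rule: scale.span_induct_alt)
      case base
      show ?case
        using lie_hom_n_alg(2)[OF \<phi> y_n_alg[of 1 0], of 0] \<rho>_linear(2)[of 0 0 ?v]
        by (simp add: scale.span_zero)
    next
      case (step a x x')
      from step(1) obtain d i where x: "x = yb d i" "1 \<le> d" by auto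
      have x1: "x \<in> carrier n_alg" using x y_n_alg by blast
      have *: "x \<in> carrier n_alg" "x' \<in> carrier n_alg" "scale a x \<in> carrier n_alg"
        using x1 step(2) n_alg.smult_closed[OF x1, of a] unfolding n_alg_carrier by (simp_all only: n_alg_simps)
      have "\<rho> x ?v = scale (\<phi> x) ?v"
        using x character_y[OF \<phi>, of d i] by (cases "d = 1") (auto simp: \<rho>_y Y_def)
      moreover have "\<rho> x' ?v = scale (\<phi> x') ?v"
        using step by blast
      moreover have "\<phi> (scale a x + x') = a * \<phi> x + \<phi> x'"
        using lie_hom_n_alg(1)[OF \<phi> *(3,2)] lie_hom_n_alg(2)[OF \<phi> *(1), of a] by (simp only:)
      moreover have "scale a x + x' \<in> carrier n_alg"
        using n_alg.add_closed[OF *(3,2)] by (simp only: n_alg_simps)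
      ultimately show ?case
        by (simp only: \<rho>_linear scale.scale_left_distrib scale.scale_scale n_alg_carrier)
    qed
    then show ?thesis by (simp add: W_def alg_act_linear R_zero del: scale_single)
  qed
  moreover have "gen (bx 1 0) - scale \<xi> 1 \<in> W"
    using R_center[of ?v] by (simp add: W_def alg_act_linear bx_y \<rho>_y del: scale_single)
  moreover have "1 \<notin> W" using empty_word_notin_R by (simp add: W_def)
  ultimately show ?thesis unfolding whittaker_ideal_def by blast
qed

section \<open>Presentations of the quotients\<close>

lemma quot_module_carrier: "carrier (quot_module M N) = (\<lambda>x. N +>\<^bsub>M\<^esub> x) ` carrier M"
  by (auto simp: quot_module_def FactRing_def A_RCOSETS_def')

lemma quot_module_zero: "\<zero>\<^bsub>quot_module M N\<^esub> = N"
  by (simp add: quot_module_def FactRing_def)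

lemma quot_module_one: "\<one>\<^bsub>quot_module M N\<^esub> = N +>\<^bsub>M\<^esub> \<one>\<^bsub>M\<^esub>"
  by (simp add: quot_module_def FactRing_def)

lemma quot_module_add:
  assumes "abelian_subgroup N M" "x \<in> carrier M" "y \<in> carrier M"
  shows "(N +>\<^bsub>M\<^esub> x) \<oplus>\<^bsub>quot_module M N\<^esub> (N +>\<^bsub>M\<^esub> y) = N +>\<^bsub>M\<^esub> (x \<oplus>\<^bsub>M\<^esub> y)"
  using abelian_subgroup.a_rcos_sum[OF assms] by (simp add: quot_module_def FactRing_def)

lemma group_coset_eq_iff:
  assumes "group G" "subgroup H G" "x \<in> carrier G" "y \<in> carrier G"
  shows "H #>\<^bsub>G\<^esub> x = H #>\<^bsub>G\<^esub> y \<longleftrightarrow> x \<otimes>\<^bsub>G\<^esub> inv\<^bsub>G\<^esub> y \<in> H"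
proof -
  interpret group G by fact
  show ?thesis
    using assms subgroup.rcos_module[OF assms(2,1,4,3)] repr_independence[of x H y] rcos_self[of x H]
    by metis
qed

lemma coset_eq_iff:
  assumes "abelian_subgroup N M" "x \<in> carrier M" "y \<in> carrier M"
  shows "N +>\<^bsub>M\<^esub> x = N +>\<^bsub>M\<^esub> y \<longleftrightarrow> x \<ominus>\<^bsub>M\<^esub> y \<in> N"
proof -
  interpret abelian_subgroup N M by fact
  show ?thesis
    using group_coset_eq_iff[OF add.group_axioms a_subgroup, of x y] assms
    by (simp add: a_r_coset_def a_minus_def a_inv_def)
qed

lemma quot_module_smult:
  assumes "abelian_subgroup N M" "x \<in> carrier M"
    and "\<And>x. x \<in> carrier M \<Longrightarrow> a \<odot>\<^bsub>M\<^esub> x \<in> carrier M" "\<And>x. x \<in> N \<Longrightarrow> a \<odot>\<^bsub>M\<^esub> x \<in> N"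
    and "\<And>x y. x \<in> carrier M \<Longrightarrow> y \<in> carrier M \<Longrightarrow> a \<odot>\<^bsub>M\<^esub> (x \<oplus>\<^bsub>M\<^esub> y) = a \<odot>\<^bsub>M\<^esub> x \<oplus>\<^bsub>M\<^esub> a \<odot>\<^bsub>M\<^esub> y"
  shows "a \<odot>\<^bsub>quot_module M N\<^esub> (N +>\<^bsub>M\<^esub> x) = N +>\<^bsub>M\<^esub> (a \<odot>\<^bsub>M\<^esub> x)"
proof -
  interpret abelian_subgroup N M by fact
  have "N +>\<^bsub>M\<^esub> (a \<odot>\<^bsub>M\<^esub> y) = N +>\<^bsub>M\<^esub> (a \<odot>\<^bsub>M\<^esub> x)" if "y \<in> N +>\<^bsub>M\<^esub> x" for y
  proof -
    from that obtain h where h: "h \<in> N" "y = h \<oplus>\<^bsub>M\<^esub> x" by (auto simp: a_r_coset_def')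
    note carr = assms(3)[OF a_Hcarr[OF h(1)]] assms(3)[OF assms(2)]
    have "a \<odot>\<^bsub>M\<^esub> y = a \<odot>\<^bsub>M\<^esub> h \<oplus>\<^bsub>M\<^esub> a \<odot>\<^bsub>M\<^esub> x"
      unfolding h(2) by (rule assms(5)[OF a_Hcarr[OF h(1)] assms(2)])
    moreover have "a \<odot>\<^bsub>M\<^esub> h \<oplus>\<^bsub>M\<^esub> a \<odot>\<^bsub>M\<^esub> x \<ominus>\<^bsub>M\<^esub> a \<odot>\<^bsub>M\<^esub> x = a \<odot>\<^bsub>M\<^esub> h"
      using carr by (simp add: a_minus_def a_assoc r_neg)
    ultimately show ?thesis
      using coset_eq_iff[OF assms(1) a_closed[OF carr] carr(2)] assms(4)[OF h(1)] by (simp only:)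
  qed
  moreover have "x \<in> N +>\<^bsub>M\<^esub> x" using assms(2) by (rule a_rcos_self)
  ultimately have "(\<Union>y\<in>N +>\<^bsub>M\<^esub> x. N +>\<^bsub>M\<^esub> (a \<odot>\<^bsub>M\<^esub> y)) = N +>\<^bsub>M\<^esub> (a \<odot>\<^bsub>M\<^esub> x)"
    by (intro SUP_eq_const) blast+
  then show ?thesis
    by (simp only: quot_module_def module.simps)
qed

section \<open>The enveloping algebra, described by representatives\<close>

context lie_operations
begin

abbreviation cls :: "('g free_monoid \<Rightarrow>\<^sub>0 complex) \<Rightarrow> ('g free_monoid \<Rightarrow>\<^sub>0 complex) set"
  where "cls f \<equiv> env_ideal L +>\<^bsub>free_alg L\<^esub> f"

lemma env_ideal_abelian_subgroup: "abelian_subgroup (env_ideal L) (free_alg L)"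
  using env_ideal_ideal by (rule abelian_subgroupI3[OF ideal.axioms(1) free.abelian_group_axioms])

lemma env_ideal_closed:
  "0 \<in> env_ideal L" "f \<in> env_ideal L \<Longrightarrow> g \<in> env_ideal L \<Longrightarrow> f + g \<in> env_ideal L"
  "f \<in> env_ideal L \<Longrightarrow> - f \<in> env_ideal L"
  "f \<in> env_ideal L \<Longrightarrow> g \<in> carrier (free_alg L) \<Longrightarrow> g * f \<in> env_ideal L"
  "f \<in> env_ideal L \<Longrightarrow> g \<in> carrier (free_alg L) \<Longrightarrow> f * g \<in> env_ideal L"
proof -
  interpret ideal "env_ideal L" "free_alg L" by (rule env_ideal_ideal)
  show "0 \<in> env_ideal L" using zero_closed by simp
  show "f + g \<in> env_ideal L" if "f \<in> env_ideal L" "g \<in> env_ideal L" using a_closed[OF that] by simp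
  show "- f \<in> env_ideal L" if "f \<in> env_ideal L"
    using a_inv_closed[OF that] minus_free_alg[OF a_Hcarr[OF that]] by simp
  show "g * f \<in> env_ideal L" if "f \<in> env_ideal L" "g \<in> carrier (free_alg L)"
    using I_l_closed[OF that] by simp
  show "f * g \<in> env_ideal L" if "f \<in> env_ideal L" "g \<in> carrier (free_alg L)"
    using I_r_closed[OF that] by simp
qed

lemma cls_eq_iff:
  assumes "f \<in> carrier (free_alg L)" "g \<in> carrier (free_alg L)"
  shows "cls f = cls g \<longleftrightarrow> f - g \<in> env_ideal L"
  using coset_eq_iff[OF env_ideal_abelian_subgroup assms] minus_free_alg[OF assms(2)]
  by (simp add: a_minus_def)

lemma cls_self: "f \<in> carrier (free_alg L) \<Longrightarrow> f \<in> cls f"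
  by (rule abelian_subgroup.a_rcos_self[OF env_ideal_abelian_subgroup])

lemma mem_cls_iff: "g \<in> cls f \<longleftrightarrow> g - f \<in> env_ideal L"
  by (auto simp: a_r_coset_def') (metis diff_add_cancel)

lemma univ_env_carrier: "carrier (univ_env L) = cls ` carrier (free_alg L)"
  by (simp add: univ_env_def quot_module_carrier)

lemma univ_env_zero_one: "\<zero>\<^bsub>univ_env L\<^esub> = env_ideal L" "\<one>\<^bsub>univ_env L\<^esub> = cls 1"
  by (simp_all add: univ_env_def quot_module_zero quot_module_one)

lemma univ_env_add:
  "f \<in> carrier (free_alg L) \<Longrightarrow> g \<in> carrier (free_alg L) \<Longrightarrow> cls f \<oplus>\<^bsub>univ_env L\<^esub> cls g = cls (f + g)"
  using quot_module_add[OF env_ideal_abelian_subgroup] by (simp add: univ_env_def)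

lemma univ_env_mult:
  "f \<in> carrier (free_alg L) \<Longrightarrow> g \<in> carrier (free_alg L) \<Longrightarrow> cls f \<otimes>\<^bsub>univ_env L\<^esub> cls g = cls (f * g)"
  using ideal.rcoset_mult_add[OF env_ideal_ideal] by (simp add: univ_env_def quot_module_def FactRing_def)

lemma env_ideal_scale: "f \<in> env_ideal L \<Longrightarrow> scale a f \<in> env_ideal L"
  using env_ideal_closed(4)[of f "scale a 1"]
  by (simp add: scale_one_mult scale_carrier[OF free.one_closed, simplified])

lemma univ_env_smult:
  assumes "f \<in> carrier (free_alg L)"
  shows "a \<odot>\<^bsub>univ_env L\<^esub> cls f = cls (scale a f)"
  using quot_module_smult[OF env_ideal_abelian_subgroup assms, of a]
  by (simp add: univ_env_def scale_carrier env_ideal_scale scale.scale_right_distrib)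

end

text \<open>What makes \<open>env_map\<close> meaningful: classes modulo the relations of \<nn> are
  contained in classes modulo those of \<B>.\<close>

lemma env_ideal_n_subset: "env_ideal n_alg \<subseteq> env_ideal b_alg"
proof -
  have "env_ideal n_alg \<subseteq> env_ideal b_alg \<inter> carrier (free_alg n_alg)"
  proof (rule n_alg.env_ideal_minimal)
    have "env_relations n_alg \<subseteq> env_relations b_alg"
      unfolding env_relations_def n_alg_simps(2-4) b_alg_simps by blast
    then show "env_relations n_alg \<subseteq> env_ideal b_alg \<inter> carrier (free_alg n_alg)"
      using b_alg.env_relations_env_ideal n_alg.env_relations_carrier by blast
  next
    fix f assume f: "f \<in> env_ideal b_alg \<inter> carrier (free_alg n_alg)"
    then have "\<ominus>\<^bsub>free_alg n_alg\<^esub> f \<in> carrier (free_alg n_alg)" by (intro n_alg.free.a_inv_closed) auto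
    with f show "- f \<in> env_ideal b_alg \<inter> carrier (free_alg n_alg)"
      by (auto simp: minus_free_alg b_alg.env_ideal_closed)
  qed (use n_alg.free.a_closed n_alg.free.m_closed n_alg.free.zero_closed in \<open>auto intro: b_alg.env_ideal_closed\<close>)
  then show ?thesis by blast
qed

abbreviation "cls \<equiv> b_alg.cls"

lemma env_map_cls:
  assumes "g \<in> carrier (free_alg n_alg)"
  shows "env_map b_alg (n_alg.cls g) = cls g"
proof
  show "env_map b_alg (n_alg.cls g) \<subseteq> cls g"
    using env_ideal_n_subset b_alg.env_ideal_closed(2)
    by (fastforce simp: env_map_def set_add_def' a_r_coset_def')
  show "cls g \<subseteq> env_map b_alg (n_alg.cls g)"
    using n_alg.cls_self[OF assms]
    by (fastforce simp: env_map_def set_add_def' a_r_coset_def'[of "free_alg b_alg"])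
qed

definition character :: "(bvec \<Rightarrow> complex) \<Rightarrow> word_alg \<Rightarrow> complex"
  where "character \<phi> = linear_extension (*) (\<lambda>w. prod_list (map \<phi> (letters w)))"

lemma character_simps:
  "character \<phi> (f + g) = character \<phi> f + character \<phi> g" "character \<phi> (f - g) = character \<phi> f - character \<phi> g"
  "character \<phi> (scale a f) = a * character \<phi> f" "character \<phi> 0 = 0"
  "character \<phi> (single w 1) = prod_list (map \<phi> (letters w))"
  by (simp_all add: character_def complex_line.linear_extension_add complex_line.linear_extension_diff
      linear_extension_scale complex_line.module_axioms)

lemma character_gen [simp]: "character \<phi> (gen x) = \<phi> x"
  by (simp add: gen_def character_simps)

lemma character_mult: "character \<phi> (f * g) = character \<phi> f * character \<phi> g"
proof (induction f rule: linear_induct)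
  case (single u)
  show ?case
  proof (induction g rule: linear_induct)
    case (single v)
    show ?case by (simp add: mult_single character_simps)
  next
    case (add g h)
    then show ?case by (simp only: distrib_left character_simps)
  next
    case (scale a g)
    then show ?case by (simp only: scale_mult_right character_simps mult.left_commute)
  qed
qed (simp_all only: distrib_right character_simps scale_mult_left mult.assoc)

lemma one_dim_module_simps [simp]:
  "carrier (one_dim_module \<phi>) = UNIV" "ring.add (one_dim_module \<phi>) = (+)"
  "\<zero>\<^bsub>one_dim_module \<phi>\<^esub> = 0" "module.smult (one_dim_module \<phi>) = (*)"
  "act (one_dim_module \<phi>) = (\<lambda>x c. \<phi> x * c)"
  by (simp_all add: one_dim_module_def)

lemma finsum_one_dim: "finite A \<Longrightarrow> finsum (one_dim_module \<phi>) f A = sum f A"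
proof -
  interpret abelian_monoid "one_dim_module \<phi>"
    by (rule abelian_monoidI) auto
  show "finite A \<Longrightarrow> finsum (one_dim_module \<phi>) f A = sum f A"
    by (induction A rule: finite_induct) simp_all
qed

lemma free_act_one_dim: "free_act (one_dim_module \<phi>) f c = character \<phi> f * c"
proof -
  have "foldr (act (one_dim_module \<phi>)) l c = prod_list (map \<phi> l) * c" for l
    by (induction l) simp_all
  then show ?thesis
    unfolding free_act_def finsum_one_dim[OF finite_keys]
    by (simp only: character_def linear_extension_def one_dim_module_simps sum_distrib_right mult.assoc)
qed

lemma character_env_ideal:
  assumes \<phi>: "lie_hom n_alg abelian_line \<phi>" and "f \<in> env_ideal n_alg"
  shows "character \<phi> f = 0"
proof -
  have "env_ideal n_alg \<subseteq> {f \<in> carrier (free_alg n_alg). character \<phi> f = 0}"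
  proof (rule n_alg.env_ideal_minimal)
    have "character \<phi> f = 0" if "f \<in> env_relations n_alg" for f
      using that unfolding env_relations_def n_alg_simps(2-4)
      by (auto simp: character_simps character_mult lie_hom_n_alg[OF \<phi>] simp del: n_alg_simps(1))
    then show "env_relations n_alg \<subseteq> {f \<in> carrier (free_alg n_alg). character \<phi> f = 0}"
      using n_alg.env_relations_carrier by blast
  next
    fix f assume f: "f \<in> {f \<in> carrier (free_alg n_alg). character \<phi> f = 0}"
    then have "\<ominus>\<^bsub>free_alg n_alg\<^esub> f \<in> carrier (free_alg n_alg)" by (intro n_alg.free.a_inv_closed) auto
    with f show "- f \<in> {f \<in> carrier (free_alg n_alg). character \<phi> f = 0}"
      using character_simps(2)[of \<phi> 0 f] by (auto simp: minus_free_alg character_simps)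
  qed (use n_alg.free.a_closed n_alg.free.m_closed n_alg.free.zero_closed in \<open>auto simp: character_simps character_mult\<close>)
  with assms(2) show ?thesis by blast
qed

text \<open>\<open>the_elem\<close> picks a genuine value because \<open>character \<phi>\<close> is
  constant on classes modulo the relations of \<nn>.\<close>

lemma env_module_smult:
  assumes "lie_hom n_alg abelian_line \<phi>" "g \<in> carrier (free_alg n_alg)"
  shows "n_alg.cls g \<odot>\<^bsub>env_module (one_dim_module \<phi>)\<^esub> c = character \<phi> g * c"
proof -
  have "(\<lambda>f. free_act (one_dim_module \<phi>) f c) ` n_alg.cls g = {character \<phi> g * c}"
  proof -
    have "character \<phi> f = character \<phi> g" if "f \<in> n_alg.cls g" for f
      using that character_env_ideal[OF assms(1), of "f - g"]
      by (simp add: n_alg.mem_cls_iff character_simps)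
    then have "(\<lambda>f. free_act (one_dim_module \<phi>) f c) ` n_alg.cls g = (\<lambda>_. character \<phi> g * c) ` n_alg.cls g"
      by (intro image_cong refl) (simp only: free_act_one_dim)
    then show ?thesis using image_constant[OF n_alg.cls_self[OF assms(2)]] by (simp only:)
  qed
  then show ?thesis by (simp add: env_module_def)
qed

text \<open>A cyclic module given by a surjection \<open>f \<mapsto> f v\<close> from the free
  algebra. It replaces cosets by representatives: whatever the type of the carrier, the module is
  determined up to isomorphism by the left ideal of all \<open>f\<close> with
  \<open>\<pi> f = \<pi> 0\<close>.\<close>

definition presents :: "(word_alg \<Rightarrow> 'v) \<Rightarrow> (bvec, 'v, 'y) lie_mod_scheme \<Rightarrow> bool"
  where "presents \<pi> V \<longleftrightarrow> carrier V = range \<pi> \<and> \<zero>\<^bsub>V\<^esub> = \<pi> 0 \<and>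
    (\<forall>f g. \<pi> f \<oplus>\<^bsub>V\<^esub> \<pi> g = \<pi> (f + g)) \<and> (\<forall>c f. c \<odot>\<^bsub>V\<^esub> \<pi> f = \<pi> (scale c f)) \<and>
    (\<forall>x f. act V x (\<pi> f) = \<pi> (gen x * f))"

lemma left_ideal_add: "left_ideal W \<Longrightarrow> u \<in> W \<Longrightarrow> v \<in> W \<Longrightarrow> u + v \<in> W"
  by (simp add: left_ideal_def)

lemma left_ideal_mult: "left_ideal W \<Longrightarrow> u \<in> W \<Longrightarrow> f * u \<in> W"
  by (simp add: left_ideal_def)

lemma left_ideal_diff: "left_ideal W \<Longrightarrow> u \<in> W \<Longrightarrow> v \<in> W \<Longrightarrow> u - v \<in> W"
  using left_ideal_add[of W u "- v"] left_ideal_mult[of W v "- 1"] by simp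

lemma left_ideal_scale: "left_ideal W \<Longrightarrow> u \<in> W \<Longrightarrow> scale a u \<in> W"
  for W :: "('k::monoid_add \<Rightarrow>\<^sub>0 complex) set"
  using left_ideal_mult[of W u "scale a 1"] by (simp only: scale_one_mult)

lemma left_ideal_sum: "left_ideal W \<Longrightarrow> (\<And>x. x \<in> A \<Longrightarrow> f x \<in> W) \<Longrightarrow> sum f A \<in> W"
  by (induction A rule: infinite_finite_induct) (auto simp: left_ideal_def)

section \<open>The induced module as a tensor product\<close>

locale whittaker_character =
  fixes \<phi> :: "bvec \<Rightarrow> complex"
  assumes hom: "lie_hom n_alg abelian_line \<phi>"
begin

abbreviation F :: "(word_alg set \<times> complex \<Rightarrow>\<^sub>0 int) monoid"
  where "F \<equiv> free_Abelian_group (range cls \<times> UNIV)"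

abbreviation T :: "(word_alg set \<times> complex \<Rightarrow>\<^sub>0 int) set"
  where "T \<equiv> tensor_subgroup (univ_env n_alg) (env_right_module b_alg) (env_module (one_dim_module \<phi>))"

abbreviation relations
  where "relations \<equiv> tensor_relations (univ_env n_alg) (env_right_module b_alg) (env_module (one_dim_module \<phi>))"

abbreviation M where "M \<equiv> universal_whittaker \<phi>"

lemma carrier_U: "carrier (univ_env b_alg) = range cls"
  by (simp add: b_alg.univ_env_carrier)

lemma carriers: "carrier (env_right_module b_alg) = range cls" "carrier (env_module (one_dim_module \<phi>)) = UNIV"
  by (simp_all add: env_right_module_def carrier_U env_module_def)

text \<open>In terms of representatives the balancing relation reads
  \<open>f g \<otimes> c = f \<otimes> \<phi>(g) c\<close>, since \<nn> acts on the one-dimensional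
  module through the character.\<close>

lemma tensor_relations_conv:
  "relations =
    {frag_of (cls (f + f'), c) - frag_of (cls f, c) - frag_of (cls f', c) | f f' c. True} \<union>
    {frag_of (cls f, c + c') - frag_of (cls f, c) - frag_of (cls f, c') | f c c'. True} \<union>
    {frag_of (cls (f * g), c) - frag_of (cls f, character \<phi> g * c) | f g c. g \<in> carrier (free_alg n_alg)}"
  (is "?R = ?A \<union> ?B \<union> ?C")
proof -
  have 1: "{frag_of (m \<oplus>\<^bsub>env_right_module b_alg\<^esub> m', n) - frag_of (m, n) - frag_of (m', n) | m m' n.
       m \<in> carrier (env_right_module b_alg) \<and> m' \<in> carrier (env_right_module b_alg) \<and> n \<in> carrier (env_module (one_dim_module \<phi>))} = ?A"
  proof -
    have "cls f \<oplus>\<^bsub>env_right_module b_alg\<^esub> cls f' = cls (f + f')" for f f'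
      by (simp add: env_right_module_def b_alg.univ_env_add)
    note add = this[symmetric]
    show ?thesis unfolding carriers add by blast
  qed
  have 2: "{frag_of (m, n \<oplus>\<^bsub>env_module (one_dim_module \<phi>)\<^esub> n') - frag_of (m, n) - frag_of (m, n') | m n n'.
       m \<in> carrier (env_right_module b_alg) \<and> n \<in> carrier (env_module (one_dim_module \<phi>)) \<and> n' \<in> carrier (env_module (one_dim_module \<phi>))} = ?B"
    by (auto simp: env_right_module_def carrier_U env_module_def)
  have 3: "frag_of (n_alg.cls g \<odot>\<^bsub>env_right_module b_alg\<^esub> cls f, c) - frag_of (cls f, n_alg.cls g \<odot>\<^bsub>env_module (one_dim_module \<phi>)\<^esub> c)
    = frag_of (cls (f * g), c) - frag_of (cls f, character \<phi> g * c)" if "g \<in> carrier (free_alg n_alg)" for f g c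
    using that by (simp add: env_module_smult[OF hom] env_right_module_def env_map_cls b_alg.univ_env_mult)
  have "{frag_of (a \<odot>\<^bsub>env_right_module b_alg\<^esub> m, n) - frag_of (m, a \<odot>\<^bsub>env_module (one_dim_module \<phi>)\<^esub> n) | a m n.
       a \<in> carrier (univ_env n_alg) \<and> m \<in> carrier (env_right_module b_alg) \<and> n \<in> carrier (env_module (one_dim_module \<phi>))}
    = {frag_of (n_alg.cls g \<odot>\<^bsub>env_right_module b_alg\<^esub> cls f, c) - frag_of (cls f, n_alg.cls g \<odot>\<^bsub>env_module (one_dim_module \<phi>)\<^esub> c) | f g c.
        g \<in> carrier (free_alg n_alg)}"
    unfolding carriers n_alg.univ_env_carrier by blast
  also have "\<dots> = ?C" using 3 by (intro Collect_cong) metis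
  finally show ?thesis unfolding tensor_relations_def 1 2 by simp
qed

lemma T_conv: "T = generate F (relations)"
  by (simp add: tensor_subgroup_def carriers)

lemma diff_carrier_F: "x \<in> carrier F \<Longrightarrow> y \<in> carrier F \<Longrightarrow> x - y \<in> carrier F"
  using keys_diff[of x y] by auto

lemma relations_carrier:
  "relations \<subseteq> carrier F"
  unfolding tensor_relations_conv
  by (auto simp del: carrier_free_Abelian_group_iff intro!: diff_carrier_F)

lemma T_subgroup: "subgroup T F"
  unfolding T_conv by (rule group.generate_is_subgroup[OF group_free_Abelian_group relations_carrier])

lemma T_subset: "x \<in> T \<Longrightarrow> x \<in> carrier F"
  using subgroup.subset[OF T_subgroup] by blast

lemma T_diff: "x \<in> T \<Longrightarrow> y \<in> T \<Longrightarrow> x - y \<in> T"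
  using subgroup.m_closed[OF T_subgroup, of x "- y"] subgroup.m_inv_closed[OF T_subgroup, of y] T_subset[of y]
  by simp

lemma T_zero: "0 \<in> T"
  using subgroup.one_closed[OF T_subgroup] by simp

lemma T_add: "x \<in> T \<Longrightarrow> y \<in> T \<Longrightarrow> x + y \<in> T"
  using subgroup.m_closed[OF T_subgroup, of x y] by simp

lemma T_uminus: "x \<in> T \<Longrightarrow> - x \<in> T"
  using T_diff[OF T_zero, of x] by simp

lemma T_induct [consumes 1, case_names zero diff add_left add_right middle]:
  assumes "x \<in> T" and "P 0" and "\<And>x y. P x \<Longrightarrow> P y \<Longrightarrow> P (x - y)"
    and "\<And>f f' c. P (frag_of (cls (f + f'), c) - frag_of (cls f, c) - frag_of (cls f', c))"
    and "\<And>f c c'. P (frag_of (cls f, c + c') - frag_of (cls f, c) - frag_of (cls f, c'))"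
    and "\<And>f g c. g \<in> carrier (free_alg n_alg) \<Longrightarrow> P (frag_of (cls (f * g), c) - frag_of (cls f, character \<phi> g * c))"
  shows "P x"
proof -
  have rel: "P x" if "x \<in> relations" for x
    using that assms(4-6) unfolding tensor_relations_conv by blast
  have neg: "P (- x)" if "P x" for x using assms(3)[OF assms(2) that] by simp
  show ?thesis
    using assms(1) unfolding T_conv
  proof (induction rule: generate.induct)
    case (inv h)
    then have "h \<in> carrier F" using relations_carrier by blast
    then have "inv\<^bsub>F\<^esub> h = - h"
      by (intro inv_free_Abelian_group) (simp only: carrier_free_Abelian_group_iff)
    then show ?case using inv by (simp add: neg rel)
  next
    case (eng h1 h2)
    then show ?case using assms(3)[of h1 "- h2"] neg by simp
  qed (use assms(2) rel in auto)
qed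

lemma M_carrier: "carrier M = (\<lambda>x. T #>\<^bsub>F\<^esub> x) ` carrier F"
  by (auto simp: universal_whittaker_def induced_module_def tensor_module_def Let_def carriers FactGroup_def RCOSETS_def)

lemma M_zero: "\<zero>\<^bsub>M\<^esub> = T"
  by (simp add: universal_whittaker_def induced_module_def tensor_module_def Let_def carriers FactGroup_def)

lemma M_add:
  assumes "x \<in> carrier F" "y \<in> carrier F"
  shows "(T #>\<^bsub>F\<^esub> x) \<oplus>\<^bsub>M\<^esub> (T #>\<^bsub>F\<^esub> y) = T #>\<^bsub>F\<^esub> (x + y)"
proof -
  interpret comm_group F by (rule abelian_free_Abelian_group)
  have "T \<lhd> F" using T_subgroup by (simp add: normal_iff_subgroup)
  then have "(T #>\<^bsub>F\<^esub> x) <#>\<^bsub>F\<^esub> (T #>\<^bsub>F\<^esub> y) = T #>\<^bsub>F\<^esub> (x \<otimes>\<^bsub>F\<^esub> y)"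
    using assms by (rule normal.rcos_sum)
  then show ?thesis
    by (simp add: universal_whittaker_def induced_module_def tensor_module_def Let_def carriers FactGroup_def)
qed

lemma T_coset_eq_iff:
  assumes "x \<in> carrier F" "y \<in> carrier F"
  shows "T #>\<^bsub>F\<^esub> x = T #>\<^bsub>F\<^esub> y \<longleftrightarrow> x - y \<in> T"
  using group_coset_eq_iff[OF group_free_Abelian_group T_subgroup assms] assms by simp

text \<open>The tensor \<open>f \<otimes> 1\<close>. Every element of \<open>M\<close> has this
  form, because scalars can be moved into the left factor and sums collected there.\<close>

definition pure :: "word_alg \<Rightarrow> whittaker_vec"
  where "pure f = T #>\<^bsub>F\<^esub> frag_of (cls f, 1)"

lemma frag_of_F [simp]: "frag_of (cls f, c) \<in> carrier F"
  by simp

lemma relations_T: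
  "x \<in> relations \<Longrightarrow> x \<in> T"
  by (subst T_conv) (rule generate.incl)

lemma T_add_left: "frag_of (cls (f + f'), c) - frag_of (cls f, c) - frag_of (cls f', c) \<in> T"
  by (rule relations_T, subst tensor_relations_conv) blast

lemma T_add_right: "frag_of (cls f, c + c') - frag_of (cls f, c) - frag_of (cls f, c') \<in> T"
  by (rule relations_T, subst tensor_relations_conv) blast

lemma T_middle: "g \<in> carrier (free_alg n_alg) \<Longrightarrow> frag_of (cls (f * g), c) - frag_of (cls f, character \<phi> g * c) \<in> T"
  by (rule relations_T, subst tensor_relations_conv) blast

lemma add_carrier_F: "x \<in> carrier F \<Longrightarrow> y \<in> carrier F \<Longrightarrow> x + y \<in> carrier F"
  using keys_add[of x y] by auto

lemma pure_add: "pure f \<oplus>\<^bsub>M\<^esub> pure g = pure (f + g)"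
proof -
  have "frag_of (cls (f + g), 1) - (frag_of (cls f, 1) + frag_of (cls g, 1)) \<in> T"
    using T_add_left[of f g 1] by (simp only: diff_diff_eq)
  then show ?thesis
    unfolding pure_def M_add[OF frag_of_F frag_of_F]
    by (subst T_coset_eq_iff[OF add_carrier_F[OF frag_of_F frag_of_F] frag_of_F])
      (drule T_uminus, simp only: minus_diff_eq)
qed

lemma one_smult_carrier: "scale c 1 \<in> carrier (free_alg n_alg)"
  using scale_carrier[OF n_alg.free.one_closed] by simp

text \<open>Scalars cross the tensor sign as the constants \<open>scale c 1\<close> over \<nn>, on
  which the character takes the value \<open>c\<close>.\<close>

lemma pure_tensor: "frag_of (cls f, c) - frag_of (cls (scale c f), 1) \<in> T"
proof -
  have "frag_of (cls (f * scale c 1), 1) - frag_of (cls f, character \<phi> (scale c 1) * 1) \<in> T"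
    using one_smult_carrier by (rule T_middle)
  moreover have "character \<phi> (scale c 1) = c"
    by (simp only: character_simps single_one[symmetric]) (simp add: letters_zero)
  ultimately have "frag_of (cls (scale c f), 1) - frag_of (cls f, c) \<in> T"
    by (simp only: scale_one_mult mult_1_right)
  then show ?thesis
    by (drule_tac T_uminus) (simp only: minus_diff_eq)
qed

lemma pure_dense:
  assumes "x \<in> carrier F"
  obtains f where "x - frag_of (cls f, 1) \<in> T"
proof -
  have "\<exists>f. x - frag_of (cls f, 1) \<in> T" if "keys x \<subseteq> range cls \<times> UNIV" for x
    using that
  proof (rule free_Abelian_group_induct)
    show "\<exists>f. 0 - frag_of (cls f, 1) \<in> T" using T_add_left[of 0 0 1] by (intro exI[of _ 0]) simp
  next
    fix x y :: "word_alg set \<times> complex \<Rightarrow>\<^sub>0 int"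
    assume "\<exists>f. x - frag_of (cls f, 1) \<in> T" "\<exists>f. y - frag_of (cls f, 1) \<in> T"
    then obtain f g where "x - frag_of (cls f, 1) \<in> T" "y - frag_of (cls g, 1) \<in> T" by blast
    from T_add[OF T_diff[OF this] T_add_left[of "f - g" g 1]]
    show "\<exists>f. x - y - frag_of (cls f, 1) \<in> T" by (intro exI[of _ "f - g"]) simp
  next
    fix a :: "word_alg set \<times> complex" assume "a \<in> range cls \<times> UNIV"
    then obtain f c where "a = (cls f, c)" by auto
    then show "\<exists>f. frag_of a - frag_of (cls f, 1) \<in> T" using pure_tensor by blast
  qed
  from this[of x] assms obtain f where "x - frag_of (cls f, 1) \<in> T" by auto
  then show ?thesis by (rule that)
qed

lemma pure_range: "carrier M = range pure"
proof
  show "range pure \<subseteq> carrier M"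
    unfolding pure_def M_carrier using frag_of_F by blast
  show "carrier M \<subseteq> range pure"
  proof
    fix v assume "v \<in> carrier M"
    then obtain x where x: "x \<in> carrier F" "v = T #>\<^bsub>F\<^esub> x" by (auto simp: M_carrier)
    from x(1) obtain f where "x - frag_of (cls f, 1) \<in> T" by (rule pure_dense)
    then have "v = pure f" unfolding pure_def x(2) using T_coset_eq_iff[OF x(1) frag_of_F] by blast
    then show "v \<in> range pure" by blast
  qed
qed

lemma pure_eq_iff: "pure f = pure g \<longleftrightarrow> frag_of (cls f, 1) - frag_of (cls g, 1) \<in> T"
  unfolding pure_def by (rule T_coset_eq_iff[OF frag_of_F frag_of_F])

lemma pure_zero: "pure 0 = \<zero>\<^bsub>M\<^esub>"
proof -
  have "frag_of (cls 0, 1) - 0 \<in> T"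
    using T_uminus[OF T_add_left[of 0 0 1]] by simp
  then have "pure 0 = T #>\<^bsub>F\<^esub> 0"
    unfolding pure_def by (subst T_coset_eq_iff) simp_all
  also have "\<dots> = T"
    using group.coset_join2[OF group_free_Abelian_group _ T_subgroup, of 0] T_zero by simp
  finally show ?thesis by (simp add: M_zero)
qed

lemma pure_eq_diff: "pure f = pure g \<longleftrightarrow> pure (f - g) = pure 0"
proof -
  have 1: "frag_of (cls f, 1) - frag_of (cls (f - g), 1) - frag_of (cls g, 1) \<in> T"
    using T_add_left[of "f - g" g 1] by simp
  have 2: "frag_of (cls 0, 1) \<in> T"
    using T_uminus[OF T_add_left[of 0 0 1]] by simp
  show ?thesis
    unfolding pure_eq_iff
  proof
    assume "frag_of (cls f, 1) - frag_of (cls g, 1) \<in> T"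
    from T_diff[OF T_diff[OF this 1] 2] show "frag_of (cls (f - g), 1) - frag_of (cls 0, 1) \<in> T" by simp
  next
    assume "frag_of (cls (f - g), 1) - frag_of (cls 0, 1) \<in> T"
    from T_add[OF T_add[OF this 2] 1] show "frag_of (cls f, 1) - frag_of (cls g, 1) \<in> T" by simp
  qed
qed

abbreviation left_mult where
  "left_mult u \<equiv> frag_extend (\<lambda>(m, n). frag_of (u \<otimes>\<^bsub>univ_env b_alg\<^esub> m, n))"

lemma left_mult_frag: "left_mult (cls h) (frag_of (cls f, c)) = frag_of (cls (h * f), c)"
  by (simp add: b_alg.univ_env_mult)

lemma left_mult_T: "x \<in> T \<Longrightarrow> left_mult (cls h) x \<in> T"
  by (induction rule: T_induct)
    (simp_all only: frag_extend_diff frag_extend_0 left_mult_frag distrib_left T_zero T_diff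
      T_add_left T_add_right mult.assoc[symmetric] T_middle)

lemma left_mult_F: "x \<in> carrier F \<Longrightarrow> left_mult (cls h) x \<in> carrier F"
  using keys_frag_extend[of "\<lambda>(m, n). frag_of (cls h \<otimes>\<^bsub>univ_env b_alg\<^esub> m, n)" x]
  by (fastforce simp: b_alg.univ_env_mult)

lemma M_smult: "cls h \<odot>\<^bsub>M\<^esub> pure f = pure (h * f)"
proof -
  have "cls h \<odot>\<^bsub>M\<^esub> C = (\<Union>x\<in>C. T #>\<^bsub>F\<^esub> left_mult (cls h) x)" for C
    by (simp add: universal_whittaker_def induced_module_def tensor_module_def Let_def carriers)
  moreover have "T #>\<^bsub>F\<^esub> left_mult (cls h) x = pure (h * f)" if "x \<in> pure f" for x
  proof -
    from that obtain t where t: "t \<in> T" "x = t + frag_of (cls f, 1)"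
      unfolding pure_def by (auto simp: r_coset_def)
    then have "left_mult (cls h) x - frag_of (cls (h * f), 1) \<in> T"
      using left_mult_T[OF t(1)] by (simp only: frag_extend_add left_mult_frag add_diff_cancel_right')
    moreover have "x \<in> carrier F" unfolding t(2) by (rule add_carrier_F[OF T_subset[OF t(1)] frag_of_F])
    ultimately show ?thesis
      unfolding pure_def using T_coset_eq_iff[OF left_mult_F frag_of_F] by blast
  qed
  moreover have "frag_of (cls f, 1) \<in> pure f"
    unfolding pure_def by (rule group.rcos_self[OF group_free_Abelian_group frag_of_F T_subgroup])
  ultimately have "cls h \<odot>\<^bsub>M\<^esub> pure f = (\<Union>x\<in>pure f. pure (h * f))" by simp
  with \<open>frag_of (cls f, 1) \<in> pure f\<close> show ?thesis by blast
qed

text \<open>Induction on words: \<open>x l - \<phi>(x) \<phi>(l)\<close> equals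
  \<open>x (l - \<phi>(l)) + \<phi>(l) (x - \<phi>(x))\<close>, a sum of two elements of the left
  ideal.\<close>

lemma whittaker_ideal_character:
  assumes W: "whittaker_ideal \<phi> W" and g: "g \<in> carrier (free_alg n_alg)"
  shows "g - scale (character \<phi> g) 1 \<in> W"
proof -
  from W have ideal: "left_ideal W" by (simp add: whittaker_ideal_def)
  have word: "single (Word l) 1 - scale (prod_list (map \<phi> l)) 1 \<in> W"
    if "set l \<subseteq> carrier n_alg" for l
    using that
  proof (induction l)
    case Nil
    have "(single (Word []) 1 :: word_alg) = 1"
      by (simp flip: zero_free_monoid_def)
    then show ?case using ideal by (simp only: list.map prod_list.Nil scale.scale_one diff_self left_ideal_def)
  next
    case (Cons x l)
    have "gen x - scale (\<phi> x) 1 \<in> W"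
      using Cons.prems W unfolding whittaker_ideal_def by (meson list.set_intros(1) subsetD)
    then have "scale (prod_list (map \<phi> l)) (gen x - scale (\<phi> x) 1) \<in> W"
      by (rule left_ideal_scale[OF ideal])
    moreover have "gen x * (single (Word l) 1 - scale (prod_list (map \<phi> l)) 1) \<in> W"
      using Cons by (intro left_ideal_mult[OF ideal]) simp
    ultimately have "gen x * (single (Word l) 1 - scale (prod_list (map \<phi> l)) 1)
      + scale (prod_list (map \<phi> l)) (gen x - scale (\<phi> x) 1) \<in> W"
      by (intro left_ideal_add[OF ideal])
    then show ?case
      by (simp only: right_diff_distrib gen_mult_single scale_one_mult scale.scale_right_diff_distrib
          scale.scale_scale list.map prod_list.Cons mult.commute[of "\<phi> x"]) simp
  qed
  have "g - scale (character \<phi> g) 1 =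
    (\<Sum>w\<in>keys g. scale (lookup g w) (single w 1 - scale (prod_list (map \<phi> (letters w))) 1))"
  proof -
    have "g = (\<Sum>w\<in>keys g. scale (lookup g w) (single w 1))"
      using linear_extension_id[of g] by (simp only: linear_extension_def)
    moreover have "scale (character \<phi> g) 1 = (\<Sum>w\<in>keys g.
        scale (lookup g w) (scale (prod_list (map \<phi> (letters w))) 1))"
      by (simp only: character_def linear_extension_def scale.scale_sum_left scale.scale_scale)
    ultimately show ?thesis
      unfolding scale.scale_right_diff_distrib sum_subtractf by (rule arg_cong2[of _ _ _ _ "(-)"])
  qed
  also have "\<dots> \<in> W"
  proof (rule left_ideal_sum[OF ideal])
    fix w assume "w \<in> keys g"
    then have "set (letters w) \<subseteq> carrier n_alg" using g by (simp add: carrier_free_alg del: n_alg_simps(1))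
    from word[OF this] show "scale (lookup g w) (single w 1 - scale (prod_list (map \<phi> (letters w))) 1) \<in> W"
      by (intro left_ideal_scale[OF ideal]) simp
  qed
  finally show ?thesis .
qed

text \<open>The universal property of the tensor product, read on kernels: with
  \<open>pure_kernel\<close> it says that the kernel of \<open>pure\<close> is the least Whittaker
  ideal. In place of a map into the quotient by \<open>W\<close>, an additive map
  \<open>\<Theta>\<close> into the free algebra itself is used that sends \<open>T\<close> into
  \<open>W\<close>.\<close>

lemma pure_kernel_minimal:
  assumes W: "whittaker_ideal \<phi> W" and "pure f = pure 0"
  shows "f \<in> W"
proof -
  from W have ideal: "left_ideal W" and I: "env_ideal b_alg \<subseteq> W" by (simp_all add: whittaker_ideal_def)
  interpret int: Modules.module "\<lambda>n (f :: word_alg). of_int n * f"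
    by unfold_locales (simp_all add: algebra_simps)
  \<comment> \<open>Any choice of representatives will do, since two of them differ by an element of
    \<open>env_ideal b_alg\<close>, hence of \<open>W\<close>.\<close>
  define rep :: "word_alg set \<Rightarrow> word_alg"
    where "rep u = (SOME f. f \<in> u)" for u
  define \<Theta> where "\<Theta> = linear_extension (\<lambda>n (f :: word_alg). of_int n * f) (\<lambda>(u, c). scale c (rep u))"
  have \<Theta>: "\<Theta> (x + y) = \<Theta> x + \<Theta> y" "\<Theta> (x - y) = \<Theta> x - \<Theta> y" "\<Theta> 0 = 0" "\<Theta> (frag_of (u, c)) = scale c (rep u)"
    for x y u c
    by (simp_all add: \<Theta>_def int.linear_extension_add int.linear_extension_diff)
  have rep: "rep (cls f) - f \<in> W" for f
    using b_alg.mem_cls_iff[of "rep (cls f)" f] someI[of "\<lambda>g. g \<in> cls f", OF b_alg.cls_self] I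
    unfolding rep_def by auto
  have \<Theta>_T: "\<Theta> x \<in> W" if "x \<in> T" for x
    using that
  proof (induction rule: T_induct)
    case (add_left f f' c)
    have "rep (cls (f + f')) - (f + f') - (rep (cls f) - f) - (rep (cls f') - f') \<in> W"
      by (intro left_ideal_diff[OF ideal] rep)
    then have "scale c (rep (cls (f + f')) - rep (cls f) - rep (cls f')) \<in> W"
      by (intro left_ideal_scale[OF ideal]) (simp add: algebra_simps)
    then show ?case by (simp only: \<Theta> scale.scale_right_diff_distrib)
  next
    case (add_right f c c')
    show ?case using ideal by (simp add: \<Theta> scale.scale_left_distrib left_ideal_def)
  next
    case (middle f g c)
    have "f * (g - scale (character \<phi> g) 1) \<in> W"
      by (intro left_ideal_mult[OF ideal] whittaker_ideal_character[OF W middle])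
    then have 1: "f * g - scale (character \<phi> g) f \<in> W"
      by (simp only: right_diff_distrib scale_one_mult)
    have "scale (character \<phi> g) (rep (cls f) - f) \<in> W"
      by (intro left_ideal_scale[OF ideal] rep)
    from left_ideal_diff[OF ideal left_ideal_add[OF ideal rep[of "f * g"] 1] this]
    have "rep (cls (f * g)) - scale (character \<phi> g) (rep (cls f)) \<in> W"
      by (simp add: scale.scale_right_diff_distrib)
    from left_ideal_scale[OF ideal this, of c]
    show ?case by (simp only: \<Theta> scale.scale_right_diff_distrib scale.scale_scale mult.commute)
  qed (use ideal in \<open>auto simp: \<Theta> left_ideal_def intro: left_ideal_diff[OF ideal]\<close>)
  from assms(2) have "\<Theta> (frag_of (cls f, 1) - frag_of (cls 0, 1)) \<in> W"
    unfolding pure_eq_iff by (rule \<Theta>_T)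
  then have "rep (cls f) - rep (cls 0) \<in> W" by (simp only: \<Theta> scale.scale_one)
  from left_ideal_add[OF ideal left_ideal_diff[OF ideal this rep[of f]] rep[of 0]]
  show ?thesis by simp
qed

lemma pure_kernel: "whittaker_ideal \<phi> {f. pure f = pure 0}"
proof -
  have "left_ideal {f. pure f = pure 0}"
    unfolding left_ideal_def
  proof (intro conjI ballI allI)
    fix u v assume "u \<in> {f. pure f = pure 0}" "v \<in> {f. pure f = pure 0}"
    then show "u + v \<in> {f. pure f = pure 0}"
      using pure_add[of u v] pure_add[of 0 0] by simp
  next
    fix u h assume "u \<in> {f. pure f = pure 0}"
    then show "h * u \<in> {f. pure f = pure 0}"
      using M_smult[of h u] M_smult[of h 0] by simp
  qed simp
  moreover have "env_ideal b_alg \<subseteq> {f. pure f = pure 0}"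
  proof
    fix f assume "f \<in> env_ideal b_alg"
    then have "cls f = cls 0" by (simp add: b_alg.cls_eq_iff)
    then show "f \<in> {f. pure f = pure 0}" by (simp add: pure_def)
  qed
  moreover have "gen x - scale (\<phi> x) 1 \<in> {f. pure f = pure 0}" if "x \<in> carrier n_alg" for x
  proof -
    have "frag_of (cls (1 * gen x), 1) - frag_of (cls 1, character \<phi> (gen x) * 1) \<in> T"
      by (rule T_middle[OF gen_carrier[OF that]])
    from T_add[OF this pure_tensor[of 1 "character \<phi> (gen x) * 1"]]
    have "pure (gen x) = pure (scale (\<phi> x) 1)"
      unfolding pure_eq_iff by (simp del: scale_single)
    then show ?thesis unfolding pure_eq_diff[of "gen x"] by simp
  qed
  ultimately show ?thesis unfolding whittaker_ideal_def by blast
qed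

end

section \<open>The center\<close>

lemma presented_abelian_group:
  fixes p :: "'a::ab_group_add \<Rightarrow> 'b"
  assumes "carrier R = range p" "\<zero>\<^bsub>R\<^esub> = p 0" "\<And>f g. p f \<oplus>\<^bsub>R\<^esub> p g = p (f + g)"
  shows "abelian_group R" "\<ominus>\<^bsub>R\<^esub> p f = p (- f)" "p f \<ominus>\<^bsub>R\<^esub> p g = p (f - g)"
proof -
  show *: "abelian_group R"
  proof (rule abelian_groupI)
    fix x assume "x \<in> carrier R"
    then obtain f where "x = p f" using assms(1) by blast
    then show "\<exists>y\<in>carrier R. y \<oplus>\<^bsub>R\<^esub> x = \<zero>\<^bsub>R\<^esub>"
      using assms by (intro bexI[of _ "p (- f)"]) simp_all
  qed (auto simp: assms add_ac)
  then show neg: "\<ominus>\<^bsub>R\<^esub> p f = p (- f)" for f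
    by (intro abelian_group.minus_equality) (simp_all add: assms)
  show "p f \<ominus>\<^bsub>R\<^esub> p g = p (f - g)"
    by (simp add: a_minus_def neg assms(3))
qed

lemma presented_cring:
  fixes p :: "'a::comm_ring_1 \<Rightarrow> 'b"
  assumes "carrier R = range p" "\<zero>\<^bsub>R\<^esub> = p 0" "\<And>f g. p f \<oplus>\<^bsub>R\<^esub> p g = p (f + g)"
    "\<one>\<^bsub>R\<^esub> = p 1" "\<And>f g. p f \<otimes>\<^bsub>R\<^esub> p g = p (f * g)"
  shows "cring R"
proof (rule cringI)
  show "comm_monoid R" by (rule comm_monoidI) (auto simp: assms mult_ac)
qed (rule presented_abelian_group[OF assms(1-3)], auto simp: assms algebra_simps)

abbreviation zeta :: "word_alg"
  where "zeta \<equiv> gen (bx 1 0)"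

text \<open>Substitution of \<open>zeta\<close> by Horner's scheme. It is a ring homomorphism
  already into the free algebra, since only powers of one element are multiplied; centrality is
  obtained modulo \<open>env_ideal b_alg\<close>.\<close>

definition hz :: "complex poly \<Rightarrow> word_alg"
  where "hz p = fold_coeffs (\<lambda>c r. scale c 1 + zeta * r) p 0"

lemma hz_0 [simp]: "hz 0 = 0"
  by (simp add: hz_def)

lemma hz_pCons: "hz (pCons a p) = scale a 1 + zeta * hz p"
  by (cases "a = 0 \<and> p = 0") (auto simp: hz_def)

lemma hz_add: "hz (p + q) = hz p + hz q"
  by (induction p q rule: poly_induct2) (simp_all add: hz_pCons scale.scale_left_distrib distrib_left del: scale_single)

lemma hz_smult: "hz (smult a p) = scale a (hz p)"
  by (induction p) (simp_all only: smult_pCons hz_pCons smult_0_right hz_0 scale.scale_zero_right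
      scale.scale_right_distrib scale.scale_scale scale_mult_right)

lemma hz_diff: "hz (p - q) = hz p - hz q"
  using hz_add[of "p - q" q] by simp

lemma hz_mult: "hz (p * q) = hz p * hz q"
  by (induction p) (simp_all only: mult_pCons_left hz_add hz_smult hz_pCons distrib_right scale_one_mult
      mult.assoc scale.scale_zero_left add_0 mult_zero_left hz_0)

lemma hz_const: "hz [:a:] = scale a 1"
  by (simp add: hz_pCons del: scale_single)

lemma hz_1 [simp]: "hz 1 = 1"
  unfolding one_pCons hz_const by simp

lemma hz_linear: "hz [:- \<xi>, 1:] = zeta - scale \<xi> 1"
  by (simp add: hz_pCons del: scale_single)

lemma hz_X: "hz [:0, 1:] = zeta"
  by (simp add: hz_pCons)

lemma b_bracket_center: "b_bracket x (bx 1 0) = 0"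
proof (induction x rule: linear_induct)
  case (single k)
  show ?case using b_bracket_bx[of "fst k" "snd k" 1 0] by (simp add: bx_def del: scale_single)
qed (simp_all only: b_bracket_linear scale.scale_zero_right add_0)

lemma gen_zero_env_ideal: "gen (0 :: bvec) \<in> env_ideal b_alg"
  using env_ideal_gen(2)[of 0 0] by (simp only: scale.scale_zero_left diff_zero)

lemma zeta_central: "f * zeta - zeta * f \<in> env_ideal b_alg"
proof (induction f rule: linear_induct)
  case (single w)
  have "single (Word l) 1 * zeta - zeta * single (Word l) 1 \<in> env_ideal b_alg" for l
  proof (induction l)
    case Nil
    have "single (Word []) 1 = (1 :: word_alg)"
      by (simp flip: zero_free_monoid_def)
    then show ?case by (simp only: mult_1_left mult_1_right diff_self b_alg.env_ideal_closed)
  next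
    case (Cons x l)
    from b_alg.env_ideal_closed(2)[OF env_ideal_gen(3)[of x "bx 1 0"] gen_zero_env_ideal]
    have "gen x * zeta - zeta * gen x \<in> env_ideal b_alg" by (simp add: b_bracket_center)
    then have "(gen x * zeta - zeta * gen x) * single (Word l) 1 \<in> env_ideal b_alg"
      by (rule b_alg.env_ideal_closed(5)) simp
    moreover have "gen x * (single (Word l) 1 * zeta - zeta * single (Word l) 1) \<in> env_ideal b_alg"
      using Cons by (rule b_alg.env_ideal_closed(4)) simp
    ultimately have "gen x * (single (Word l) 1 * zeta - zeta * single (Word l) 1)
      + (gen x * zeta - zeta * gen x) * single (Word l) 1 \<in> env_ideal b_alg"
      by (intro b_alg.env_ideal_closed(2))
    then show ?case
      unfolding gen_mult_single[symmetric] right_diff_distrib left_diff_distrib mult.assoc by simp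
  qed
  from this[of "letters w"] show ?case by simp
next
  case (add f g)
  from b_alg.env_ideal_closed(2)[OF add] show ?case by (simp add: algebra_simps)
next
  case (scale a f)
  from b_alg.env_ideal_scale[OF scale, of a] show ?case
    by (simp only: scale_mult_left scale_mult_right scale.scale_right_diff_distrib)
qed

lemma hz_central: "f * hz p - hz p * f \<in> env_ideal b_alg"
proof (induction p)
  case 0
  show ?case by (simp add: b_alg.env_ideal_closed)
next
  case (pCons a p)
  have "zeta * (f * hz p - hz p * f) \<in> env_ideal b_alg"
    using pCons by (intro b_alg.env_ideal_closed(4)) simp_all
  moreover have "(f * zeta - zeta * f) * hz p \<in> env_ideal b_alg"
    by (intro b_alg.env_ideal_closed(5) zeta_central) simp
  ultimately have "(f * zeta - zeta * f) * hz p + zeta * (f * hz p - hz p * f) \<in> env_ideal b_alg"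
    by (intro b_alg.env_ideal_closed(2))
  moreover have "f * hz (pCons a p) - hz (pCons a p) * f = (f * zeta - zeta * f) * hz p + zeta * (f * hz p - hz p * f)"
    unfolding hz_pCons distrib_left distrib_right scale_one_mult
    by (simp add: right_diff_distrib left_diff_distrib mult.assoc)
  ultimately show ?case by simp
qed

section \<open>The algebra \<open>S(Z)\<close> and its maximal ideals\<close>

lemma univ_env_presented:
  "carrier (univ_env b_alg) = range cls" "\<zero>\<^bsub>univ_env b_alg\<^esub> = cls 0" "\<one>\<^bsub>univ_env b_alg\<^esub> = cls 1"
  "cls f \<oplus>\<^bsub>univ_env b_alg\<^esub> cls g = cls (f + g)" "cls f \<otimes>\<^bsub>univ_env b_alg\<^esub> cls g = cls (f * g)"
  "c \<odot>\<^bsub>univ_env b_alg\<^esub> cls f = cls (scale c f)" "cls f = cls g \<longleftrightarrow> f - g \<in> env_ideal b_alg"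
proof -
  have "cls 0 = env_ideal b_alg"
  proof -
    interpret abelian_subgroup "env_ideal b_alg" "free_alg b_alg" by (rule b_alg.env_ideal_abelian_subgroup)
    show ?thesis using a_rcos_const[of 0] b_alg.env_ideal_closed(1) by simp
  qed
  then show "\<zero>\<^bsub>univ_env b_alg\<^esub> = cls 0" by (simp add: b_alg.univ_env_zero_one)
qed (simp_all add: b_alg.univ_env_carrier b_alg.univ_env_zero_one b_alg.univ_env_add b_alg.univ_env_mult
    b_alg.univ_env_smult b_alg.cls_eq_iff)

lemma env_incl_cls: "env_incl b_alg x = cls (gen x)"
  by (simp add: env_incl_def)

lemma cls_scale_gen: "cls (gen (scale c x)) = cls (scale c (gen x))"
  unfolding univ_env_presented by (rule env_ideal_gen)

lemma center_b_conv: "center_b = range (\<lambda>c. scale c (bx 1 0))"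
  by (simp add: center_b_def scale.span_singleton)

abbreviation central :: "complex poly \<Rightarrow> word_alg set"
  where "central p \<equiv> cls (hz p)"

lemma sym_center_carrier: "carrier sym_center = range central"
proof -
  let ?H = "range (\<lambda>c. c \<odot>\<^bsub>univ_env b_alg\<^esub> \<one>\<^bsub>univ_env b_alg\<^esub>) \<union> env_incl b_alg ` center_b"
  have H: "?H = range (\<lambda>c. cls (scale c 1)) \<union> range (\<lambda>c. cls (scale c zeta))"
    by (simp only: univ_env_presented center_b_conv image_image env_incl_cls cls_scale_gen)
  have neg: "\<ominus>\<^bsub>univ_env b_alg\<^esub> cls f = cls (- f)" for f
    by (rule presented_abelian_group(2)[of _ cls]) (simp_all only: univ_env_presented(1,2,4))
  have "generate_ring (univ_env b_alg) ?H = range central"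
  proof (intro equalityI subsetI)
    fix u assume "u \<in> generate_ring (univ_env b_alg) ?H"
    then show "u \<in> range central"
    proof (induction rule: generate_ring.induct)
      case one
      show ?case unfolding univ_env_presented by (intro image_eqI[of _ _ 1]) simp_all
    next
      case (incl h)
      then consider c where "h = cls (scale c 1)" | c where "h = cls (scale c zeta)" unfolding H by blast
      then show ?case
      proof cases
        case 1
        then show ?thesis by (intro image_eqI[of _ _ "[:c:]"]) (simp_all only: hz_const UNIV_I)
      next
        case 2
        have "hz [:0, c:] = scale c zeta"
          by (simp only: hz_pCons[of 0] hz_const scale_mult_right mult_1_right scale.scale_zero_left add_0)
        with 2 show ?thesis by (intro image_eqI[of _ _ "[:0, c:]"]) simp_all
      qed
    next
      case (a_inv h)
      then obtain p where "h = central p" by blast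
      moreover have "hz (- p) = - hz p" using hz_diff[of 0 p] by simp
      ultimately show ?case by (intro image_eqI[of _ _ "- p"]) (simp_all add: neg)
    next
      case (eng_add h1 h2)
      then show ?case by (auto simp: univ_env_presented hz_add[symmetric])
    next
      case (eng_mult h1 h2)
      then show ?case by (auto simp: univ_env_presented hz_mult[symmetric])
    qed
  next
    fix u assume "u \<in> range central"
    then obtain p where u: "u = central p" by blast
    have const: "cls (scale a 1) \<in> generate_ring (univ_env b_alg) ?H" for a
      by (rule generate_ring.incl) (unfold H, blast)
    have zeta: "cls zeta \<in> generate_ring (univ_env b_alg) ?H"
      by (rule generate_ring.incl) (unfold H, metis UnI2 rangeI scale.scale_one)
    have "central p \<in> generate_ring (univ_env b_alg) ?H"
    proof (induction p)
      case 0
      show ?case using const[of 0] by (simp add: scale.scale_zero_left)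
    next
      case (pCons a p)
      from generate_ring.eng_add[OF const[of a] generate_ring.eng_mult[OF zeta pCons(2)]]
      show ?case by (simp only: univ_env_presented hz_pCons)
    qed
    then show "u \<in> generate_ring (univ_env b_alg) ?H" by (simp add: u)
  qed
  then show ?thesis by (simp add: sym_center_def)
qed

lemma sym_center_presented:
  "\<zero>\<^bsub>sym_center\<^esub> = central 0" "\<one>\<^bsub>sym_center\<^esub> = central 1"
  "cls f \<oplus>\<^bsub>sym_center\<^esub> cls g = cls (f + g)" "cls f \<otimes>\<^bsub>sym_center\<^esub> cls g = cls (f * g)"
  by (simp_all add: sym_center_def univ_env_presented)

lemma sym_center_cring: "cring sym_center"
  by (rule presented_cring[of _ central])
    (simp_all only: sym_center_carrier sym_center_presented hz_add hz_mult)

lemma ideal_sym_centerI: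
  assumes P: "left_ideal P"
  shows "ideal (central ` P) sym_center"
proof (rule idealI[OF cring.axioms(1)[OF sym_center_cring]])
  show "subgroup (central ` P) (add_monoid sym_center)"
  proof (rule group.subgroupI[OF abelian_group.a_group[OF ring.is_abelian_group[OF cring.axioms(1)[OF sym_center_cring]]]])
    show "central ` P \<subseteq> carrier (add_monoid sym_center)" by (auto simp: sym_center_carrier)
    show "central ` P \<noteq> {}" using P by (auto simp: left_ideal_def)
  next
    fix a assume "a \<in> central ` P"
    then obtain r where a: "a = central r" "r \<in> P" by blast
    have "inv\<^bsub>add_monoid sym_center\<^esub> a = \<ominus>\<^bsub>sym_center\<^esub> a" by (simp add: a_inv_def)
    also have "\<dots> = central (- r)"
      unfolding a by (rule presented_abelian_group(2)[of _ central])
        (simp_all only: sym_center_carrier sym_center_presented hz_add)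
    finally show "inv\<^bsub>add_monoid sym_center\<^esub> a \<in> central ` P"
      using left_ideal_mult[OF P a(2), of "- 1"] by simp
  next
    fix a b assume "a \<in> central ` P" "b \<in> central ` P"
    then obtain r r' where r: "a = central r" "r \<in> P" "b = central r'" "r' \<in> P" by blast
    then have "a \<oplus>\<^bsub>sym_center\<^esub> b = central (r + r')"
      by (simp add: sym_center_presented hz_add)
    then show "a \<otimes>\<^bsub>add_monoid sym_center\<^esub> b \<in> central ` P"
      using left_ideal_add[OF P r(2,4)] by simp
  qed
next
  fix a x assume "a \<in> central ` P" "x \<in> carrier sym_center"
  then obtain r t where r: "a = central r" "r \<in> P" "x = central t"
    by (auto simp: sym_center_carrier)
  then have "x \<otimes>\<^bsub>sym_center\<^esub> a = central (t * r)" "a \<otimes>\<^bsub>sym_center\<^esub> x = central (t * r)"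
    by (simp_all add: sym_center_presented hz_mult[symmetric] mult.commute)
  then show "x \<otimes>\<^bsub>sym_center\<^esub> a \<in> central ` P" "a \<otimes>\<^bsub>sym_center\<^esub> x \<in> central ` P"
    using left_ideal_mult[OF P r(2)] by simp_all
qed

text \<open>Induction on the degree of \<open>r\<close>: the fundamental theorem of algebra splits
  off a factor \<open>X - \<xi>\<close>; either the cofactor lies in \<open>P\<close> and has
  smaller degree, or \<open>prime\<close> applies. This form of primeness can be supplied both for a
  maximal ideal and for the annihilator of a generator of a simple module.\<close>

lemma linear_poly_in_ideal:
  assumes P: "left_ideal P" "1 \<notin> P" and r: "r \<in> P" "r \<noteq> 0"
    and prime: "\<And>s \<xi>. s \<notin> P \<Longrightarrow> [:- \<xi>, 1:] * s \<in> P \<Longrightarrow> [:- \<xi>, 1:] \<in> P"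
  shows "\<exists>\<xi>. [:- \<xi>, 1:] \<in> (P :: complex poly set)"
  using r
proof (induction "degree r" arbitrary: r rule: less_induct)
  case less
  have "degree r \<noteq> 0"
  proof
    assume "degree r = 0"
    then obtain a where "r = [:a:]" using degree_eq_zeroE by blast
    with less.prems have "1 = [:inverse a:] * r" by (auto simp: one_pCons)
    with left_ideal_mult[OF P(1) less.prems(1)] P(2) show False by metis
  qed
  then obtain \<xi> where "poly r \<xi> = 0"
    using fundamental_theorem_of_algebra[of r] by (auto simp: constant_degree)
  then obtain s where s: "r = [:- \<xi>, 1:] * s" by (auto simp: poly_eq_0_iff_dvd)
  with less.prems have "s \<noteq> 0" by auto
  then have deg: "degree s < degree r" unfolding s by (subst degree_mult_eq) auto
  show ?case
  proof (cases "s \<in> P")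
    case True
    then show ?thesis using less.hyps[OF deg] \<open>s \<noteq> 0\<close> by blast
  next
    case False
    with prime[of s \<xi>] less.prems(1) show ?thesis unfolding s by blast
  qed
qed

lemma poly_split: "\<exists>s. p = s * [:- \<xi>, 1:] + [:poly p \<xi>:]" for p :: "complex poly"
proof -
  have "[:- \<xi>, 1:] dvd p - [:poly p \<xi>:]" by (simp add: poly_eq_0_iff_dvd[symmetric])
  then obtain s where "p - [:poly p \<xi>:] = [:- \<xi>, 1:] * s" by (elim dvdE)
  then show ?thesis by (intro exI[of _ s]) (simp add: algebra_simps)
qed

text \<open>The preimage \<open>P\<close> of \<open>\<mm>\<close> in \<open>\<complex>[X]\<close>
  contains a linear polynomial, and division with remainder by it identifies \<open>P\<close> with
  the kernel of evaluation at its root.\<close>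

lemma maximalideal_sym_center:
  assumes "maximalideal \<mm> sym_center"
  obtains \<xi> where "\<And>p. central p \<in> \<mm> \<longleftrightarrow> poly p \<xi> = 0"
proof -
  interpret maximalideal \<mm> sym_center by fact
  define P where "P = {p. central p \<in> \<mm>}"
  have P: "left_ideal P"
    unfolding left_ideal_def P_def
  proof (intro conjI ballI allI CollectI)
    show "central 0 \<in> \<mm>" using additive_subgroup.zero_closed[OF is_additive_subgroup] by (simp only: sym_center_presented)
  next
    fix u v assume "u \<in> {p. central p \<in> \<mm>}" "v \<in> {p. central p \<in> \<mm>}"
    then show "central (u + v) \<in> \<mm>"
      using additive_subgroup.a_closed[OF is_additive_subgroup, of "central u" "central v"] by (simp add: sym_center_presented hz_add)
  next
    fix u q assume "u \<in> {p. central p \<in> \<mm>}"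
    then show "central (q * u) \<in> \<mm>"
      using I_l_closed[of "central u" "central q"] by (simp add: sym_center_presented hz_mult sym_center_carrier)
  qed
  have "1 \<notin> P"
  proof
    assume "1 \<in> P"
    then have "\<one>\<^bsub>sym_center\<^esub> \<in> \<mm>" by (simp only: P_def sym_center_presented mem_Collect_eq)
    then show False using one_imp_carrier I_notcarr by blast
  qed
  \<comment> \<open>By maximality the ideal generated by \<open>P\<close> and \<open>s\<close> is
    everything, so \<open>s\<close> is invertible modulo \<open>P\<close>.\<close>
  have inv: "\<exists>q. 1 - q * s \<in> P" if "s \<notin> P" for s
  proof -
    define P' where "P' = {r + q * s | r q. r \<in> P}"
    define J where "J = central ` P'"
    have "left_ideal P'"
      unfolding left_ideal_def
    proof (intro conjI ballI allI)
      show "0 \<in> P'" using P unfolding P'_def by (intro CollectI exI[of _ 0]) (simp add: left_ideal_def)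
    next
      fix u v assume "u \<in> P'" "v \<in> P'"
      then obtain r q r' q' where "u = r + q * s" "r \<in> P" "v = r' + q' * s" "r' \<in> P" unfolding P'_def by blast
      moreover from this have "u + v = (r + r') + (q + q') * s" by (simp add: algebra_simps)
      ultimately show "u + v \<in> P'" using left_ideal_add[OF P] unfolding P'_def by blast
    next
      fix u f assume "u \<in> P'"
      then obtain r q where "u = r + q * s" "r \<in> P" unfolding P'_def by blast
      moreover from this have "f * u = f * r + (f * q) * s" by (simp add: algebra_simps)
      ultimately show "f * u \<in> P'" using left_ideal_mult[OF P] unfolding P'_def by blast
    qed
    then have "ideal J sym_center" unfolding J_def by (rule ideal_sym_centerI)
    moreover have "\<mm> \<subseteq> J"
    proof
      fix a assume a: "a \<in> \<mm>"
      then obtain p where "a = central p" using a_Hcarr by (auto simp: sym_center_carrier)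
      moreover have "p \<in> P'"
        using a \<open>a = _\<close> unfolding P'_def P_def by (intro CollectI exI[of _ p] exI[of _ 0]) simp
      ultimately show "a \<in> J" unfolding J_def by blast
    qed
    moreover have "s \<in> P'"
      unfolding P'_def using P by (intro CollectI exI[of _ 0] exI[of _ 1]) (simp add: left_ideal_def)
    then have "central s \<in> J" unfolding J_def by blast
    moreover have "J \<subseteq> carrier sym_center" by (auto simp: J_def sym_center_carrier)
    moreover have "central s \<notin> \<mm>" using that by (simp add: P_def)
    ultimately have carrier: "J = carrier sym_center"
      using I_maximal[of J] by blast
    have "central 1 \<in> J" unfolding carrier sym_center_carrier by blast
    then obtain r q where r: "central 1 = central (r + q * s)" "r \<in> P"
      unfolding J_def P'_def by blast
    have "central (1 - q * s) = central r"
      using r(1) unfolding univ_env_presented by (simp add: hz_diff hz_add algebra_simps)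
    then have "1 - q * s \<in> P" using r(2) by (simp add: P_def)
    then show ?thesis by blast
  qed
  \<comment> \<open>Tested on \<open>X\<close>: either it lies in \<open>P\<close>, or some
    \<open>1 - q X\<close> does, which is nonzero because its value at 0 is 1.\<close>
  have "\<exists>r\<in>P. r \<noteq> 0"
  proof (cases "[:0, 1:] \<in> P")
    case False
    then obtain q where q: "1 - q * [:0, 1:] \<in> P" using inv by blast
    have "1 - q * [:0, 1:] \<noteq> 0"
    proof
      assume "1 - q * [:0, 1:] = 0"
      then have "poly (1 - q * [:0, 1:]) 0 = 0" by (simp only: Polynomial.poly_0)
      then show False by simp
    qed
    with q show ?thesis by blast
  next
    case True
    moreover have "[:0, 1:] \<noteq> (0 :: complex poly)" by simp
    ultimately show ?thesis by blast
  qed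
  moreover have "[:- \<xi>, 1:] \<in> P" if s: "s \<notin> P" "[:- \<xi>, 1:] * s \<in> P" for s \<xi>
  proof -
    from inv[OF s(1)] obtain q where q: "1 - q * s \<in> P" by blast
    have "t * (1 - q * s) + q * (t * s) = t" for t :: "complex poly" by (simp add: algebra_simps)
    with left_ideal_add[OF P left_ideal_mult[OF P q] left_ideal_mult[OF P s(2)]] show ?thesis by metis
  qed
  ultimately obtain \<xi> where \<xi>: "[:- \<xi>, 1:] \<in> P"
    using linear_poly_in_ideal[OF P \<open>1 \<notin> P\<close>] by blast
  have "p \<in> P \<longleftrightarrow> poly p \<xi> = 0" for p
  proof -
    obtain s where s: "p = s * [:- \<xi>, 1:] + [:poly p \<xi>:]" using poly_split by blast
    have *: "s * [:- \<xi>, 1:] \<in> P" by (rule left_ideal_mult[OF P \<xi>])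
    show ?thesis
    proof
      assume "p \<in> P"
      from left_ideal_diff[OF P this *] s have c: "[:poly p \<xi>:] \<in> P" by (metis add_diff_cancel_left')
      show "poly p \<xi> = 0"
      proof (rule ccontr)
        assume "poly p \<xi> \<noteq> 0"
        then have "1 = [:inverse (poly p \<xi>):] * [:poly p \<xi>:]" by (simp add: one_pCons)
        with left_ideal_mult[OF P c] \<open>1 \<notin> P\<close> show False by metis
      qed
    next
      assume "poly p \<xi> = 0"
      with s * show "p \<in> P" by simp
    qed
  qed
  then show thesis by (intro that) (simp add: P_def)
qed

section \<open>The quotient of the induced module by \<open>\<mm> M\<close>\<close>

context whittaker_character
begin

lemma M_abelian_group: "abelian_group M"
  by (rule presented_abelian_group(1)[of _ pure]) (simp_all only: pure_range pure_zero pure_add)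

lemma M_uminus: "\<ominus>\<^bsub>M\<^esub> pure f = pure (- f)"
  by (rule presented_abelian_group(2)[of _ pure]) (simp_all only: pure_range pure_zero pure_add)

context
  fixes \<mm> :: "word_alg set set"
  assumes \<mm>: "\<mm> \<subseteq> carrier sym_center"
begin

abbreviation N where "N \<equiv> ideal_times_module \<mm> M"

lemma N_generators: "{z \<odot>\<^bsub>M\<^esub> v | z v. z \<in> \<mm> \<and> v \<in> carrier M} = {pure (p * f) | p f. cls p \<in> \<mm>}"
proof -
  have "\<exists>p. z = cls p" if "z \<in> \<mm>" for z using that \<mm> by (auto simp: sym_center_carrier)
  then have "{z \<odot>\<^bsub>M\<^esub> v | z v. z \<in> \<mm> \<and> v \<in> carrier M} = {cls p \<odot>\<^bsub>M\<^esub> pure f | p f. cls p \<in> \<mm>}"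
    unfolding pure_range by blast
  then show ?thesis by (simp only: M_smult)
qed

lemma N_subgroup: "subgroup N (add_monoid M)"
  unfolding ideal_times_module_def N_generators
  by (rule group.generate_is_subgroup[OF abelian_group.a_group[OF M_abelian_group]]) (auto simp: pure_range)

lemma N_abelian_subgroup: "abelian_subgroup N M"
  by (rule abelian_subgroupI3[OF additive_subgroup.intro[OF N_subgroup] M_abelian_group])

lemma N_induct [consumes 1, case_names generator zero diff]:
  assumes "v \<in> N"
    and gen: "\<And>p f. cls p \<in> \<mm> \<Longrightarrow> Q (p * f)"
    and zero: "Q 0"
    and diff: "\<And>f g. Q f \<Longrightarrow> Q g \<Longrightarrow> Q (f - g)"
  shows "\<exists>f. v = pure f \<and> Q f"
  using assms(1) unfolding ideal_times_module_def N_generators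
proof (induction rule: generate.induct)
  case one
  show ?case using zero pure_zero by (intro exI[of _ 0]) simp
next
  case (incl h)
  then show ?case using gen by blast
next
  case (inv h)
  then obtain p f where h: "h = pure (p * f)" "cls p \<in> \<mm>" by blast
  have "inv\<^bsub>add_monoid M\<^esub> h = pure (0 - p * f)"
    using M_uminus[of "p * f"] by (simp add: h a_inv_def)
  then show ?case using diff[OF zero gen[OF h(2)]] by blast
next
  case (eng h1 h2)
  then obtain f g where fg: "h1 = pure f" "Q f" "h2 = pure g" "Q g" by blast
  have "h1 \<otimes>\<^bsub>add_monoid M\<^esub> h2 = pure (f - (0 - g))" by (simp add: fg pure_add)
  then show ?case using diff[OF fg(2) diff[OF zero fg(4)]] by blast
qed

lemma N_zero: "pure 0 \<in> N"
  using subgroup.one_closed[OF N_subgroup] by (simp add: pure_zero)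

lemma N_add: "pure f \<in> N \<Longrightarrow> pure g \<in> N \<Longrightarrow> pure (f + g) \<in> N"
  using subgroup.m_closed[OF N_subgroup, of "pure f" "pure g"] by (simp add: pure_add)

lemma N_uminus: "pure f \<in> N \<Longrightarrow> pure (- f) \<in> N"
  using subgroup.m_inv_closed[OF N_subgroup, of "pure f"] M_uminus[of f] by (simp add: a_inv_def)

lemma N_generator: "cls p \<in> \<mm> \<Longrightarrow> pure (p * f) \<in> N"
  unfolding ideal_times_module_def N_generators by (rule generate.incl) blast

lemma cls_eq_pure_mult: "cls p = cls q \<Longrightarrow> pure (p * f) = pure (q * f)"
  using M_smult[of p f] M_smult[of q f] by simp

text \<open>Elements of \<open>\<mm>\<close> are represented by polynomials in the central element,
  so \<open>h\<close> can be moved past them modulo the relations.\<close>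

lemma N_mult:
  assumes "pure f \<in> N"
  shows "pure (h * f) \<in> N"
proof -
  have "\<exists>g. pure f = pure g \<and> pure (h * g) \<in> N"
    using assms
  proof (induction rule: N_induct)
    case (generator p f)
    then obtain q where q: "cls p = central q" using \<mm> by (auto simp: sym_center_carrier)
    have "cls (h * hz q) = cls (hz q * h)" using hz_central[of h q] by (simp add: univ_env_presented(7))
    then have "pure (h * hz q * f) = pure (hz q * (h * f))"
      unfolding mult.assoc[symmetric, of "hz q"] by (rule cls_eq_pure_mult)
    moreover have "pure (h * (p * f)) = pure (h * hz q * f)"
      using cls_eq_pure_mult[OF q, of f] M_smult[of h "p * f"] M_smult[of h "hz q * f"] by (simp add: mult.assoc)
    ultimately show ?case using N_generator[of "hz q" "h * f"] generator q by simp
  next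
    case (diff f g)
    then show ?case using N_add[of "h * f" "- (h * g)"] N_uminus[of "h * g"] by (simp add: right_diff_distrib)
  qed (simp add: N_zero)
  then obtain g where "pure f = pure g" "pure (h * g) \<in> N" by blast
  then show ?thesis using M_smult[of h f] M_smult[of h g] by simp
qed

definition proj :: "word_alg \<Rightarrow> whittaker_vec set"
  where "proj f = N +>\<^bsub>M\<^esub> pure f"

lemma pure_M: "pure f \<in> carrier M"
  by (simp add: pure_range)

lemma proj_eq_zero: "proj f = proj 0 \<longleftrightarrow> pure f \<in> N"
proof -
  have "pure f \<ominus>\<^bsub>M\<^esub> pure 0 = pure f"
    using M_uminus[of 0] by (simp add: a_minus_def pure_add)
  then show ?thesis
    unfolding proj_def using coset_eq_iff[OF N_abelian_subgroup pure_M[of f] pure_M[of 0]] by simp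
qed

lemma quot_smult: "cls h \<odot>\<^bsub>quot_module M N\<^esub> proj f = proj (h * f)"
proof -
  have "cls h \<odot>\<^bsub>M\<^esub> v \<in> N" if "v \<in> N" for v
  proof -
    from that obtain f where "v = pure f" using subgroup.subset[OF N_subgroup] by (auto simp: pure_range)
    then show ?thesis using N_mult that by (simp add: M_smult)
  qed
  then show ?thesis
    unfolding proj_def
    by (subst quot_module_smult[OF N_abelian_subgroup pure_M])
      (auto simp: pure_range M_smult pure_add distrib_left)
qed

lemma proj_presents: "presents proj (whittaker_quotient \<phi> \<mm>)"
proof -
  have "proj 0 = N"
    using N_zero abelian_subgroup.a_rcos_const[OF N_abelian_subgroup] by (simp add: proj_def)
  moreover have "carrier (quot_module M N) = range proj"
    by (simp add: quot_module_carrier pure_range proj_def image_image)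
  moreover have "proj f \<oplus>\<^bsub>quot_module M N\<^esub> proj g = proj (f + g)" for f g
    unfolding proj_def using quot_module_add[OF N_abelian_subgroup pure_M pure_M] by (simp add: pure_add)
  ultimately show ?thesis
    unfolding presents_def
    by (simp add: whittaker_quotient_def Let_def restrict_to_lie_def quot_smult univ_env_presented
        env_incl_cls scale_one_mult quot_module_zero del: scale_single)
qed

lemma proj_kernel: "whittaker_ideal \<phi> {f. proj f = proj 0}"
proof -
  have "left_ideal {f. proj f = proj 0}"
    by (auto simp: left_ideal_def proj_eq_zero N_zero N_add N_mult)
  moreover have "proj f = proj 0" if "pure f = pure 0" for f using that by (simp add: proj_def)
  ultimately show ?thesis using pure_kernel unfolding whittaker_ideal_def by blast
qed

lemma proj_generator: "cls p \<in> \<mm> \<Longrightarrow> proj (p * f) = proj 0"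
  by (simp add: proj_eq_zero N_generator)

text \<open>Every element of \<open>\<mm> M\<close> has a representative in \<open>W\<close>, by
  induction on its generation; any other representative differs from it by an element of the kernel
  of \<open>pure\<close>, which lies in \<open>W\<close> as well.\<close>

lemma proj_kernel_minimal:
  assumes W: "whittaker_ideal \<phi> W" and p: "\<And>p f. cls p \<in> \<mm> \<Longrightarrow> p * f \<in> W" and "proj f = proj 0"
  shows "f \<in> W"
proof -
  have ideal: "left_ideal W" using W by (simp add: whittaker_ideal_def)
  from assms(3) have "pure f \<in> N" by (simp add: proj_eq_zero)
  then have "\<exists>g. pure f = pure g \<and> g \<in> W"
    by (induction rule: N_induct) (use p ideal left_ideal_diff[OF ideal] in \<open>auto simp: left_ideal_def\<close>)
  then obtain g where g: "pure f = pure g" "g \<in> W" by blast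
  then have "pure (f - g) = pure 0" by (simp flip: pure_eq_diff)
  then have "f - g \<in> W" by (rule pure_kernel_minimal[OF W])
  from left_ideal_add[OF ideal this g(2)] show ?thesis by simp
qed

end

end

section \<open>Presented modules, their submodules and left ideals\<close>

lemma left_idealI:
  assumes "0 \<in> W" "\<And>u v. u \<in> W \<Longrightarrow> v \<in> W \<Longrightarrow> u + v \<in> W" "\<And>c u. u \<in> W \<Longrightarrow> scale c u \<in> W"
    "\<And>x u. u \<in> W \<Longrightarrow> gen x * u \<in> W"
  shows "left_ideal (W :: ('g free_monoid \<Rightarrow>\<^sub>0 complex) set)"
proof -
  have "f * u \<in> W" if "u \<in> W" for f u
  proof (induction f rule: linear_induct)
    case (single w)
    have "single (Word l) 1 * u \<in> W" for l
    proof (induction l)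
      case Nil
      have "single (Word []) 1 = (1 :: 'g free_monoid \<Rightarrow>\<^sub>0 complex)"
        by (simp flip: zero_free_monoid_def)
      then show ?case using that by (simp only: mult_1_left)
    next
      case (Cons x l)
      then show ?case unfolding gen_mult_single[symmetric] mult.assoc by (rule assms(4))
    qed
    from this[of "letters w"] show ?case by simp
  qed (simp_all only: assms(2,3) distrib_right scale_mult_left)
  with assms show ?thesis by (auto simp: left_ideal_def)
qed

context
  fixes \<pi> :: "word_alg \<Rightarrow> 'v" and V :: "(bvec, 'v, 'y) lie_mod_scheme"
  assumes presents: "presents \<pi> V"
begin

lemma presents_simps: "carrier V = range \<pi>" "\<zero>\<^bsub>V\<^esub> = \<pi> 0" "\<pi> f \<oplus>\<^bsub>V\<^esub> \<pi> g = \<pi> (f + g)"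
  "c \<odot>\<^bsub>V\<^esub> \<pi> f = \<pi> (scale c f)" "act V x (\<pi> f) = \<pi> (gen x * f)"
  using presents by (simp_all add: presents_def)

lemma presents_abelian: "abelian_group V" "\<ominus>\<^bsub>V\<^esub> \<pi> f = \<pi> (- f)" "\<pi> f \<ominus>\<^bsub>V\<^esub> \<pi> g = \<pi> (f - g)"
  by (rule presented_abelian_group[OF presents_simps(1-3)])+

lemma presents_eq: "\<pi> f = \<pi> g \<longleftrightarrow> \<pi> (f - g) = \<pi> 0"
proof
  assume "\<pi> f = \<pi> g"
  then show "\<pi> (f - g) = \<pi> 0"
    using presents_simps(3)[of f "- g"] presents_simps(3)[of g "- g"] by simp
next
  assume "\<pi> (f - g) = \<pi> 0"
  then show "\<pi> f = \<pi> g"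
    using presents_simps(3)[of "f - g" g] presents_simps(3)[of 0 g] by simp
qed

lemma presents_lie_module:
  assumes I: "\<And>f. f \<in> env_ideal b_alg \<Longrightarrow> \<pi> f = \<pi> 0"
  shows "lie_module b_alg V"
proof -
  have rel: "\<pi> (r * f) = \<pi> 0" if "r \<in> env_ideal b_alg" for r f
    using that by (intro I b_alg.env_ideal_closed(5)) auto
  have 1: "\<pi> (gen (x + x') * f) = \<pi> (gen x * f + gen x' * f)" for x x' f
    using rel[OF env_ideal_gen(1)[of x x'], of f]
    by (subst presents_eq) (simp only: left_diff_distrib distrib_right)
  have 2: "\<pi> (gen (scale c x) * f) = \<pi> (scale c (gen x * f))" for c x f
    using rel[OF env_ideal_gen(2)[of c x], of f]
    by (subst presents_eq) (simp only: left_diff_distrib scale_mult_left)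
  have 3: "\<pi> (gen (b_bracket x x') * f) = \<pi> (gen x * (gen x' * f) - gen x' * (gen x * f))" for x x' f
    using rel[OF env_ideal_gen(3)[of x x'], of f]
    by (subst eq_commute, subst presents_eq) (simp only: left_diff_distrib mult.assoc)
  have "Module.module complex_field V"
  proof (rule moduleI)
    show "cring complex_field" by (rule cring_from_type_algebra)
  qed (auto simp: presents_abelian(1) presents_simps ring_of_type_algebra_def
      scale.scale_left_distrib scale.scale_right_distrib)
  then show ?thesis
    by (intro lie_module.intro lie_module_axioms.intro)
      (auto simp: presents_simps presents_abelian(3) 1 2 3 distrib_left scale_mult_right)
qed

lemma submodule_left_ideal:
  assumes "lie_module b_alg V" "lie_submodule b_alg V W"
  shows "left_ideal {f. \<pi> f \<in> W}" "W = \<pi> ` {f. \<pi> f \<in> W}"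
proof -
  interpret lie_module b_alg V by fact
  have W: "submodule W complex_field V" and act: "\<And>x w. w \<in> W \<Longrightarrow> act V x w \<in> W"
    using assms(2) by (auto simp: lie_submodule_def)
  note sub = submoduleE[OF W]
  show "left_ideal {f. \<pi> f \<in> W}"
  proof (rule left_idealI)
    show "0 \<in> {f. \<pi> f \<in> W}"
      using subgroup.one_closed[OF submodule.axioms(1)[OF W]] by (simp add: presents_simps)
  next
    fix u v assume "u \<in> {f. \<pi> f \<in> W}" "v \<in> {f. \<pi> f \<in> W}"
    then show "u + v \<in> {f. \<pi> f \<in> W}" using sub(5)[of "\<pi> u" "\<pi> v"] by (simp add: presents_simps)
  next
    fix c u assume "u \<in> {f. \<pi> f \<in> W}"
    then show "scale c u \<in> {f. \<pi> f \<in> W}"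
      using sub(4)[of c "\<pi> u"] by (simp add: presents_simps ring_of_type_algebra_def)
  next
    fix x u assume "u \<in> {f. \<pi> f \<in> W}"
    then show "gen x * u \<in> {f. \<pi> f \<in> W}" using act[of "\<pi> u" x] by (simp add: presents_simps)
  qed
  show "W = \<pi> ` {f. \<pi> f \<in> W}" using sub(1) by (auto simp: presents_simps)
qed

lemma left_ideal_submodule:
  assumes "lie_module b_alg V" "left_ideal W"
  shows "lie_submodule b_alg V (\<pi> ` W)"
proof -
  interpret lie_module b_alg V by fact
  have "submodule (\<pi> ` W) complex_field V"
  proof (rule submoduleI)
    show "\<zero>\<^bsub>V\<^esub> \<in> \<pi> ` W" using assms(2) by (auto simp: presents_simps left_ideal_def)
  next
    fix v assume "v \<in> \<pi> ` W"
    then show "\<ominus>\<^bsub>V\<^esub> v \<in> \<pi> ` W"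
      using left_ideal_mult[OF assms(2), of _ "- 1"] by (auto simp: presents_abelian)
  qed (use left_ideal_add[OF assms(2)] left_ideal_scale[OF assms(2)] in \<open>auto simp: presents_simps\<close>)
  then show ?thesis
    using left_ideal_mult[OF assms(2)] by (auto simp: lie_submodule_def presents_simps)
qed

text \<open>Submodules correspond to left ideals containing the kernel, and such an ideal is
  everything as soon as it contains 1. Simplicity thus becomes maximality of the kernel.\<close>

lemma presents_simple_iff:
  assumes I: "env_ideal b_alg \<subseteq> {f. \<pi> f = \<pi> 0}"
  shows "simple_lie_module b_alg V \<longleftrightarrow> \<pi> 1 \<noteq> \<pi> 0 \<and>
    (\<forall>W. left_ideal W \<longrightarrow> {f. \<pi> f = \<pi> 0} \<subseteq> W \<longrightarrow> W = {f. \<pi> f = \<pi> 0} \<or> 1 \<in> W)"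
proof -
  have lie: "lie_module b_alg V" using I by (intro presents_lie_module) auto
  have trivial: "\<pi> f = \<pi> 0" if "\<pi> 1 = \<pi> 0" for f
  proof -
    have "left_ideal {f. \<pi> f \<in> {\<zero>\<^bsub>V\<^esub>}}"
    proof (rule submodule_left_ideal[OF lie])
      have "left_ideal {0 :: word_alg}" by (simp add: left_ideal_def)
      from left_ideal_submodule[OF lie this] show "lie_submodule b_alg V {\<zero>\<^bsub>V\<^esub>}" by (simp add: presents_simps)
    qed
    from left_ideal_mult[OF this, of 1 f] that show ?thesis by (simp add: presents_simps)
  qed
  show ?thesis
  proof (intro iffI conjI allI impI)
    assume simple: "simple_lie_module b_alg V"
    show "\<pi> 1 \<noteq> \<pi> 0"
    proof
      assume "\<pi> 1 = \<pi> 0"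
      then have "range \<pi> = {\<pi> 0}" using trivial by blast
      then have "carrier V = {\<zero>\<^bsub>V\<^esub>}" by (simp only: presents_simps)
      with simple show False by (simp add: simple_lie_module_def)
    qed
    fix W assume W: "left_ideal W" "{f. \<pi> f = \<pi> 0} \<subseteq> W"
    with simple left_ideal_submodule[OF lie W(1)] consider "\<pi> ` W = {\<pi> 0}" | "\<pi> ` W = range \<pi>"
      by (auto simp: simple_lie_module_def presents_simps)
    then show "W = {f. \<pi> f = \<pi> 0} \<or> 1 \<in> W"
    proof cases
      case 1
      then show ?thesis using W by blast
    next
      case 2
      then obtain w where "w \<in> W" "\<pi> 1 = \<pi> w" by (metis imageE rangeI)
      then have "1 - w \<in> W" using W(2) presents_eq[of 1 w] by blast
      from left_ideal_add[OF W(1) this \<open>w \<in> W\<close>] show ?thesis by simp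
    qed
  next
    assume *: "\<pi> 1 \<noteq> \<pi> 0 \<and> (\<forall>W. left_ideal W \<longrightarrow> {f. \<pi> f = \<pi> 0} \<subseteq> W \<longrightarrow> W = {f. \<pi> f = \<pi> 0} \<or> 1 \<in> W)"
    have "W = {\<zero>\<^bsub>V\<^esub>} \<or> W = carrier V" if W: "lie_submodule b_alg V W" for W
    proof -
      note W' = submodule_left_ideal[OF lie W]
      have "\<pi> 0 \<in> W" using W'(1) by (simp add: left_ideal_def)
      then have "{f. \<pi> f = \<pi> 0} \<subseteq> {f. \<pi> f \<in> W}" by auto
      with * W'(1) consider "{f. \<pi> f \<in> W} = {f. \<pi> f = \<pi> 0}" | "1 \<in> {f. \<pi> f \<in> W}" by blast
      then show ?thesis
      proof cases
        case 1
        then have "W = \<pi> ` {f. \<pi> f = \<pi> 0}" using W'(2) by simp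
        then show ?thesis by (auto simp: presents_simps)
      next
        case 2
        then have "{f. \<pi> f \<in> W} = UNIV" using left_ideal_mult[OF W'(1), of 1] by auto
        then show ?thesis using W'(2) by (simp add: presents_simps)
      qed
    qed
    moreover have "carrier V \<noteq> {\<zero>\<^bsub>V\<^esub>}" using * by (auto simp: presents_simps)
    ultimately show "simple_lie_module b_alg V" using lie by (simp add: simple_lie_module_def)
  qed
qed

end

lemma presents_isomorphic:
  assumes V: "presents \<pi> V" and V': "presents \<pi>' V'" and ker: "\<And>f. \<pi> f = \<pi> 0 \<longleftrightarrow> \<pi>' f = \<pi>' 0"
  shows "lie_module_isomorphic b_alg V V'"
proof -
  define F where "F v = \<pi>' (SOME f. \<pi> f = v)" for v
  have eq: "\<pi> f = \<pi> g \<longleftrightarrow> \<pi>' f = \<pi>' g" for f g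
    using presents_eq[OF V, of f g] presents_eq[OF V', of f g] ker by simp
  have F: "F (\<pi> f) = \<pi>' f" for f
    unfolding F_def using someI[of "\<lambda>g. \<pi> g = \<pi> f" f] eq by blast
  have "bij_betw F (carrier V) (carrier V')"
    unfolding bij_betw_def inj_on_def presents_simps[OF V] presents_simps[OF V']
    by (auto simp: F eq image_image)
  then show ?thesis
    unfolding lie_module_isomorphic_def
    by (intro exI[of _ F]) (auto simp: presents_simps[OF V] presents_simps[OF V'] F)
qed

section \<open>Simplicity and the eigenvalue of the center\<close>

text \<open>The elements \<open>f v\<close> form a submodule containing \<open>v\<close>, hence
  exhaust the module. The relations of the enveloping algebra act as 0 because they are the module
  axioms.\<close>

lemma free_act_presents:
  assumes V: "lie_module b_alg V" and v: "v \<in> carrier V"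
    and gen: "\<Inter>{W. lie_submodule b_alg V W \<and> v \<in> W} = carrier V"
  shows "presents (\<lambda>f. free_act V f v) V" "free_act V 1 v = v"
    "f \<in> env_ideal b_alg \<Longrightarrow> free_act V f v = \<zero>\<^bsub>V\<^esub>"
proof -
  interpret lie_module b_alg V by fact
  have cf [simp]: "carrier complex_field = UNIV" "a \<oplus>\<^bsub>complex_field\<^esub> b = a + b" "a \<otimes>\<^bsub>complex_field\<^esub> b = a * b"
    "\<one>\<^bsub>complex_field\<^esub> = 1" "\<zero>\<^bsub>complex_field\<^esub> = 0" for a b
    by (simp_all add: ring_of_type_algebra_def)
  let ?R = "range (\<lambda>f. free_act V f v)" and ?Z = "{f. \<forall>u\<in>carrier V. free_act V f u = \<zero>\<^bsub>V\<^esub>}"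
  have zero_smult [simp]: "0 \<odot>\<^bsub>V\<^esub> u = \<zero>\<^bsub>V\<^esub>" if "u \<in> carrier V" for u
    using smult_l_null[OF that] by simp
  let ?w = "\<lambda>w u. foldr (act V) (letters w) u"
  have word_closed [simp]: "foldr (act V) l u \<in> carrier V" if "u \<in> carrier V" for l u
    using that by (induction l) (simp_all add: act_closed)
  have superset: "free_act V f u = (\<Oplus>\<^bsub>V\<^esub>w\<in>A. lookup f w \<odot>\<^bsub>V\<^esub> ?w w u)"
    if "finite A" "keys f \<subseteq> A" "u \<in> carrier V" for A f u
    unfolding free_act_def finsum_def
    by (rule comm_monoid.finprod_mono_neutral_cong_left[OF M.a_comm_monoid]) (use that in \<open>auto simp: in_keys_iff\<close>)
  have closed [simp]: "free_act V f u \<in> carrier V" if "u \<in> carrier V" for f u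
    unfolding free_act_def by (rule M.finsum_closed) (use that in auto)
  have add: "free_act V (f + g) u = free_act V f u \<oplus>\<^bsub>V\<^esub> free_act V g u" if u: "u \<in> carrier V" for f g u
  proof -
    let ?A = "keys f \<union> keys g"
    have "free_act V (f + g) u = (\<Oplus>\<^bsub>V\<^esub>w\<in>?A. lookup (f + g) w \<odot>\<^bsub>V\<^esub> ?w w u)"
      by (rule superset) (auto simp: Poly_Mapping.keys_add u)
    also have "\<dots> = (\<Oplus>\<^bsub>V\<^esub>w\<in>?A. lookup f w \<odot>\<^bsub>V\<^esub> ?w w u \<oplus>\<^bsub>V\<^esub> lookup g w \<odot>\<^bsub>V\<^esub> ?w w u)"
      using smult_l_distr[of "lookup f _" "lookup g _"] u by (simp add: lookup_add)
    also have "\<dots> = free_act V f u \<oplus>\<^bsub>V\<^esub> free_act V g u"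
      using u by (subst M.finsum_addf) (auto simp: superset[of ?A])
    finally show ?thesis .
  qed
  have smult: "free_act V (scale c f) u = c \<odot>\<^bsub>V\<^esub> free_act V f u" if u: "u \<in> carrier V" for c f u
  proof -
    have "free_act V (scale c f) u = (\<Oplus>\<^bsub>V\<^esub>w\<in>keys f. lookup (scale c f) w \<odot>\<^bsub>V\<^esub> ?w w u)"
      by (rule superset) (auto simp: lookup_scale in_keys_iff u)
    also have "\<dots> = (\<Oplus>\<^bsub>V\<^esub>w\<in>keys f. c \<odot>\<^bsub>V\<^esub> (lookup f w \<odot>\<^bsub>V\<^esub> ?w w u))"
      using smult_assoc1[of c "lookup f _"] u by (simp add: lookup_scale)
    also have "\<dots> = c \<odot>\<^bsub>V\<^esub> free_act V f u"
      unfolding free_act_def using u by (subst finsum_smult_ldistr) auto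
    finally show ?thesis .
  qed
  have word_single: "free_act V (single w 1) u = ?w w u" if "u \<in> carrier V" for w u
    using that smult_one by (simp add: free_act_def)
  have zero: "free_act V 0 u = \<zero>\<^bsub>V\<^esub>" for u
    by (simp add: free_act_def)
  have act: "free_act V (gen x * f) u = act V x (free_act V f u)" if u: "u \<in> carrier V" for x f u
  proof (induction f rule: linear_induct)
    case (single w)
    show ?case using gen_mult_single[of x "letters w" 1] by (simp add: word_single u)
  qed (simp_all add: distrib_left add smult scale_mult_right act_add_right act_scale_right u)
  have mult: "free_act V (f * g) u = free_act V f (free_act V g u)" if u: "u \<in> carrier V" for f g u
  proof (induction f rule: linear_induct)
    case (single w)
    have "free_act V (single (Word l) 1 * g) u = foldr (act V) l (free_act V g u)" for l
    proof (induction l)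
      case Nil
      have "single (Word []) 1 = (1 :: word_alg)"
        by (simp flip: zero_free_monoid_def)
      then show ?case by simp
    next
      case (Cons x l)
      then show ?case unfolding gen_mult_single[symmetric] mult.assoc act[OF u] by simp
    qed
    from this[of "letters w"] show ?case
      using word_single[of "free_act V g u" w] u by simp
  qed (simp_all add: distrib_right add smult scale_mult_left u)
  show one: "free_act V 1 v = v"
    using word_single[OF v, of 0] by (simp add: single_one)
  have range: "carrier V = ?R"
  proof
    have "submodule (?R) complex_field V"
    proof (rule submoduleI)
      show "\<zero>\<^bsub>V\<^esub> \<in> ?R" using rangeI[of "\<lambda>f. free_act V f v" 0] by (simp only: zero)
    next
      fix a assume "a \<in> ?R"
      then obtain f where f: "a = free_act V f v" by blast
      have "free_act V (- f) v \<oplus>\<^bsub>V\<^esub> free_act V f v = \<zero>\<^bsub>V\<^esub>"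
        using add[OF v, of "- f" f] by (simp add: zero)
      then have "\<ominus>\<^bsub>V\<^esub> a = free_act V (- f) v" unfolding f by (intro M.minus_equality) (simp_all add: v)
      then show "\<ominus>\<^bsub>V\<^esub> a \<in> ?R" by blast
    next
      fix a b assume "a \<in> ?R" "b \<in> ?R"
      then obtain f g where "a = free_act V f v" "b = free_act V g v" by blast
      then have "a \<oplus>\<^bsub>V\<^esub> b = free_act V (f + g) v" by (simp only: add[OF v])
      then show "a \<oplus>\<^bsub>V\<^esub> b \<in> ?R" by blast
    next
      fix c a assume "a \<in> ?R"
      then obtain f where "a = free_act V f v" by blast
      then have "c \<odot>\<^bsub>V\<^esub> a = free_act V (scale c f) v" by (simp only: smult[OF v])
      then show "c \<odot>\<^bsub>V\<^esub> a \<in> ?R" by blast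
    qed (auto simp: v)
    moreover have "act V x w \<in> ?R" if w: "w \<in> ?R" for x w
    proof -
      from w obtain f where "w = free_act V f v" by blast
      then have "act V x w = free_act V (gen x * f) v" by (simp only: act[OF v])
      then show ?thesis by blast
    qed
    ultimately have "lie_submodule b_alg V (?R)"
      unfolding lie_submodule_def by blast
    then show "carrier V \<subseteq> ?R"
      using one gen rangeI[of "\<lambda>f. free_act V f v" 1] by auto
  qed (auto simp: v)
  show "presents (\<lambda>f. free_act V f v) V"
    unfolding presents_def using range zero add[OF v] smult[OF v] act[OF v] by simp
  show "free_act V f v = \<zero>\<^bsub>V\<^esub>" if "f \<in> env_ideal b_alg" for f
  proof -
    have "env_ideal b_alg \<subseteq> ?Z"
    proof (rule b_alg.env_ideal_minimal)
      have gen': "free_act V (gen x) u = act V x u" if "u \<in> carrier V" for x u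
        using act[OF that, of x 1] word_single[OF that, of 0] that by (simp add: single_one)
      have diff: "free_act V (f - g) u = free_act V f u \<ominus>\<^bsub>V\<^esub> free_act V g u" if u: "u \<in> carrier V" for f g u
      proof -
        have "free_act V f u = free_act V (f - g) u \<oplus>\<^bsub>V\<^esub> free_act V g u"
          using add[OF u, of "f - g" g] by simp
        then show ?thesis using u by (simp add: a_minus_def M.a_assoc M.r_neg)
      qed
      have self: "a \<ominus>\<^bsub>V\<^esub> a = \<zero>\<^bsub>V\<^esub>" if "a \<in> carrier V" for a
        using that by (simp add: a_minus_def M.r_neg)
      show "env_relations b_alg \<subseteq> ?Z"
        unfolding env_relations_def
        by (auto simp: diff add smult mult gen' act_closed self
            act_add_left[simplified] act_scale_left[simplified] act_bracket[simplified])
    next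
      fix f assume f: "f \<in> ?Z"
      have "free_act V (- f) u = \<zero>\<^bsub>V\<^esub>" if u: "u \<in> carrier V" for u
      proof -
        have "free_act V f u = \<zero>\<^bsub>V\<^esub>" using f u by blast
        then show ?thesis using add[OF u, of "- f" f] M.r_zero[OF closed[OF u, of "- f"]] by (simp add: zero)
      qed
      then show "- f \<in> ?Z" by blast
    next
      fix f g assume f: "f \<in> ?Z"
      have "free_act V g \<zero>\<^bsub>V\<^esub> = \<zero>\<^bsub>V\<^esub>"
        using smult[of "\<zero>\<^bsub>V\<^esub>" 0 g] mult[of v g 0] zero v by simp
      moreover have "free_act V f u = \<zero>\<^bsub>V\<^esub>" if "u \<in> carrier V" for u using f that by blast
      ultimately show "g * f \<in> ?Z"
        by (intro CollectI ballI) (simp only: mult)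
    qed (simp_all add: zero add mult)
    with that v show ?thesis by blast
  qed
qed

lemma left_ideal_uminus: "left_ideal W \<Longrightarrow> u \<in> W \<Longrightarrow> - u \<in> W"
  using left_ideal_mult[of W u "- 1"] by simp

lemma additive_of_int:
  fixes \<eta> :: "'a::ring_1 \<Rightarrow> 'b::ring_1"
  assumes add: "\<And>a b. \<eta> (a + b) = \<eta> a + \<eta> b" and one: "\<eta> 1 = 1"
  shows "\<eta> (of_int n) = of_int n"
proof -
  have zero: "\<eta> 0 = 0" using add[of 0 0] by simp
  have neg: "\<eta> (- a) = - \<eta> a" for a using add[of "- a" a] by (simp add: zero eq_neg_iff_add_eq_0)
  have nat: "\<eta> (of_nat k) = of_nat k" for k by (induction k) (simp_all add: add one zero)
  show ?thesis by (cases n) (simp_all only: of_int_of_nat_eq of_int_minus neg nat)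
qed

lemma gen_yb_comm:
  "gen (yb d i) * gen (yb e j) - gen (yb e j) * gen (yb d i)
    - of_int (e * int i - d * int j) * gen (yb (d + e) (i + j - 1)) \<in> env_ideal b_alg"
proof -
  let ?c = "of_int (e * int i - d * int j) :: complex"
  have "(gen (yb d i) * gen (yb e j) - gen (yb e j) * gen (yb d i) - gen (b_bracket (yb d i) (yb e j)))
      + (gen (scale ?c (yb (d + e) (i + j - 1))) - scale ?c (gen (yb (d + e) (i + j - 1)))) \<in> env_ideal b_alg"
    by (intro b_alg.env_ideal_closed(2) env_ideal_gen)
  moreover have "scale ?c f = of_int (e * int i - d * int j) * f" for f :: "word_alg"
    using additive_of_int[of "\<lambda>a. scale a (1 :: word_alg)" "e * int i - d * int j"]
    by (simp add: scale.scale_left_distrib scale_one_mult(1)[symmetric, of _ f] del: scale_single of_int_diff of_int_mult)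
  ultimately show ?thesis
    unfolding b_bracket_y by (simp del: of_int_diff of_int_mult)
qed

text \<open>One set of hypotheses for two rings of scalars: \<complex> embedded as constants, and
  \<open>\<complex>[X]\<close> substituted by \<open>hz\<close>. Centrality of the images is stated
  modulo \<open>env_ideal b_alg\<close>, which is why the descent asks for linearity of
  \<open>Y\<close> modulo \<open>W\<close>.\<close>

locale descent_data = whittaker_character \<phi>
  for \<phi> :: "bvec \<Rightarrow> complex" +
  fixes \<eta> :: "'a::{idom,ring_char_0} \<Rightarrow> word_alg" and ph :: "nat \<Rightarrow> 'a"
  assumes \<eta>_add: "\<eta> (a + b) = \<eta> a + \<eta> b" and \<eta>_mult: "\<eta> (a * b) = \<eta> a * \<eta> b" and \<eta>_one: "\<eta> 1 = 1"
    and \<eta>_central: "f * \<eta> a - \<eta> a * f \<in> env_ideal b_alg"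
    and \<eta>_scalar: "\<exists>a. scale c 1 = \<eta> a"
    and \<eta>_ph: "\<eta> (ph i) = scale (\<phi> (yb 1 i)) 1"
    and ph_independent: "\<And>a :: nat \<Rightarrow> 'a. (\<And>j. (\<Sum>i = 1..n. a i * ph (i + j - 1)) = 0) \<Longrightarrow> i \<in> {1..n} \<Longrightarrow> a i = 0"
begin

abbreviation sc where "sc \<equiv> \<lambda>a f. \<eta> a * f"
abbreviation Y where "Y \<equiv> \<lambda>d i f. gen (yb d i) * f"

lemma \<eta>_zero: "\<eta> 0 = 0"
  using \<eta>_add[of 0 0] by simp

lemma descent:
  assumes W: "whittaker_ideal \<phi> W"
  shows "whittaker_descent sc Y W 1 ph"
proof -
  from W have ideal: "left_ideal W" and I: "env_ideal b_alg \<subseteq> W" by (simp_all add: whittaker_ideal_def)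
  interpret Modules.module sc
    by unfold_locales (simp_all add: \<eta>_add \<eta>_mult \<eta>_one algebra_simps)
  have mult_I: "r * f \<in> W" if "r \<in> env_ideal b_alg" for r f
    using b_alg.env_ideal_closed(5)[OF that, of f] I by auto
  show ?thesis
  proof unfold_locales
    show "subspace W"
      using ideal by (intro subspaceI) (auto simp: left_ideal_def)
  next
    fix d i a f
    show "gen (yb d i) * (\<eta> a * f) - \<eta> a * (gen (yb d i) * f) \<in> W"
      using mult_I[OF \<eta>_central[of "gen (yb d i)" a], of f] by (simp add: left_diff_distrib mult.assoc)
  next
    fix d i e j f
    have "\<eta> (of_int (e * int i - d * int j)) = of_int (e * int i - d * int j)"
      by (rule additive_of_int[OF \<eta>_add \<eta>_one])
    then show "gen (yb d i) * (gen (yb e j) * f) - gen (yb e j) * (gen (yb d i) * f)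
      - \<eta> (of_int (e * int i - d * int j)) * (gen (yb (d + e) (i + j - 1)) * f) \<in> W"
      using mult_I[OF gen_yb_comm[of d i e j], of f]
      by (simp only: left_diff_distrib mult.assoc)
  next
    fix d :: int and i :: nat assume d: "1 \<le> d"
    have "gen (yb d i) - scale (\<phi> (yb d i)) 1 \<in> W"
      using W y_n_alg[OF d] unfolding whittaker_ideal_def by blast
    moreover have "scale (\<phi> (yb d i)) 1 = \<eta> (if d = 1 then ph i else 0)"
      using d character_y[OF hom, of d i] by (cases "d = 1") (simp_all add: \<eta>_ph \<eta>_zero del: scale_single)
    ultimately show "gen (yb d i) * 1 - \<eta> (if d = 1 then ph i else 0) * 1 \<in> W"
      by (simp only: mult_1_right)
  next
    fix n i and a :: "nat \<Rightarrow> 'a" assume "\<And>j. (\<Sum>i = 1..n. a i * ph (i + j - 1)) = 0" "i \<in> {1..n}"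
    then show "a i = 0" by (rule ph_independent)
  qed (use ideal in \<open>simp_all only: left_ideal_mult distrib_left\<close>)
qed

text \<open>The elements lying in some \<open>G N\<close> form a left ideal containing 1; closure
  under complex multiples rests on \<open>\<eta>_scalar\<close>.\<close>

lemma exhaustive:
  assumes W: "whittaker_ideal \<phi> W"
  shows "\<exists>N :: nat. f \<in> whittaker_descent.G sc Y W 1 (int N)"
proof -
  interpret W: whittaker_descent sc Y W 1 ph by (rule descent[OF W])
  from W have ideal: "left_ideal W" and I: "env_ideal b_alg \<subseteq> W" by (simp_all add: whittaker_ideal_def)
  let ?U = "{f. \<exists>N. f \<in> W.G N}"
  have U_add: "u + v \<in> ?U" if "u \<in> ?U" "v \<in> ?U" for u v
  proof -
    from that obtain N N' where "u \<in> W.G N" "v \<in> W.G N'" by blast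
    then have "u + v \<in> W.G (max N N')" by (intro W.G_rules(1)) (auto elim: W.G_mono)
    then show ?thesis by blast
  qed
  have U_scale: "scale c u \<in> ?U" if "u \<in> ?U" for c u
  proof -
    obtain a where "scale c 1 = \<eta> a" using \<eta>_scalar by blast
    then have "scale c u = \<eta> a * u" using scale_one_mult(1)[of c u] by metis
    with that W.G_rules(3) show ?thesis by auto
  qed
  have mod_I: "u \<in> ?U" if "u - v \<in> env_ideal b_alg" "v \<in> ?U" for u v
    using that I W.W_G[of "u - v"] W.G_cong by blast
  have mult_I: "r * f \<in> env_ideal b_alg" if "r \<in> env_ideal b_alg" for r f
    using that by (rule b_alg.env_ideal_closed(5)) simp
  have "left_ideal ?U"
  proof (rule left_idealI)
    fix x :: bvec and u assume u: "u \<in> ?U"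
    show "gen x * u \<in> ?U"
    proof (induction x rule: linear_induct)
      case (single k)
      have "single k 1 = yb (fst k + int (snd k) - 1) (snd k)"
        by (simp add: yb_def bx_def)
      then show ?case using u W.Y_G_exists[of u] by auto
    next
      case (add x x')
      have "(gen (x + x') - (gen x + gen x')) * u \<in> env_ideal b_alg"
        by (intro mult_I env_ideal_gen)
      then have "gen (x + x') * u - (gen x * u + gen x' * u) \<in> env_ideal b_alg"
        by (simp only: left_diff_distrib distrib_right)
      then show ?case by (rule mod_I) (rule U_add[OF add])
    next
      case (scale c x)
      have "(gen (scale c x) - scale c (gen x)) * u \<in> env_ideal b_alg"
        by (intro mult_I env_ideal_gen)
      then have "gen (scale c x) * u - scale c (gen x * u) \<in> env_ideal b_alg"
        by (simp only: left_diff_distrib scale_mult_left)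
      then show ?case by (rule mod_I) (rule U_scale[OF scale])
    qed
  next
    show "0 \<in> ?U" using W.G_rules(4) by blast
  qed (fact U_add, fact U_scale)
  moreover have "1 \<in> ?U" using W.G_word[of "[]" 1] by auto
  ultimately have "f * 1 \<in> ?U" by (rule left_ideal_mult)
  then obtain N where "f \<in> W.G N" by auto
  then have "f \<in> W.G (int (nat N))" by (rule W.G_mono) simp
  then show ?thesis by blast
qed

text \<open>Take the least \<open>n\<close> with \<open>f \<in> G n\<close>. It is positive because
  \<open>G 0 = W\<close>, and for \<open>n = N + 1\<close> the symbol of weight \<open>N\<close> is
  nonzero by minimality.\<close>

lemma leading_symbol:
  assumes W: "whittaker_ideal \<phi> W" and f: "f \<notin> W" and \<zeta>: "zeta - \<eta> \<zeta> \<in> W"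
  obtains N P where "whittaker_descent.homogeneous N P" "P \<noteq> 0"
    "f - linear_extension sc (whittaker_descent.s Y 1) P \<in> whittaker_descent.G sc Y W 1 (int N)"
proof -
  interpret W: whittaker_descent sc Y W 1 ph by (rule descent[OF W])
  define n where "n = (LEAST n :: nat. f \<in> W.G (int n))"
  have n: "f \<in> W.G (int n)" unfolding n_def using exhaustive[OF W] by (rule LeastI_ex)
  have "f \<notin> W.G 0" using f by (simp add: W.G_nonpos)
  with n have "n \<noteq> 0" by (intro notI) simp
  then obtain N where N: "n = Suc N" by (cases n) auto
  have "f \<notin> W.G (int N)"
    using not_less_Least[of N "\<lambda>n. f \<in> W.G (int n)"] N unfolding n_def by simp
  have "f \<in> W.G (int N + 1)" using n N by (simp add: add.commute)
  \<comment> \<open>Since \<open>W\<close> is a left ideal, the hypothesis on \<open>\<zeta>\<close>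
    gives this relation with \<open>v\<close> on the left; centrality of both terms moves
    \<open>v\<close> to the right.\<close>
  moreover have "gen (yb 0 0) * v - \<eta> \<zeta> * v \<in> W" for v
  proof -
    have "v * (zeta - \<eta> \<zeta>) \<in> W"
      using \<zeta> W by (simp add: whittaker_ideal_def left_ideal_def)
    moreover have "v * zeta - zeta * v \<in> W" "v * \<eta> \<zeta> - \<eta> \<zeta> * v \<in> W"
      using zeta_central \<eta>_central W by (auto simp: whittaker_ideal_def)
    ultimately have "v * (zeta - \<eta> \<zeta>) - (v * zeta - zeta * v) + (v * \<eta> \<zeta> - \<eta> \<zeta> * v) \<in> W"
      using W unfolding whittaker_ideal_def by (meson left_ideal_add left_ideal_diff)
    then show ?thesis by (simp add: yb_def algebra_simps)
  qed
  ultimately obtain P where P: "W.homogeneous N P" "f - W.S P \<in> W.G (int N)"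
    using W.symbol_exists by blast
  moreover have "P \<noteq> 0" using P(2) \<open>f \<notin> W.G (int N)\<close> by auto
  ultimately show thesis by (intro that)
qed

lemma G_subset:
  assumes "whittaker_ideal \<phi> J" "whittaker_ideal \<phi> W" "J \<subseteq> W"
  shows "whittaker_descent.G sc Y J 1 n \<subseteq> whittaker_descent.G sc Y W 1 n"
proof -
  interpret J: whittaker_descent sc Y J 1 ph by (rule descent) fact
  interpret W: whittaker_descent sc Y W 1 ph by (rule descent) fact
  show ?thesis unfolding J.G_def W.G_def using assms(3) by (intro J.span_mono) auto
qed

text \<open>The symbol is taken modulo the smaller ideal \<open>J\<close>, where \<open>f\<close> is
  nonzero, and the descent is run modulo \<open>W\<close>, where \<open>f\<close> vanishes, so that
  its symbol represents an element of lower weight.\<close>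

lemma nonzero_scalar:
  assumes J: "whittaker_ideal \<phi> J" and W: "whittaker_ideal \<phi> W" and "J \<subseteq> W" "f \<in> W" "f \<notin> J"
    and \<zeta>: "zeta - \<eta> \<zeta> \<in> J"
  shows "\<exists>a. a \<noteq> 0 \<and> \<eta> a \<in> W"
proof -
  interpret W: whittaker_descent sc Y W 1 ph by (rule descent[OF W])
  obtain N P where P: "W.homogeneous N P" "P \<noteq> 0" "f - W.S P \<in> whittaker_descent.G sc Y J 1 (int N)"
    using leading_symbol[OF J \<open>f \<notin> J\<close> \<zeta>] by metis
  then have "f - W.S P \<in> W.G (int N)" using G_subset[OF J W \<open>J \<subseteq> W\<close>] by blast
  with W.G_cong[OF this] W.W_G[OF \<open>f \<in> W\<close>] have "W.S P \<in> W.G (int N)" by blast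
  then obtain a where "a \<noteq> 0" "\<eta> a * 1 \<in> W" using W.graded_faithful[OF P(1,2)] by blast
  then show ?thesis by auto
qed

end

section \<open>The Hankel rank condition as linear independence\<close>

lemma vector_space_sequences: "vector_space (\<lambda>c (f :: nat \<Rightarrow> complex) i. c * f i)"
  unfolding vector_space_def
  by (intro conjI allI; rule ext) (simp_all only: plus_fun_apply distrib_left distrib_right mult.assoc mult_1_left)

text \<open>For \<open>s = 1\<close> the entry in row \<open>m\<close> and column \<open>j\<close>
  is \<open>\<phi> (y 1 (m + j))\<close>, so \<open>rel\<close> at \<open>m\<close> is row
  \<open>m\<close> of a relation between the columns \<open>i - 1\<close>. A rank equal to the
  number \<open>n + 1\<close> of columns forces them to be distinct and independent.\<close>

lemma hankel_independent:
  assumes good: "good_character \<phi>" and i: "i \<in> {1..n}"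
    and rel: "\<And>j. (\<Sum>i = 1..n. a i * \<phi> (yb 1 (i + j - 1))) = 0"
  shows "a i = 0"
proof -
  interpret vs: vector_space "\<lambda>c (f :: nat \<Rightarrow> complex) i. c * f i"
    by (rule vector_space_sequences)
  define col where "col = (\<lambda>j m. if m \<in> {1..} then hankel \<phi> 1 m j else 0)"
  have "n \<ge> 1" using i by simp
  then have rank: "vs.dim (col ` {0..n}) = n + 1"
    using good unfolding good_character_def matrix_rank_def col_def by blast
  obtain B where B: "B \<subseteq> col ` {0..n}" "vs.independent B" "col ` {0..n} \<subseteq> vs.span B"
    using vs.maximal_independent_subset[of "col ` {0..n}"] by blast
  have "card B = n + 1" using vs.basis_card_eq_dim[OF B(1,3,2)] rank by simp
  moreover have "card (col ` {0..n}) \<le> n + 1" using card_image_le[of "{0..n}" col] by simp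
  ultimately have "B = col ` {0..n}" using B(1) \<open>card B = n + 1\<close> by (intro card_seteq) simp_all
  with B(2) \<open>card B = n + 1\<close> have ind: "vs.independent (col ` {0..n})" and inj: "inj_on col {0..n}"
    by (auto intro: eq_card_imp_inj_on)
  \<comment> \<open>The relation has \<open>n\<close> terms while the matrix has
    \<open>n + 1\<close> columns; the last column gets coefficient 0.\<close>
  define b where "b j = (if j < n then a (j + 1) else 0)" for j
  have "(\<Sum>j = 0..n. (\<lambda>m. b j * col j m)) = 0"
  proof (rule ext)
    fix m
    have "(\<Sum>j = 0..n. b j * col j m) = 0"
    proof (cases "1 \<le> m")
      case True
      have "(\<Sum>j = 0..n. b j * col j m) = (\<Sum>j = 0..<n. b j * col j m)"
        by (rule sum.mono_neutral_right) (auto simp: b_def)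
      also have "\<dots> = (\<Sum>j = 0..<n. a (j + 1) * \<phi> (yb 1 (j + m)))"
        using True by (intro sum.cong refl) (simp add: b_def col_def hankel_def yb_def add.commute Let_def)
      also have "\<dots> = (\<Sum>i = 1..n. a i * \<phi> (yb 1 (i + m - 1)))"
        by (rule sum.reindex_bij_witness[of _ "\<lambda>i. i - 1" "\<lambda>j. j + 1"]) auto
      finally show ?thesis using rel by simp
    qed (simp add: col_def)
    moreover have "(\<Sum>j\<in>A. (\<lambda>m. b j * col j m)) m = (\<Sum>j\<in>A. b j * col j m)" for A
      by (induction A rule: infinite_finite_induct) simp_all
    ultimately show "(\<Sum>j = 0..n. (\<lambda>m. b j * col j m)) m = 0 m" by simp
  qed
  then have "(\<Sum>v\<in>col ` {0..n}. (\<lambda>m. b (inv_into {0..n} col v) * v m)) = 0"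
    by (subst sum.reindex[OF inj]) (simp add: inj)
  then have "b (inv_into {0..n} col v) = 0" if "v \<in> col ` {0..n}" for v
    using vs.independentD[OF ind _ subset_refl, of "\<lambda>v. b (inv_into {0..n} col v)" v] that by simp
  from this[of "col (i - 1)"] i inj have "b (i - 1) = 0" by auto
  moreover have "i - 1 < n" "i - 1 + 1 = i" using i by auto
  ultimately show ?thesis by (simp only: b_def if_True)
qed

lemma descent_data_complex:
  assumes "good_character \<phi>"
  shows "descent_data \<phi> (\<lambda>c. scale c 1) (\<lambda>i. \<phi> (yb 1 i))"
proof unfold_locales
  show "lie_hom n_alg abelian_line \<phi>" using assms by (simp add: good_character_def)
  fix n i and a :: "nat \<Rightarrow> complex"
  assume "\<And>j. (\<Sum>i = 1..n. a i * \<phi> (yb 1 (i + j - 1))) = 0" "i \<in> {1..n}"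
  then show "a i = 0" using hankel_independent[OF assms] by blast
next
  fix f a show "f * scale a 1 - scale a 1 * f \<in> env_ideal b_alg"
    by (simp add: scale_one_mult b_alg.env_ideal_closed del: scale_single)
qed (auto simp: scale.scale_left_distrib scale_one_mult simp del: scale_single)

lemma descent_data_poly:
  assumes "good_character \<phi>"
  shows "descent_data \<phi> hz (\<lambda>i. [:\<phi> (yb 1 i):])"
proof unfold_locales
  show "lie_hom n_alg abelian_line \<phi>" using assms by (simp add: good_character_def)
  fix n i and a :: "nat \<Rightarrow> complex poly"
  assume rel: "\<And>j. (\<Sum>i = 1..n. a i * [:\<phi> (yb 1 (i + j - 1)):]) = 0" and i: "i \<in> {1..n}"
  \<comment> \<open>The values of the character are constants, so a relation over
    \<open>\<complex>[X]\<close> splits into relations over \<complex>, one for each power of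
    \<open>X\<close>.\<close>
  have "Polynomial.coeff (a i) k = 0" for k
  proof (rule hankel_independent[OF assms i])
    fix j
    have "(\<Sum>i = 1..n. Polynomial.coeff (a i) k * \<phi> (yb 1 (i + j - 1)))
      = Polynomial.coeff (\<Sum>i = 1..n. a i * [:\<phi> (yb 1 (i + j - 1)):]) k"
      by (simp add: coeff_sum mult.commute)
    then show "(\<Sum>i = 1..n. Polynomial.coeff (a i) k * \<phi> (yb 1 (i + j - 1))) = 0"
      by (simp only: rel coeff_0)
  qed
  then show "a i = 0" by (simp add: poly_eq_iff)
next
  show "\<exists>p. scale c 1 = hz p" for c using hz_const by metis
qed (simp_all only: hz_add hz_mult hz_1 hz_central hz_const)

text \<open>As \<open>z\<close> acts by a number, the descent runs over \<complex>, and the nonzero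
  scalar it produces is invertible. Hence a proper \<open>J\<close> of this kind is a maximal left
  ideal.\<close>

lemma proper_extension_contains_one:
  assumes good: "good_character \<phi>" and J: "whittaker_ideal \<phi> J" and W: "whittaker_ideal \<phi> W"
    and "J \<subseteq> W" "J \<noteq> W" and \<xi>: "zeta - scale \<xi> 1 \<in> J"
  shows "1 \<in> W"
proof -
  interpret descent_data \<phi> "\<lambda>c. scale c 1" "\<lambda>i. \<phi> (yb 1 i)" by (rule descent_data_complex[OF good])
  obtain f where "f \<in> W" "f \<notin> J" using assms by blast
  with nonzero_scalar[OF J W \<open>J \<subseteq> W\<close>] \<xi> obtain a where a: "a \<noteq> 0" "scale a 1 \<in> W" by blast
  have "left_ideal W" using W by (simp add: whittaker_ideal_def)
  from left_ideal_scale[OF this a(2), of "inverse a"] a(1) show ?thesis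
    by (simp add: scale.scale_scale del: scale_single)
qed

text \<open>The descent is run over \<open>\<complex>[X]\<close>, where \<open>z\<close> is the
  scalar \<open>X\<close>, so it is available before an eigenvalue is known. It shows that the
  annihilator \<open>P\<close> of the generator in \<open>\<complex>[X]\<close> is nonzero;
  \<open>linear_poly_in_ideal\<close> then extracts a linear factor.\<close>

lemma maximal_central_eigenvalue:
  assumes good: "good_character \<phi>" and J: "whittaker_ideal \<phi> J" and "1 \<notin> J"
    and max: "\<And>W. left_ideal W \<Longrightarrow> J \<subseteq> W \<Longrightarrow> W = J \<or> 1 \<in> W"
  obtains \<xi> where "zeta - scale \<xi> 1 \<in> J"
proof -
  interpret descent_data \<phi> hz "\<lambda>i. [:\<phi> (yb 1 i):]" by (rule descent_data_poly[OF good])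
  from J have ideal: "left_ideal J" and I: "env_ideal b_alg \<subseteq> J" by (simp_all add: whittaker_ideal_def)
  define P where "P = {p. hz p \<in> J}"
  have comm: "hz p * f \<in> J" if "hz p \<in> J" for p f
    using left_ideal_diff[OF ideal left_ideal_mult[OF ideal that, of f], of "f * hz p - hz p * f"] hz_central[of f p] I
    by auto
  have P: "left_ideal P"
    using ideal left_ideal_mult[OF ideal] by (auto simp: P_def left_ideal_def hz_add hz_mult)
  have "1 \<notin> P" using \<open>1 \<notin> J\<close> by (simp add: P_def)
  \<comment> \<open>Schur's argument: the kernel of \<open>z - \<xi>\<close> on the simple module is
    a submodule, and as it contains the nonzero image of \<open>hz s\<close>, it is
    everything.\<close>
  have prime: "[:- \<xi>, 1:] \<in> P" if s: "s \<notin> P" "[:- \<xi>, 1:] * s \<in> P" for s \<xi>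
  proof -
    let ?l = "[:- \<xi>, 1:] :: complex poly"
    define U where "U = {f. hz ?l * f \<in> J}"
    have "left_ideal U"
      unfolding left_ideal_def
    proof (intro conjI ballI allI)
      show "0 \<in> U" using ideal by (simp add: U_def left_ideal_def)
    next
      fix u v assume "u \<in> U" "v \<in> U"
      then show "u + v \<in> U" using left_ideal_add[OF ideal] by (simp add: U_def distrib_left)
    next
      fix u f assume "u \<in> U"
      then have "f * (hz ?l * u) \<in> J" using left_ideal_mult[OF ideal] by (simp add: U_def)
      moreover have "(f * hz ?l - hz ?l * f) * u \<in> J"
        using b_alg.env_ideal_closed(5)[OF hz_central] I by auto
      ultimately have "f * (hz ?l * u) - (f * hz ?l - hz ?l * f) * u \<in> J" by (rule left_ideal_diff[OF ideal])
      then show "f * u \<in> U" by (simp add: U_def left_diff_distrib mult.assoc)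
    qed
    moreover have "J \<subseteq> U" using left_ideal_mult[OF ideal] by (auto simp: U_def)
    ultimately have "U = J \<or> 1 \<in> U" by (rule max)
    moreover have "hz s \<in> U" using s(2) by (simp only: U_def P_def hz_mult mem_Collect_eq)
    moreover have "hz s \<notin> J" using s(1) by (simp add: P_def)
    ultimately have "1 \<in> U" by blast
    then show ?thesis by (simp only: U_def P_def mem_Collect_eq mult_1_right)
  qed
  have "\<exists>r\<in>P. r \<noteq> 0"
  proof (cases "zeta \<in> J")
    case True
    then have "[:0, 1:] \<in> P" by (simp only: P_def hz_X mem_Collect_eq)
    moreover have "[:0, 1:] \<noteq> (0 :: complex poly)" by simp
    ultimately show ?thesis by blast
  next
    case False
    \<comment> \<open>The left ideal belonging to the image of \<open>z\<close>. As \<open>z\<close>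
      does not kill the generator, this image is the whole simple module, so the generator is
      \<open>z f\<close> for some \<open>f\<close>.\<close>
    define U where "U = {zeta * f + j | f j. j \<in> J}"
    have "left_ideal U"
      unfolding left_ideal_def
    proof (intro conjI ballI allI)
      show "0 \<in> U" using ideal unfolding U_def by (intro CollectI exI[of _ 0]) (simp add: left_ideal_def)
    next
      fix u v assume "u \<in> U" "v \<in> U"
      then obtain f j f' j' where "u = zeta * f + j" "j \<in> J" "v = zeta * f' + j'" "j' \<in> J" unfolding U_def by blast
      moreover from this have "u + v = zeta * (f + f') + (j + j')" by (simp add: algebra_simps)
      ultimately show "u + v \<in> U" using left_ideal_add[OF ideal] unfolding U_def by blast
    next
      fix u h assume "u \<in> U"
      then obtain f j where u: "u = zeta * f + j" "j \<in> J" unfolding U_def by blast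
      have "(h * zeta - zeta * h) * f \<in> J"
        using b_alg.env_ideal_closed(5)[OF zeta_central] I by auto
      then have "(h * zeta - zeta * h) * f + h * j \<in> J"
        by (rule left_ideal_add[OF ideal _ left_ideal_mult[OF ideal u(2)]])
      moreover have "h * u = zeta * (h * f) + ((h * zeta - zeta * h) * f + h * j)"
        by (simp add: u(1) algebra_simps)
      ultimately show "h * u \<in> U" unfolding U_def by blast
    qed
    moreover have "j \<in> U" if "j \<in> J" for j
      using that unfolding U_def by (intro CollectI exI[of _ 0] exI[of _ j]) simp
    then have "J \<subseteq> U" by blast
    ultimately have "U = J \<or> 1 \<in> U" by (rule max)
    moreover have "zeta \<in> U"
      using ideal unfolding U_def by (intro CollectI exI[of _ 1] exI[of _ 0]) (simp add: left_ideal_def)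
    ultimately have "1 \<in> U" using False by blast
    then obtain f j where f: "1 = zeta * f + j" "j \<in> J" unfolding U_def by blast
    have "zeta * f - 1 = zeta * f - (zeta * f + j)" by (simp only: f(1)[symmetric])
    then have zf: "zeta * f - 1 \<in> J" using left_ideal_uminus[OF ideal f(2)] by simp
    have "f \<notin> J"
      using f left_ideal_add[OF ideal left_ideal_mult[OF ideal, of f zeta] f(2)] \<open>1 \<notin> J\<close> by auto
    moreover have "zeta - hz [:0, 1:] \<in> J" using ideal by (simp add: hz_X left_ideal_def)
    ultimately obtain n Q where Q: "whittaker_descent.homogeneous n Q" "Q \<noteq> 0"
      "f - linear_extension sc (whittaker_descent.s Y 1) Q \<in> whittaker_descent.G sc Y J 1 (int n)"
      using leading_symbol[OF J] by metis
    interpret D: whittaker_descent sc Y J 1 "\<lambda>i. [:\<phi> (yb 1 i):]" by (rule descent[OF J])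
    show ?thesis
    proof (cases "n = 0")
      \<comment> \<open>In weight 0 the symbol is a polynomial \<open>a\<close>, and
        \<open>f\<close> agrees with \<open>hz a\<close> modulo \<open>J\<close>. So
        \<open>1 - X a\<close> annihilates the generator, and its value at 0 is 1.\<close>
      case True
      have "keys Q \<subseteq> {{#}}"
      proof
        fix A assume "A \<in> keys Q"
        then have "D.wt A = 0" using Q(1) True by (simp add: D.homogeneous_def)
        then show "A \<in> {{#}}" by (cases A) simp_all
      qed
      then have "D.S Q = sc (lookup Q {#}) (D.s {#})"
        by (subst D.linear_extension_superset[of "{{#}}"]) simp_all
      moreover have "D.s {#} = 1" by (simp add: D.s_def)
      ultimately have "f - hz (lookup Q {#}) \<in> J"
        using Q(3) True by (simp add: D.G_nonpos)
      from left_ideal_diff[OF ideal left_ideal_mult[OF ideal this, of zeta] zf]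
      have "hz (1 - [:0, 1:] * lookup Q {#}) \<in> J"
        by (simp only: hz_diff hz_1 hz_mult hz_X right_diff_distrib) (simp add: algebra_simps)
      moreover have "1 - [:0, 1:] * a \<noteq> 0" for a :: "complex poly"
      proof
        assume "1 - [:0, 1:] * a = 0"
        then have "poly (1 - [:0, 1:] * a) 0 = 0" by (simp only: Polynomial.poly_0)
        then show False by simp
      qed
      ultimately show ?thesis unfolding P_def by blast
    next
      case False
      let ?X = "[:0, 1:] :: complex poly"
      let ?Q = "Poly_Mapping.map ((*) ?X) Q"
      have 1: "sc ?X (f - D.S Q) \<in> D.G (int n)" using Q(3) by (rule D.G_rules(3))
      have 2: "1 \<in> D.G (int n)" using D.G_word[of "[]" "int n"] False by simp
      have 3: "zeta * f - 1 \<in> D.G (int n)" using zf by (rule D.W_G)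
      \<comment> \<open>\<open>X Q\<close> is the symbol of \<open>zeta * f\<close> in weight
        \<open>n\<close>, but \<open>zeta * f\<close> agrees modulo \<open>J\<close> with 1, which
        has weight 0. So \<open>X Q\<close> represents an element of lower weight and the descent
        applies.\<close>
      have "1 + (zeta * f - 1) - sc ?X (f - D.S Q) \<in> D.G (int n)"
        by (rule D.G_rules(2)[OF D.G_rules(1)[OF 2 3] 1])
      then have "D.S ?Q \<in> D.G (int n)"
        by (simp only: D.linear_extension_map hz_X right_diff_distrib) simp
      moreover have "D.homogeneous n ?Q"
        using Q(1) by (auto simp: D.homogeneous_def Poly_Mapping.map.rep_eq in_keys_iff when_def)
      moreover have "?Q \<noteq> 0"
      proof -
        obtain A where "A \<in> keys Q" using Q(2) by fastforce
        then have "lookup ?Q A \<noteq> 0"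
          by (simp add: Poly_Mapping.map.rep_eq in_keys_iff when_def)
        then show ?thesis by (metis lookup_zero)
      qed
      ultimately obtain a where "a \<noteq> 0" "sc a 1 \<in> J" using D.graded_faithful by blast
      then show ?thesis by (auto simp: P_def)
    qed
  qed
  then obtain r where "r \<in> P" "r \<noteq> 0" by blast
  have "\<exists>\<xi>. [:- \<xi>, 1:] \<in> P"
    by (rule linear_poly_in_ideal[OF P \<open>1 \<notin> P\<close> \<open>r \<in> P\<close> \<open>r \<noteq> 0\<close>]) (rule prime)
  then obtain \<xi> where "[:- \<xi>, 1:] \<in> P" by blast
  then have "zeta - scale \<xi> 1 \<in> J" by (simp only: P_def mem_Collect_eq hz_linear)
  then show thesis by (rule that)
qed

section \<open>Matching eigenvalues with maximal ideals of \<open>S(Z)\<close>\<close>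

lemma central_ideal_eigenvalue:
  assumes W: "left_ideal W" "env_ideal b_alg \<subseteq> W" and \<xi>: "zeta - scale \<xi> 1 \<in> W" and "poly q \<xi> = 0"
  shows "hz q * f \<in> W"
proof -
  obtain s where "q = s * [:- \<xi>, 1:]" using poly_split[of q \<xi>] assms(4) by auto
  then have "f * hz q \<in> W"
    unfolding hz_mult hz_linear mult.assoc[symmetric] using left_ideal_mult[OF W(1) \<xi>] by (simp only: hz_mult hz_linear mult.assoc[symmetric])
  from left_ideal_diff[OF W(1) this, of "f * hz q - hz q * f"] hz_central[of f q] W(2) show ?thesis by auto
qed

text \<open>\<open>J\<close> certifies that the ideal is proper: if 1 and some \<open>p\<close>
  vanishing at \<open>\<xi>\<close> had the same class, then 1 would lie in \<open>J\<close>. In a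
  larger ideal, an element with nonzero value at \<open>\<xi>\<close>, divided by that value,
  differs from 1 by an element of the given ideal.\<close>

lemma maximalideal_eigenvalue:
  assumes J: "left_ideal J" "env_ideal b_alg \<subseteq> J" "1 \<notin> J" and \<xi>: "zeta - scale \<xi> 1 \<in> J"
  shows "maximalideal (central ` {p. poly p \<xi> = 0}) sym_center"
proof (rule maximalidealI)
  show "ideal (central ` {p. poly p \<xi> = 0}) sym_center"
    by (rule ideal_sym_centerI) (auto simp: left_ideal_def)
  show "carrier sym_center \<noteq> central ` {p. poly p \<xi> = 0}"
  proof
    assume "carrier sym_center = central ` {p. poly p \<xi> = 0}"
    moreover have "central 1 \<in> carrier sym_center" unfolding sym_center_carrier by (rule rangeI)
    ultimately obtain p where p: "central 1 = central p" "poly p \<xi> = 0" by blast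
    then have "1 - hz p \<in> J" using J(2) by (auto simp: univ_env_presented(7))
    moreover have "hz p * 1 \<in> J" by (rule central_ideal_eigenvalue[OF J(1,2) \<xi> p(2)])
    ultimately have "1 - hz p + hz p \<in> J" by (intro left_ideal_add[OF J(1)]) simp_all
    with J(3) show False by simp
  qed
  fix K assume K: "ideal K sym_center" "central ` {p. poly p \<xi> = 0} \<subseteq> K" "K \<subseteq> carrier sym_center"
  interpret K: ideal K sym_center by fact
  show "K = central ` {p. poly p \<xi> = 0} \<or> K = carrier sym_center"
  proof (rule disjCI)
    assume "K \<noteq> carrier sym_center"
    have "poly p \<xi> = 0" if p: "central p \<in> K" for p
    proof (rule ccontr)
      let ?c = "poly p \<xi>"
      assume c: "?c \<noteq> 0"
      have "central [:inverse ?c:] \<in> carrier sym_center" unfolding sym_center_carrier by (rule rangeI)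
      from K.I_l_closed[OF p this] have "central ([:inverse ?c:] * p) \<in> K"
        by (simp only: sym_center_presented hz_mult)
      moreover have "poly (1 - [:inverse ?c:] * p) \<xi> = 0" using c by simp
      then have "central (1 - [:inverse ?c:] * p) \<in> K" using K(2) by blast
      ultimately have "central ([:inverse ?c:] * p) \<oplus>\<^bsub>sym_center\<^esub> central (1 - [:inverse ?c:] * p) \<in> K"
        by (rule additive_subgroup.a_closed[OF K.is_additive_subgroup])
      moreover have "t + (1 - t) = 1" for t :: "complex poly" by simp
      ultimately have "\<one>\<^bsub>sym_center\<^esub> \<in> K"
        by (simp only: sym_center_presented hz_add[symmetric])
      then show False using K.one_imp_carrier \<open>K \<noteq> carrier sym_center\<close> by blast
    qed
    with K show "K = central ` {p. poly p \<xi> = 0}"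
      unfolding sym_center_carrier by blast
  qed
qed

text \<open>Together with \<open>proj_kernel\<close>: the kernel of the presentation of
  \<open>whittaker_quotient \<phi> \<mm>\<close> is the least Whittaker ideal containing
  \<open>z - \<xi>\<close>.\<close>

lemma (in whittaker_character) proj_kernel_eigenvalue:
  assumes \<mm>: "\<And>p. central p \<in> \<mm> \<longleftrightarrow> poly p \<xi> = 0" and sub: "\<mm> \<subseteq> carrier sym_center"
  shows "zeta - scale \<xi> 1 \<in> {f. proj \<mm> f = proj \<mm> 0}"
    and "whittaker_ideal \<phi> W \<Longrightarrow> zeta - scale \<xi> 1 \<in> W \<Longrightarrow> {f. proj \<mm> f = proj \<mm> 0} \<subseteq> W"
proof -
  have "central [:- \<xi>, 1:] \<in> \<mm>" using \<mm> by simp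
  from proj_generator[OF sub this, of 1] show "zeta - scale \<xi> 1 \<in> {f. proj \<mm> f = proj \<mm> 0}"
    by (simp only: hz_linear mult_1_right mem_Collect_eq)
next
  assume W: "whittaker_ideal \<phi> W" and \<xi>: "zeta - scale \<xi> 1 \<in> W"
  then have ideal: "left_ideal W" and I: "env_ideal b_alg \<subseteq> W" by (simp_all add: whittaker_ideal_def)
  show "{f. proj \<mm> f = proj \<mm> 0} \<subseteq> W"
  proof
    fix f assume "f \<in> {f. proj \<mm> f = proj \<mm> 0}"
    then have "proj \<mm> f = proj \<mm> 0" by simp
    then show "f \<in> W"
    proof (rule proj_kernel_minimal[OF sub W, rotated])
      fix p f assume p: "cls p \<in> \<mm>"
      then obtain q where q: "cls p = central q" using sub unfolding sym_center_carrier by blast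
      with p \<mm> have "poly q \<xi> = 0" by simp
      then have "hz q * f \<in> W" by (rule central_ideal_eigenvalue[OF ideal I \<xi>])
      moreover have "(p - hz q) * f \<in> W"
        using q I b_alg.env_ideal_closed(5)[of "p - hz q" f] by (auto simp: univ_env_presented(7))
      ultimately have "(p - hz q) * f + hz q * f \<in> W" by (intro left_ideal_add[OF ideal])
      then show "p * f \<in> W" by (simp add: left_diff_distrib)
    qed
  qed
qed

text \<open>In terms of left ideals: the kernel \<open>K\<close> of the quotient is proper by the
  explicit module on words and maximal by the descent. The kernel \<open>J\<close> of a simple
  Whittaker module contains some \<open>z - \<xi>\<close>, hence contains the corresponding
  \<open>K\<close>, hence equals it.\<close>

theorem corollary4p2p3:
  fixes \<phi> :: "bvec \<Rightarrow> complex"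
  assumes "good_character \<phi>"
  shows "(\<forall>\<mm>. maximalideal \<mm> sym_center \<longrightarrow>
            simple_lie_module b_alg (whittaker_quotient \<phi> \<mm>)) \<and>
         (\<forall>V :: (bvec, 'v) lie_mod.
            whittaker_module \<phi> V \<and> simple_lie_module b_alg V \<longrightarrow>
            (\<exists>\<mm>. maximalideal \<mm> sym_center \<and>
                 lie_module_isomorphic b_alg V (whittaker_quotient \<phi> \<mm>)))"
proof (intro conjI allI impI)
  have hom: "lie_hom n_alg abelian_line \<phi>" using assms by (simp add: good_character_def)
  interpret whittaker_character \<phi> by unfold_locales (rule hom)
  {
    fix \<mm> assume max: "maximalideal \<mm> sym_center"
    then have sub: "\<mm> \<subseteq> carrier sym_center"
      by (auto intro: additive_subgroup.a_Hcarr ideal.axioms(1) maximalideal.axioms(1))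
    obtain \<xi> where \<mm>: "\<And>p. central p \<in> \<mm> \<longleftrightarrow> poly p \<xi> = 0"
      using maximalideal_sym_center[OF max] by blast
    let ?K = "{f. proj \<mm> f = proj \<mm> 0}"
    note K = proj_kernel[OF sub] proj_kernel_eigenvalue[OF \<mm> sub]
    from exists_whittaker_ideal[OF hom, of \<xi>] obtain W0 where "?K \<subseteq> W0" "1 \<notin> W0" using K(3) by blast
    then have "proj \<mm> 1 \<noteq> proj \<mm> 0" by blast
    moreover have "W = ?K \<or> 1 \<in> W" if W: "left_ideal W" "?K \<subseteq> W" for W
    proof -
      have "whittaker_ideal \<phi> W" using W K(1) unfolding whittaker_ideal_def by blast
      then show ?thesis using proper_extension_contains_one[OF assms K(1) _ W(2) _ K(2)] by blast
    qed
    moreover have "env_ideal b_alg \<subseteq> ?K" using K(1) by (simp add: whittaker_ideal_def)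
    ultimately show "simple_lie_module b_alg (whittaker_quotient \<phi> \<mm>)"
      using presents_simple_iff[OF proj_presents[OF sub]] by blast
  next
    fix V :: "(bvec, 'v) lie_mod"
    assume V: "whittaker_module \<phi> V \<and> simple_lie_module b_alg V"
    then have lie: "lie_module b_alg V" by (simp add: whittaker_module_def)
    from V obtain v where v: "whittaker_vector \<phi> V v" "\<Inter>{W. lie_submodule b_alg V W \<and> v \<in> W} = carrier V"
      by (auto simp: whittaker_module_def)
    then have vV: "v \<in> carrier V" by (simp add: whittaker_vector_def)
    define \<pi> where "\<pi> = (\<lambda>f. free_act V f v)"
    have pres: "presents \<pi> V" and \<pi>1: "\<pi> 1 = v" and I: "\<And>f. f \<in> env_ideal b_alg \<Longrightarrow> \<pi> f = \<zero>\<^bsub>V\<^esub>"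
      unfolding \<pi>_def using free_act_presents[OF lie vV v(2)] by blast+
    let ?J = "{f. \<pi> f = \<pi> 0}"
    have I: "env_ideal b_alg \<subseteq> ?J" using I by (auto simp: presents_simps(2)[OF pres])
    have ideal: "left_ideal ?J"
    proof (rule left_idealI)
      fix u w assume "u \<in> ?J" "w \<in> ?J"
      then show "u + w \<in> ?J"
        using presents_simps(3)[OF pres, of u w] presents_simps(3)[OF pres, of 0 0] by simp
    next
      fix c u assume "u \<in> ?J"
      then show "scale c u \<in> ?J"
        using presents_simps(4)[OF pres, of c u] presents_simps(4)[OF pres, of c 0] by simp
    next
      fix x u assume "u \<in> ?J"
      then show "gen x * u \<in> ?J"
        using presents_simps(5)[OF pres, of x u] presents_simps(5)[OF pres, of x 0] by simp
    qed simp
    have J: "whittaker_ideal \<phi> ?J"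
      unfolding whittaker_ideal_def
    proof (intro conjI ballI ideal I)
      fix x assume "x \<in> carrier n_alg"
      then have "\<pi> (gen x * 1) = \<pi> (scale (\<phi> x) 1)"
        using v(1) unfolding whittaker_vector_def \<pi>1[symmetric] presents_simps(4,5)[OF pres, symmetric] by blast
      then show "gen x - scale (\<phi> x) 1 \<in> ?J"
        by (simp only: mult_1_right presents_eq[OF pres, of "gen x"] mem_Collect_eq)
    qed
    have simple: "\<pi> 1 \<noteq> \<pi> 0" "\<And>W. left_ideal W \<Longrightarrow> ?J \<subseteq> W \<Longrightarrow> W = ?J \<or> 1 \<in> W"
      using V presents_simple_iff[OF pres I] by blast+
    then have "1 \<notin> ?J" by simp
    then obtain \<xi> where \<xi>: "zeta - scale \<xi> 1 \<in> ?J"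
      using maximal_central_eigenvalue[OF assms J _ simple(2)] by blast
    define \<mm> where "\<mm> = central ` {p. poly p \<xi> = 0}"
    have max: "maximalideal \<mm> sym_center"
      unfolding \<mm>_def by (rule maximalideal_eigenvalue[OF ideal I \<open>1 \<notin> ?J\<close> \<xi>])
    have sub: "\<mm> \<subseteq> carrier sym_center" unfolding \<mm>_def sym_center_carrier by blast
    \<comment> \<open>Membership in \<open>\<mm>\<close> directly gives only some polynomial of the
      same class that vanishes at \<open>\<xi>\<close>. But \<open>\<mm>\<close> is maximal, so it
      corresponds to evaluation at some \<open>\<xi>'\<close>, and \<open>X - \<xi>\<close> shows
      that \<open>\<xi>' = \<xi>\<close>.\<close>
    have \<mm>: "central p \<in> \<mm> \<longleftrightarrow> poly p \<xi> = 0" for p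
    proof
      assume "central p \<in> \<mm>"
      obtain \<xi>' where \<xi>': "\<And>p. central p \<in> \<mm> \<longleftrightarrow> poly p \<xi>' = 0"
        using maximalideal_sym_center[OF max] by blast
      have "central [:- \<xi>, 1:] \<in> \<mm>" unfolding \<mm>_def by (rule imageI) simp
      then have "\<xi>' = \<xi>" using \<xi>'[of "[:- \<xi>, 1:]"] by simp
      with \<xi>'[of p] \<open>central p \<in> \<mm>\<close> show "poly p \<xi> = 0" by simp
    qed (auto simp: \<mm>_def)
    let ?K = "{f. proj \<mm> f = proj \<mm> 0}"
    note K = proj_kernel[OF sub] proj_kernel_eigenvalue[OF \<mm> sub]
    have "?K = ?J"
    proof (rule ccontr)
      assume "?K \<noteq> ?J"
      from proper_extension_contains_one[OF assms K(1) J K(3)[OF J \<xi>] this K(2)] \<open>1 \<notin> ?J\<close> show False by blast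
    qed
    then have "lie_module_isomorphic b_alg V (whittaker_quotient \<phi> \<mm>)"
      by (intro presents_isomorphic[OF pres proj_presents[OF sub]]) blast
    with max show "\<exists>\<mm>. maximalideal \<mm> sym_center \<and> lie_module_isomorphic b_alg V (whittaker_quotient \<phi> \<mm>)"
      by blast
  }
qed

end
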